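(* Let $E$ be an arbitrary directed graph, and let $K$ be any field. Then the Leavitt path algebra $L_K(E)$ is primitive if and only if all three of the following hold: (i) $E$ satisfies Condition (MT3); (ii) $E$ satisfies Condition (L); (iii) $E^0$ has the Countable Separation Property.
   Context: A (directed) graph $E=(E^0,E^1,r,s)$ consists of two sets $E^0$ (vertices), $E^1$ (edges), of arbitrary cardinality, and functions $r,s:E^1\to E^0$ (range and source). A path is a finite sequence of edges $\mu=e_1\cdots e_n$ with $r(e_i)=s(e_{i+1})$ for $1\le i\le n-1$; $s(\mu)=s(e_1)$, $r(\mu)=r(e_n)$; vertices are regarded as paths of length $0$. For vertices $u,v$, write $u\ge v$ if there is a path $p$ (possibly of length $0$) with $s(p)=u$, $r(p)=v$. A cycle is a path $\mu=e_1\cdots e_n$ ($n\ge 1$) with $s(\mu)=r(\mu)$ and $s(e_i)\ne s(e_j)$ for $i\neq j$. An edge $e$ is an exit for $\mu=e_1\cdots e_n$ if there is an $i$ with $s(e)=s(e_i)$ and $e\ne e_i$. Condition (MT3): for every pair of vertices $v,w\in E^0$ there is a vertex $u\in E^0$ with $v\ge u$ and $w\ge u$. Condition (L): every cycle in $E$ has an exit. A subset $S\subseteq E^0$ has the Countable Separation Property (CSP) if there is an at most countable set $C(S)\subseteq E^0$ such that for every $w\in S$ there is some $v\in C(S)$ with $w\ge v$. The Leavitt path algebra $L_K(E)$ is the (associative, not necessarily unital) $K$-algebra generated by the set $\{v\mid v\in E^0\}\cup\{e,e^*\mid e\in E^1\}$ subject to the relations: (V) $vw=\delta_{v,w}v$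 for $v,w\in E^0$; (E1) $s(e)e=er(e)=e$ for $e\in E^1$; (E2) $r(e)e^*=e^*s(e)=e^*$ for $e\in E^1$; (CK1) $e^*e'=\delta_{e,e'}r(e)$ for $e,e'\in E^1$; (CK2) $v=\sum_{\{e\in E^1\mid s(e)=v\}}ee^*$ for every vertex $v$ with $1\le|s^{-1}(v)|<\infty$. A ring $R$ (possibly nonunital) is left primitive if it admits a simple faithful left $R$-module. Since $L_K(E)\cong L_K(E)^{op}$, left and right primitivity coincide for $L_K(E)$, and one simply says primitive. *)

theory Defs
  imports
    "Graph_Theory.Arc_Walk"
    "HOL-Algebra.QuotRing"
    "HOL-Algebra.Module"
    "HOL-Library.Poly_Mapping"
    "HOL-Library.Countable_Set"
begin

section \<open>Conditions on graphs\<close>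

text \<open>
  A graph is a \<^locale>\<open>wf_digraph\<close>: \<^const>\<open>verts\<close> and \<^const>\<open>arcs\<close> are arbitrary (possibly empty or
  uncountable) sets, with loops and parallel arcs allowed; \<^const>\<open>tail\<close> is the source map \<open>s\<close> and
  \<^const>\<open>head\<close> is the range map \<open>r\<close>. The preorder \<open>u \<ge> v\<close> is \<open>u \<rightarrow>\<^sup>*\<^bsub>G\<^esub> v\<close>. In
  \<^const>\<open>pre_digraph.cycle\<close> the condition \<open>distinct (tl (awalk_verts u p))\<close> says exactly that the
  sources of the arcs of the closed walk \<open>p\<close> are pairwise distinct: the tail of \<open>awalk_verts u p\<close>
  lists the sources of all arcs but the first, and then \<open>u\<close>, which is the source of the first one.
\<close>

definition condition_MT3 :: "('v,'e) pre_digraph \<Rightarrow> bool" where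
  "condition_MT3 G \<longleftrightarrow>
     (\<forall>v\<in>verts G. \<forall>w\<in>verts G. \<exists>u\<in>verts G. v \<rightarrow>\<^sup>*\<^bsub>G\<^esub> u \<and> w \<rightarrow>\<^sup>*\<^bsub>G\<^esub> u)"

definition is_exit :: "('v,'e) pre_digraph \<Rightarrow> 'e \<Rightarrow> 'e list \<Rightarrow> bool" where
  "is_exit G e p \<longleftrightarrow> e \<in> arcs G \<and> (\<exists>i<length p. tail G e = tail G (p ! i) \<and> e \<noteq> p ! i)"

definition condition_L :: "('v,'e) pre_digraph \<Rightarrow> bool" where
  "condition_L G \<longleftrightarrow> (\<forall>p. pre_digraph.cycle G p \<longrightarrow> (\<exists>e. is_exit G e p))"

definition countable_separation_property :: "('v,'e) pre_digraph \<Rightarrow> 'v set \<Rightarrow> bool" where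
  "countable_separation_property G S \<longleftrightarrow>
     (\<exists>C\<subseteq>verts G. countable C \<and> (\<forall>w\<in>S. \<exists>v\<in>C. w \<rightarrow>\<^sup>*\<^bsub>G\<^esub> v))"


section \<open>Free algebras\<close>

text \<open>
  Words under concatenation, as a separate type so that the type of lists gets no global
  \<^class>\<open>monoid_add\<close> structure. The type \<open>'x word \<Rightarrow>\<^sub>0 'k\<close> with the convolution product of
  \<^theory>\<open>HOL-Library.Poly_Mapping\<close> is then the free unital algebra on \<open>'x\<close> over \<open>'k\<close>.
\<close>

datatype 'x word = Word (letters: "'x list")

instantiation word :: (type) monoid_add
begin

definition zero_word :: "'a word" where
  "zero_word = Word []"

definition plus_word :: "'a word \<Rightarrow> 'a word \<Rightarrow> 'a word" where
  "u + v = Word (letters u @ letters v)"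

instance
  by standard (simp_all add: zero_word_def plus_word_def)

end

text \<open>
  The free non-unital algebra on the set \<open>X\<close>: linear combinations of non-empty words over \<open>X\<close>.
  The field \<^const>\<open>one\<close>, which the record type forces us to supply, lies outside the carrier.
\<close>

definition free_carrier :: "'x set \<Rightarrow> ('x word \<Rightarrow>\<^sub>0 'k::field) set" where
  "free_carrier X = {p. \<forall>w\<in>Poly_Mapping.keys p. letters w \<noteq> [] \<and> set (letters w) \<subseteq> X}"

definition free_algebra :: "'x set \<Rightarrow> ('x word \<Rightarrow>\<^sub>0 'k::field) ring" where
  "free_algebra X =
     \<lparr>carrier = free_carrier X, mult = (*), one = 1, zero = 0, add = (+)\<rparr>"

definition gen :: "'x \<Rightarrow> 'x word \<Rightarrow>\<^sub>0 'k::field" where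
  "gen x = Poly_Mapping.single (Word [x]) 1"

text \<open>
  The two-sided algebra ideal generated by \<open>S\<close>. Multiplication by \<open>Poly_Mapping.single 0 c\<close>, that
  is, by \<open>c\<close> times the empty word, is multiplication by the scalar \<open>c\<close>.
\<close>

inductive_set algebra_ideal ::
  "'x set \<Rightarrow> ('x word \<Rightarrow>\<^sub>0 'k::field) set \<Rightarrow> ('x word \<Rightarrow>\<^sub>0 'k) set"
  for X :: "'x set" and S :: "('x word \<Rightarrow>\<^sub>0 'k) set" where
  base: "p \<in> S \<Longrightarrow> p \<in> algebra_ideal X S"
| zero: "0 \<in> algebra_ideal X S"
| add: "p \<in> algebra_ideal X S \<Longrightarrow> q \<in> algebra_ideal X S \<Longrightarrow> p + q \<in> algebra_ideal X S"
| scale: "p \<in> algebra_ideal X S \<Longrightarrow> Poly_Mapping.single 0 c * p \<in> algebra_ideal X S"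
| left: "p \<in> algebra_ideal X S \<Longrightarrow> q \<in> free_carrier X \<Longrightarrow> q * p \<in> algebra_ideal X S"
| right: "p \<in> algebra_ideal X S \<Longrightarrow> q \<in> free_carrier X \<Longrightarrow> p * q \<in> algebra_ideal X S"


section \<open>Leavitt path algebras\<close>

datatype ('v,'e) lpa_gen = Vertex 'v | Edge 'e | Ghost 'e

definition lpa_gens :: "('v,'e) pre_digraph \<Rightarrow> ('v,'e) lpa_gen set" where
  "lpa_gens G = Vertex ` verts G \<union> Edge ` arcs G \<union> Ghost ` arcs G"

text \<open>A relation \<open>a = b\<close> is represented by the element \<open>a - b\<close>.\<close>

inductive_set lpa_relations ::
  "('v,'e) pre_digraph \<Rightarrow> (('v,'e) lpa_gen word \<Rightarrow>\<^sub>0 'k::field) set"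
  for G :: "('v,'e) pre_digraph" where
  V: "v \<in> verts G \<Longrightarrow> w \<in> verts G \<Longrightarrow>
      gen (Vertex v) * gen (Vertex w) - (if v = w then gen (Vertex v) else 0) \<in> lpa_relations G"
| E1_source: "e \<in> arcs G \<Longrightarrow>
      gen (Vertex (tail G e)) * gen (Edge e) - gen (Edge e) \<in> lpa_relations G"
| E1_range: "e \<in> arcs G \<Longrightarrow>
      gen (Edge e) * gen (Vertex (head G e)) - gen (Edge e) \<in> lpa_relations G"
| E2_range: "e \<in> arcs G \<Longrightarrow>
      gen (Vertex (head G e)) * gen (Ghost e) - gen (Ghost e) \<in> lpa_relations G"
| E2_source: "e \<in> arcs G \<Longrightarrow>
      gen (Ghost e) * gen (Vertex (tail G e)) - gen (Ghost e) \<in> lpa_relations G"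
| CK1: "e \<in> arcs G \<Longrightarrow> f \<in> arcs G \<Longrightarrow>
      gen (Ghost e) * gen (Edge f) - (if e = f then gen (Vertex (head G e)) else 0)
        \<in> lpa_relations G"
| CK2: "v \<in> verts G \<Longrightarrow> finite (out_arcs G v) \<Longrightarrow> out_arcs G v \<noteq> {} \<Longrightarrow>
      gen (Vertex v) - (\<Sum>e\<in>out_arcs G v. gen (Edge e) * gen (Ghost e)) \<in> lpa_relations G"

type_synonym ('v,'e,'k) lpa_elem = "(('v,'e) lpa_gen word \<Rightarrow>\<^sub>0 'k) set"

text \<open>Only the ring structure is recorded, since primitivity does not involve the scalars.\<close>

definition leavitt_path_algebra ::
  "('v,'e) pre_digraph \<Rightarrow> ('v,'e,'k::field) lpa_elem ring" where
  "leavitt_path_algebra G =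
     free_algebra (lpa_gens G) Quot algebra_ideal (lpa_gens G) (lpa_relations G)"


section \<open>Primitive rings\<close>

text \<open>
  The ring locales of the library are unital, and its \<^locale>\<open>module\<close> is over commutative rings.
  The \<^const>\<open>one\<close> field of \<open>R\<close> and the multiplicative fields of \<open>M\<close> play no role below.
\<close>

locale nonunital_ring = abelian_group R for R (structure) +
  assumes mult_closed: "\<lbrakk>a \<in> carrier R; b \<in> carrier R\<rbrakk> \<Longrightarrow> a \<otimes> b \<in> carrier R"
    and mult_assoc: "\<lbrakk>a \<in> carrier R; b \<in> carrier R; c \<in> carrier R\<rbrakk> \<Longrightarrow>
      (a \<otimes> b) \<otimes> c = a \<otimes> (b \<otimes> c)"
    and distrib_right: "\<lbrakk>a \<in> carrier R; b \<in> carrier R; c \<in> carrier R\<rbrakk> \<Longrightarrow>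
      (a \<oplus> b) \<otimes> c = a \<otimes> c \<oplus> b \<otimes> c"
    and distrib_left: "\<lbrakk>a \<in> carrier R; b \<in> carrier R; c \<in> carrier R\<rbrakk> \<Longrightarrow>
      a \<otimes> (b \<oplus> c) = a \<otimes> b \<oplus> a \<otimes> c"

locale left_module = R?: nonunital_ring R + M?: abelian_group M
  for R :: "('a,'r) ring_scheme" (structure) and M :: "('a,'b,'m) module_scheme" (structure) +
  assumes smult_closed: "\<lbrakk>a \<in> carrier R; x \<in> carrier M\<rbrakk> \<Longrightarrow> a \<odot>\<^bsub>M\<^esub> x \<in> carrier M"
    and smult_l_distr: "\<lbrakk>a \<in> carrier R; b \<in> carrier R; x \<in> carrier M\<rbrakk> \<Longrightarrow>
      (a \<oplus> b) \<odot>\<^bsub>M\<^esub> x = a \<odot>\<^bsub>M\<^esub> x \<oplus>\<^bsub>M\<^esub> b \<odot>\<^bsub>M\<^esub> x"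
    and smult_r_distr: "\<lbrakk>a \<in> carrier R; x \<in> carrier M; y \<in> carrier M\<rbrakk> \<Longrightarrow>
      a \<odot>\<^bsub>M\<^esub> (x \<oplus>\<^bsub>M\<^esub> y) = a \<odot>\<^bsub>M\<^esub> x \<oplus>\<^bsub>M\<^esub> a \<odot>\<^bsub>M\<^esub> y"
    and smult_assoc: "\<lbrakk>a \<in> carrier R; b \<in> carrier R; x \<in> carrier M\<rbrakk> \<Longrightarrow>
      (a \<otimes> b) \<odot>\<^bsub>M\<^esub> x = a \<odot>\<^bsub>M\<^esub> (b \<odot>\<^bsub>M\<^esub> x)"

definition simple_left_module ::
  "('a,'r) ring_scheme \<Rightarrow> ('a,'b,'m) module_scheme \<Rightarrow> bool" where
  "simple_left_module R M \<longleftrightarrow> left_module R M \<and> carrier M \<noteq> {\<zero>\<^bsub>M\<^esub>} \<and>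
     (\<forall>N. submodule N R M \<longrightarrow> N = {\<zero>\<^bsub>M\<^esub>} \<or> N = carrier M)"

definition faithful_left_module ::
  "('a,'r) ring_scheme \<Rightarrow> ('a,'b,'m) module_scheme \<Rightarrow> bool" where
  "faithful_left_module R M \<longleftrightarrow> left_module R M \<and>
     (\<forall>a\<in>carrier R. (\<forall>x\<in>carrier M. a \<odot>\<^bsub>M\<^esub> x = \<zero>\<^bsub>M\<^esub>) \<longrightarrow> a = \<zero>\<^bsub>R\<^esub>)"

text \<open>
  Some authors also require \<open>R M \<noteq> 0\<close> of a simple module over a non-unital ring. For a faithful
  module over a ring \<open>R \<noteq> 0\<close> this is automatic, so that the two conventions for primitivity differ
  only in that the zero ring is primitive for the one used here. Among the Leavitt path algebras,
  this concerns the algebra of the graph without vertices alone, which satisfies all three graph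
  conditions vacuously.

  The type of the elements of the module has to be fixed in the definition. Lemma
  \<open>left_primitiveI\<close> below shows that the choice of \<^typ>\<open>'a set\<close> is no restriction.
\<close>

definition left_primitive :: "('a,'r) ring_scheme \<Rightarrow> bool" where
  "left_primitive R \<longleftrightarrow>
     (\<exists>M :: ('a, 'a set) module. simple_left_module R M \<and> faithful_left_module R M)"

lemma left_primitive_transport:
  fixes M :: "('a,'b,'m) module_scheme" and f :: "'b \<Rightarrow> 'a set"
  assumes simple: "simple_left_module R M" and faithful: "faithful_left_module R M"
    and inj: "inj_on f (carrier M)"
  shows "left_primitive R"
proof -
  interpret left_module R M
    using simple by (simp add: simple_left_module_def)
  define g where "g = inv_into (carrier M) f"
  have gf [simp]: "g (f x) = x" if "x \<in> carrier M" for x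
    using inj that by (simp add: g_def)
  define M' :: "('a, 'a set) module" where
    "M' = \<lparr>carrier = f ` carrier M, mult = undefined, one = undefined, zero = f \<zero>\<^bsub>M\<^esub>,
       add = (\<lambda>x y. f (g x \<oplus>\<^bsub>M\<^esub> g y)), smult = (\<lambda>a x. f (a \<odot>\<^bsub>M\<^esub> g x))\<rparr>"
  have sel [simp]: "carrier M' = f ` carrier M" "\<zero>\<^bsub>M'\<^esub> = f \<zero>\<^bsub>M\<^esub>"
    "\<And>x y. x \<oplus>\<^bsub>M'\<^esub> y = f (g x \<oplus>\<^bsub>M\<^esub> g y)" "\<And>a x. a \<odot>\<^bsub>M'\<^esub> x = f (a \<odot>\<^bsub>M\<^esub> g x)"
    by (simp_all add: M'_def)
  have f_eq: "f x = f y \<longleftrightarrow> x = y" if "x \<in> carrier M" "y \<in> carrier M" for x y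
    using inj that by (auto dest: inj_onD)
  interpret M': abelian_group M'
  proof (rule abelian_groupI)
    show "\<exists>y\<in>carrier M'. y \<oplus>\<^bsub>M'\<^esub> x = \<zero>\<^bsub>M'\<^esub>" if "x \<in> carrier M'" for x
    proof -
      obtain m where "m \<in> carrier M" "x = f m"
        using \<open>x \<in> _\<close> by auto
      then show ?thesis
        by (intro bexI[of _ "f (\<ominus>\<^bsub>M\<^esub> m)"]) (auto simp: M.l_neg)
    qed
    show "x \<oplus>\<^bsub>M'\<^esub> y = y \<oplus>\<^bsub>M'\<^esub> x" if "x \<in> carrier M'" "y \<in> carrier M'" for x y
      using that by (auto intro!: arg_cong[where f = f] M.a_comm)
  qed (auto simp: M.a_assoc)
  have lm: "left_module R M'"
    apply unfold_locales
       apply (auto simp: smult_closed smult_l_distr smult_r_distr smult_assoc)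
    done
  have sub: "submodule (g ` N) R M" if "submodule N R M'" for N
  proof -
    interpret N: submodule N R M' by fact
    have Nsub: "N \<subseteq> f ` carrier M"
      using N.subset by simp
    have fg: "f (g x) = x" "g x \<in> carrier M" if "x \<in> N" for x
      using that Nsub by auto
    have cl: "g x \<oplus>\<^bsub>M\<^esub> g y \<in> g ` N" if "x \<in> N" "y \<in> N" for x y
    proof -
      have "g (f (g x \<oplus>\<^bsub>M\<^esub> g y)) \<in> g ` N"
        using N.m_closed[OF that] by (intro imageI) simp
      then show ?thesis
        using fg(2) that by simp
    qed
    have z: "\<zero>\<^bsub>M\<^esub> \<in> g ` N"
    proof -
      have "g (f \<zero>\<^bsub>M\<^esub>) \<in> g ` N"
        using N.one_closed by (intro imageI) simp
      then show ?thesis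
        by simp
    qed
    have iv: "\<ominus>\<^bsub>M\<^esub> g x \<in> g ` N" if x: "x \<in> N" for x
    proof -
      have inN: "\<ominus>\<^bsub>M'\<^esub> x \<in> N"
        using N.m_inv_closed[OF x] by (simp add: a_inv_def)
      have "\<ominus>\<^bsub>M'\<^esub> x \<oplus>\<^bsub>M'\<^esub> x = \<zero>\<^bsub>M'\<^esub>"
        using x Nsub by (intro M'.l_neg) auto
      then have "g (\<ominus>\<^bsub>M'\<^esub> x) \<oplus>\<^bsub>M\<^esub> g x = \<zero>\<^bsub>M\<^esub>"
        using fg[OF x] fg[OF inN] by (simp add: f_eq)
      then have "g (\<ominus>\<^bsub>M'\<^esub> x) = \<ominus>\<^bsub>M\<^esub> g x"
        using fg[OF x] fg[OF inN] by (metis M.minus_equality)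
      then show ?thesis
        using inN by (metis imageI)
    qed
    have sm: "a \<odot>\<^bsub>M\<^esub> g x \<in> g ` N" if "a \<in> carrier R" "x \<in> N" for a x
    proof -
      have "g (f (a \<odot>\<^bsub>M\<^esub> g x)) \<in> g ` N"
        using N.smult_closed[OF that] by (intro imageI) simp
      then show ?thesis
        using fg(2) that smult_closed by simp
    qed
    show ?thesis
    proof unfold_locales
      show "g ` N \<subseteq> carrier (add_monoid M)"
        using fg(2) by auto
      show "x \<otimes>\<^bsub>add_monoid M\<^esub> y \<in> g ` N" if "x \<in> g ` N" "y \<in> g ` N" for x y
        using that cl by auto
      show "\<one>\<^bsub>add_monoid M\<^esub> \<in> g ` N"
        using z by simp
      show "inv\<^bsub>add_monoid M\<^esub> x \<in> g ` N" if "x \<in> g ` N" for x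
        using that iv unfolding a_inv_def by auto
      show "a \<odot>\<^bsub>M\<^esub> x \<in> g ` N" if "a \<in> carrier R" "x \<in> g ` N" for a x
        using that sm by auto
    qed
  qed
  have "simple_left_module R M'"
    unfolding simple_left_module_def
  proof (intro conjI allI impI lm)
    have "f ` carrier M \<noteq> f ` {\<zero>\<^bsub>M\<^esub>}"
      using simple inj_on_image_eq_iff[OF inj, of "carrier M" "{\<zero>\<^bsub>M\<^esub>}"]
      by (auto simp: simple_left_module_def)
    then show "carrier M' \<noteq> {\<zero>\<^bsub>M'\<^esub>}"
      by simp
  next
    fix N assume N: "submodule N R M'"
    then have "N \<subseteq> f ` carrier M"
      using subgroup.subset[of N "add_monoid M'"] by (simp add: submodule_def)
    then have "f (g x) = x" if "x \<in> N" for x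
      using that by auto
    then have "f ` g ` N = N"
      by (simp add: image_image)
    moreover have "g ` N = {\<zero>\<^bsub>M\<^esub>} \<or> g ` N = carrier M"
      using simple sub[OF N] by (simp add: simple_left_module_def)
    ultimately show "N = {\<zero>\<^bsub>M'\<^esub>} \<or> N = carrier M'"
      by auto
  qed
  moreover have "faithful_left_module R M'"
    unfolding faithful_left_module_def
  proof (intro conjI ballI impI lm)
    fix a assume a: "a \<in> carrier R" and ann: "\<forall>x\<in>carrier M'. a \<odot>\<^bsub>M'\<^esub> x = \<zero>\<^bsub>M'\<^esub>"
    have "a \<odot>\<^bsub>M\<^esub> x = \<zero>\<^bsub>M\<^esub>" if "x \<in> carrier M" for x
      using ann that f_eq[OF smult_closed[OF a that] M.zero_closed] by simp
    then show "a = \<zero>\<^bsub>R\<^esub>"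
      using a faithful by (simp add: faithful_left_module_def)
  qed
  ultimately show ?thesis
    unfolding left_primitive_def by blast
qed

lemma left_primitiveI:
  fixes M :: "('a,'b,'m) module_scheme"
  assumes simple: "simple_left_module R M" and faithful: "faithful_left_module R M"
  shows "left_primitive R"
proof (cases "\<exists>x\<in>carrier M. \<exists>a\<in>carrier R. a \<odot>\<^bsub>M\<^esub> x \<noteq> \<zero>\<^bsub>M\<^esub>")
  case True
  interpret left_module R M
    using simple by (simp add: simple_left_module_def)
  obtain x a where x: "x \<in> carrier M" and a: "a \<in> carrier R" "a \<odot>\<^bsub>M\<^esub> x \<noteq> \<zero>\<^bsub>M\<^esub>"
    using True by blast
  let ?N = "(\<lambda>a. a \<odot>\<^bsub>M\<^esub> x) ` carrier R"
  have z: "\<zero>\<^bsub>R\<^esub> \<odot>\<^bsub>M\<^esub> x = \<zero>\<^bsub>M\<^esub>"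
    using smult_l_distr[OF R.zero_closed R.zero_closed x] smult_closed[OF R.zero_closed x]
    by (metis M.add.l_cancel_one R.l_zero R.zero_closed)
  have neg: "(\<ominus>\<^bsub>R\<^esub> b) \<odot>\<^bsub>M\<^esub> x = \<ominus>\<^bsub>M\<^esub> (b \<odot>\<^bsub>M\<^esub> x)" if "b \<in> carrier R" for b
    using smult_l_distr[OF R.a_inv_closed[OF that] that x] that z
    by (metis M.minus_equality R.a_inv_closed R.l_neg smult_closed x)
  have "submodule ?N R M"
  proof unfold_locales
    show "?N \<subseteq> carrier (add_monoid M)"
      using x smult_closed by auto
    show "u \<otimes>\<^bsub>add_monoid M\<^esub> v \<in> ?N" if uv: "u \<in> ?N" "v \<in> ?N" for u v
    proof -
      obtain b c where "b \<in> carrier R" "c \<in> carrier R" "u = b \<odot>\<^bsub>M\<^esub> x" "v = c \<odot>\<^bsub>M\<^esub> x"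
        using uv by blast
      then show ?thesis
        using smult_l_distr[of b c x] x by (intro image_eqI[of _ _ "b \<oplus>\<^bsub>R\<^esub> c"]) simp_all
    qed
    show "\<one>\<^bsub>add_monoid M\<^esub> \<in> ?N"
      using z by (intro image_eqI[of _ _ "\<zero>\<^bsub>R\<^esub>"]) simp_all
    show "inv\<^bsub>add_monoid M\<^esub> u \<in> ?N" if u: "u \<in> ?N" for u
    proof -
      obtain b where "b \<in> carrier R" "u = b \<odot>\<^bsub>M\<^esub> x"
        using u by blast
      then show ?thesis
        using neg[of b] by (intro image_eqI[of _ _ "\<ominus>\<^bsub>R\<^esub> b"]) (simp_all add: a_inv_def[of M])
    qed
    show "b \<odot>\<^bsub>M\<^esub> u \<in> ?N" if b: "b \<in> carrier R" and u: "u \<in> ?N" for b u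
    proof -
      obtain c where "c \<in> carrier R" "u = c \<odot>\<^bsub>M\<^esub> x"
        using u by blast
      then show ?thesis
        using smult_assoc[of b c x] mult_closed[of b c] b x
        by (intro image_eqI[of _ _ "b \<otimes>\<^bsub>R\<^esub> c"]) simp_all
    qed
  qed
  then have "?N = {\<zero>\<^bsub>M\<^esub>} \<or> ?N = carrier M"
    using simple by (simp add: simple_left_module_def)
  with a have N: "?N = carrier M"
    by blast
  have "inj_on (\<lambda>y. {b \<in> carrier R. b \<odot>\<^bsub>M\<^esub> x = y}) (carrier M)"
  proof (rule inj_onI)
    fix y z
    assume y: "y \<in> carrier M"
      and eq: "{b \<in> carrier R. b \<odot>\<^bsub>M\<^esub> x = y} = {b \<in> carrier R. b \<odot>\<^bsub>M\<^esub> x = z}"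
    obtain b where "b \<in> carrier R" "y = b \<odot>\<^bsub>M\<^esub> x"
      using y N by blast
    then have "b \<in> {b \<in> carrier R. b \<odot>\<^bsub>M\<^esub> x = y}"
      by simp
    then show "y = z"
      unfolding eq using \<open>y = _\<close> by simp
  qed
  then show ?thesis
    using left_primitive_transport simple faithful by blast
next
  case False
  interpret left_module R M
    using simple by (simp add: simple_left_module_def)
  have R0: "carrier R = {\<zero>\<^bsub>R\<^esub>}"
    using False faithful by (auto simp: faithful_left_module_def)
  define Z :: "('a, bool) module" where
    "Z = \<lparr>carrier = UNIV, mult = undefined, one = undefined, zero = False,
       add = (\<noteq>), smult = (\<lambda>a x. False)\<rparr>"
  have sel [simp]: "carrier Z = UNIV" "\<zero>\<^bsub>Z\<^esub> = False"
    "\<And>x y. x \<oplus>\<^bsub>Z\<^esub> y = (x \<noteq> y)" "\<And>a x. a \<odot>\<^bsub>Z\<^esub> x = False"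
    by (simp_all add: Z_def)
  interpret Z: abelian_group Z
    by (rule abelian_groupI) auto
  have lm: "left_module R Z"
    by unfold_locales auto
  have "N = {False} \<or> N = UNIV" if "submodule N R Z" for N
  proof -
    have "False \<in> N"
      using that subgroup.one_closed[of N "add_monoid Z"] by (simp add: submodule_def)
    then show ?thesis
      by (metis (full_types) UNIV_eq_I empty_iff insert_iff subsetI subset_antisym)
  qed
  then have "simple_left_module R Z"
    using lm by (auto simp: simple_left_module_def)
  moreover have "faithful_left_module R Z"
    using lm R0 by (simp add: faithful_left_module_def)
  moreover have "inj_on (\<lambda>b. if b then UNIV else ({} :: 'a set)) (carrier Z)"
    by (auto simp: inj_on_def split: if_splits)
  ultimately show ?thesis
    using left_primitive_transport by blast
qed

text \<open>The Leavitt path algebra is indeed a ring.\<close>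

lemma nonunital_ring_free_algebra: "nonunital_ring (free_algebra X)"
proof -
  have [simp]: "0 \<in> free_carrier X"
    by (simp add: free_carrier_def)
  have add: "p + q \<in> free_carrier X" if "p \<in> free_carrier X" "q \<in> free_carrier X"
    for p q :: "'a word \<Rightarrow>\<^sub>0 'b"
    using that keys_add[of p q] unfolding free_carrier_def by blast
  have mul: "p * q \<in> free_carrier X" if "p \<in> free_carrier X" "q \<in> free_carrier X"
    for p q :: "'a word \<Rightarrow>\<^sub>0 'b"
    using that keys_mult[of p q] unfolding free_carrier_def
    by (fastforce simp: plus_word_def)
  have neg: "- p \<in> free_carrier X" if "p \<in> free_carrier X" for p :: "'a word \<Rightarrow>\<^sub>0 'b"
    using that by (simp add: free_carrier_def)
  interpret abelian_group "free_algebra X :: ('a word \<Rightarrow>\<^sub>0 'b) ring"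
    apply (rule abelian_groupI)
         apply (auto simp: free_algebra_def add algebra_simps)
    using neg by (metis add.commute add.right_inverse)
  show ?thesis
    by unfold_locales (auto simp: free_algebra_def mul algebra_simps)
qed

lemma scale_closed: "p \<in> free_carrier X \<Longrightarrow> Poly_Mapping.single 0 c * p \<in> free_carrier X"
  using keys_mult[of "Poly_Mapping.single 0 c" p] unfolding free_carrier_def
  by (fastforce simp: plus_word_def zero_word_def split: if_splits)

lemma uminus_algebra_ideal:
  assumes "p \<in> algebra_ideal X S" shows "- p \<in> algebra_ideal X S"
  using algebra_ideal.scale[OF assms, of "- 1"]
  by (simp add: single_uminus)

lemma algebra_ideal_subset:
  assumes "S \<subseteq> free_carrier X" shows "algebra_ideal X S \<subseteq> free_carrier X"
proof
  fix p assume "p \<in> algebra_ideal X S"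
  interpret nonunital_ring "free_algebra X :: ('a word \<Rightarrow>\<^sub>0 'b) ring"
    by (rule nonunital_ring_free_algebra)
  from \<open>p \<in> _\<close> show "p \<in> free_carrier X"
    using zero_closed a_closed mult_closed
    by induction (use assms in \<open>auto simp: free_algebra_def scale_closed\<close>)
qed

lemma nonunital_ring_quotient:
  fixes S :: "('x word \<Rightarrow>\<^sub>0 'k::field) set"
  assumes S: "S \<subseteq> free_carrier X"
  shows "nonunital_ring (free_algebra X Quot algebra_ideal X S)"
proof -
  let ?F = "free_algebra X :: ('x word \<Rightarrow>\<^sub>0 'k) ring" and ?I = "algebra_ideal X S"
  interpret F: nonunital_ring ?F
    by (rule nonunital_ring_free_algebra)
  have sel [simp]: "carrier ?F = free_carrier X" "\<And>p q. p \<oplus>\<^bsub>?F\<^esub> q = p + q"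
    "\<And>p q. p \<otimes>\<^bsub>?F\<^esub> q = p * q" "\<zero>\<^bsub>?F\<^esub> = 0"
    by (simp_all add: free_algebra_def)
  note I_sub = algebra_ideal_subset[OF S]
  have uminus: "\<ominus>\<^bsub>?F\<^esub> p = - p" if "p \<in> ?I" for p
    using that I_sub uminus_algebra_ideal by (intro F.minus_equality) auto
  have "additive_subgroup ?I ?F"
    using I_sub uminus uminus_algebra_ideal
    by (intro additive_subgroup.intro subgroup.intro)
       (auto intro: algebra_ideal.zero algebra_ideal.add simp: uminus[unfolded a_inv_def, simplified])
  then interpret I: abelian_subgroup ?I ?F
    by (rule abelian_subgroupI3) (rule F.abelian_group_axioms)
  have coset: "?I +>\<^bsub>?F\<^esub> p = {q. q - p \<in> ?I}" for p
    by (force simp: a_r_coset_def' algebra_simps)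
  have mod: "?I +>\<^bsub>?F\<^esub> p = ?I +>\<^bsub>?F\<^esub> q \<longleftrightarrow> p - q \<in> ?I" for p q
  proof
    assume "?I +>\<^bsub>?F\<^esub> p = ?I +>\<^bsub>?F\<^esub> q"
    moreover have "p \<in> ?I +>\<^bsub>?F\<^esub> p"
      by (simp add: coset algebra_ideal.zero)
    ultimately show "p - q \<in> ?I"
      by (simp add: coset)
  next
    assume *: "p - q \<in> ?I"
    have "r - q \<in> ?I" if "r - p \<in> ?I" for r
      using algebra_ideal.add[OF that *] by simp
    moreover have "r - p \<in> ?I" if "r - q \<in> ?I" for r
      using algebra_ideal.add[OF that uminus_algebra_ideal[OF *]] by simp
    ultimately show "?I +>\<^bsub>?F\<^esub> p = ?I +>\<^bsub>?F\<^esub> q"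
      by (auto simp: coset)
  qed
  have mult: "rcoset_mult ?F ?I (?I +>\<^bsub>?F\<^esub> p) (?I +>\<^bsub>?F\<^esub> q) = ?I +>\<^bsub>?F\<^esub> (p * q)"
    if pq: "p \<in> free_carrier X" "q \<in> free_carrier X" for p q
  proof -
    have "?I +>\<^bsub>?F\<^esub> (p' * q') = ?I +>\<^bsub>?F\<^esub> (p * q)"
      if "p' \<in> ?I +>\<^bsub>?F\<^esub> p" "q' \<in> ?I +>\<^bsub>?F\<^esub> q" for p' q'
    proof -
      have d: "p' - p \<in> ?I" "q' - q \<in> ?I"
        using that by (auto simp: coset)
      have "p' = (p' - p) + p"
        by simp
      then have "p' \<in> free_carrier X"
        using d(1) I_sub pq F.a_closed[of "p' - p" p] by auto
      then have "p' * (q' - q) + (p' - p) * q \<in> ?I"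
        using d pq by (intro algebra_ideal.add algebra_ideal.left algebra_ideal.right)
      then show ?thesis
        by (simp add: mod algebra_simps)
    qed
    then have "rcoset_mult ?F ?I (?I +>\<^bsub>?F\<^esub> p) (?I +>\<^bsub>?F\<^esub> q) =
        (\<Union>a\<in>?I +>\<^bsub>?F\<^esub> p. \<Union>b\<in>?I +>\<^bsub>?F\<^esub> q. ?I +>\<^bsub>?F\<^esub> (p * q))"
      unfolding rcoset_mult_def sel by (intro SUP_cong refl)
    moreover have "p \<in> ?I +>\<^bsub>?F\<^esub> p" "q \<in> ?I +>\<^bsub>?F\<^esub> q"
      by (simp_all add: coset algebra_ideal.zero)
    then have "?I +>\<^bsub>?F\<^esub> p \<noteq> {}" "?I +>\<^bsub>?F\<^esub> q \<noteq> {}"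
      by (metis empty_iff)+
    ultimately show ?thesis
      by simp
  qed
  have sum: "(?I +>\<^bsub>?F\<^esub> p) <+>\<^bsub>?F\<^esub> (?I +>\<^bsub>?F\<^esub> q) = ?I +>\<^bsub>?F\<^esub> (p + q)"
    if "p \<in> free_carrier X" "q \<in> free_carrier X" for p q
    using I.a_rcos_sum[of p q] that by simp
  have Q: "carrier (?F Quot ?I) = (\<lambda>p. ?I +>\<^bsub>?F\<^esub> p) ` free_carrier X"
    "\<And>A B. A \<oplus>\<^bsub>?F Quot ?I\<^esub> B = A <+>\<^bsub>?F\<^esub> B"
    "\<And>A B. A \<otimes>\<^bsub>?F Quot ?I\<^esub> B = rcoset_mult ?F ?I A B"
    "\<zero>\<^bsub>?F Quot ?I\<^esub> = ?I +>\<^bsub>?F\<^esub> 0"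
    by (auto simp: FactRing_def A_RCOSETS_def' coset)
  have cl: "p + q \<in> free_carrier X" "p * q \<in> free_carrier X"
    if "p \<in> free_carrier X" "q \<in> free_carrier X" for p q :: "'x word \<Rightarrow>\<^sub>0 'k"
    using F.a_closed[of p q] F.mult_closed[of p q] that by auto
  have neg: "- p \<in> free_carrier X" if "p \<in> free_carrier X" for p :: "'x word \<Rightarrow>\<^sub>0 'k"
    using that by (simp add: free_carrier_def)
  have zero: "0 \<in> free_carrier X"
    by (simp add: free_carrier_def)
  interpret Q: abelian_group "?F Quot ?I"
  proof (rule abelian_groupI)
    show "\<exists>B\<in>carrier (?F Quot ?I). B \<oplus>\<^bsub>?F Quot ?I\<^esub> A = \<zero>\<^bsub>?F Quot ?I\<^esub>"
      if "A \<in> carrier (?F Quot ?I)" for A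
    proof -
      obtain p where "p \<in> free_carrier X" "A = ?I +>\<^bsub>?F\<^esub> p"
        using \<open>A \<in> _\<close> by (auto simp: Q)
      then show ?thesis
        by (intro bexI[of _ "?I +>\<^bsub>?F\<^esub> (- p)"]) (auto simp: Q sum neg)
    qed
    show "A \<oplus>\<^bsub>?F Quot ?I\<^esub> B = B \<oplus>\<^bsub>?F Quot ?I\<^esub> A"
      if "A \<in> carrier (?F Quot ?I)" "B \<in> carrier (?F Quot ?I)" for A B
      using that unfolding Q by (elim imageE) (simp add: sum add.commute)
    show "A \<oplus>\<^bsub>?F Quot ?I\<^esub> B \<oplus>\<^bsub>?F Quot ?I\<^esub> C =
        A \<oplus>\<^bsub>?F Quot ?I\<^esub> (B \<oplus>\<^bsub>?F Quot ?I\<^esub> C)"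
      if "A \<in> carrier (?F Quot ?I)" "B \<in> carrier (?F Quot ?I)" "C \<in> carrier (?F Quot ?I)"
      for A B C
      using that unfolding Q by (elim imageE) (simp add: sum cl add.assoc)
  qed (auto simp: Q sum cl zero)
  show ?thesis
  proof unfold_locales
    fix A B
    assume "A \<in> carrier (?F Quot ?I)" "B \<in> carrier (?F Quot ?I)"
    then show "A \<otimes>\<^bsub>?F Quot ?I\<^esub> B \<in> carrier (?F Quot ?I)"
      unfolding Q by (elim imageE) (simp add: mult cl)
  next
    fix A B C
    assume *: "A \<in> carrier (?F Quot ?I)" "B \<in> carrier (?F Quot ?I)" "C \<in> carrier (?F Quot ?I)"
    obtain p q r where pqr: "p \<in> free_carrier X" "q \<in> free_carrier X" "r \<in> free_carrier X"
      and ABC: "A = ?I +>\<^bsub>?F\<^esub> p" "B = ?I +>\<^bsub>?F\<^esub> q" "C = ?I +>\<^bsub>?F\<^esub> r"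
      using * unfolding Q by blast
    show "(A \<otimes>\<^bsub>?F Quot ?I\<^esub> B) \<otimes>\<^bsub>?F Quot ?I\<^esub> C = A \<otimes>\<^bsub>?F Quot ?I\<^esub> (B \<otimes>\<^bsub>?F Quot ?I\<^esub> C)"
      using pqr unfolding Q ABC by (simp add: mult cl mult.assoc)
    show "(A \<oplus>\<^bsub>?F Quot ?I\<^esub> B) \<otimes>\<^bsub>?F Quot ?I\<^esub> C =
        A \<otimes>\<^bsub>?F Quot ?I\<^esub> C \<oplus>\<^bsub>?F Quot ?I\<^esub> B \<otimes>\<^bsub>?F Quot ?I\<^esub> C"
      using pqr unfolding Q ABC by (simp add: mult sum cl distrib_right)
    show "A \<otimes>\<^bsub>?F Quot ?I\<^esub> (B \<oplus>\<^bsub>?F Quot ?I\<^esub> C) =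
        A \<otimes>\<^bsub>?F Quot ?I\<^esub> B \<oplus>\<^bsub>?F Quot ?I\<^esub> A \<otimes>\<^bsub>?F Quot ?I\<^esub> C"
      using pqr unfolding Q ABC by (simp add: mult sum cl distrib_left)
  qed
qed

theorem nonunital_ring_leavitt_path_algebra:
  assumes "wf_digraph G"
  shows "nonunital_ring (leavitt_path_algebra G)"
proof -
  interpret wf_digraph G by fact
  interpret F: nonunital_ring "free_algebra (lpa_gens G) :: (('a,'b) lpa_gen word \<Rightarrow>\<^sub>0 'c) ring"
    by (rule nonunital_ring_free_algebra)
  have add: "p + q \<in> free_carrier (lpa_gens G)"
    if "p \<in> free_carrier (lpa_gens G)" "q \<in> free_carrier (lpa_gens G)"
    for p q :: "('a,'b) lpa_gen word \<Rightarrow>\<^sub>0 'c"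
    using F.a_closed[of p q] that by (simp add: free_algebra_def)
  have mult: "p * q \<in> free_carrier (lpa_gens G)"
    if "p \<in> free_carrier (lpa_gens G)" "q \<in> free_carrier (lpa_gens G)"
    for p q :: "('a,'b) lpa_gen word \<Rightarrow>\<^sub>0 'c"
    using F.mult_closed[of p q] that by (simp add: free_algebra_def)
  have zero: "0 \<in> free_carrier (lpa_gens G)"
    by (simp add: free_carrier_def)
  have diff: "p - q \<in> free_carrier (lpa_gens G)"
    if "p \<in> free_carrier (lpa_gens G)" "q \<in> free_carrier (lpa_gens G)"
    for p q :: "('a,'b) lpa_gen word \<Rightarrow>\<^sub>0 'c"
    using that keys_diff[of p q] unfolding free_carrier_def by blast
  have gens: "v \<in> verts G \<Longrightarrow> gen (Vertex v) \<in> free_carrier (lpa_gens G)"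
    "e \<in> arcs G \<Longrightarrow> gen (Edge e) \<in> free_carrier (lpa_gens G)"
    "e \<in> arcs G \<Longrightarrow> gen (Ghost e) \<in> free_carrier (lpa_gens G)" for v e
    by (auto simp: free_carrier_def gen_def lpa_gens_def)
  have sum: "sum f A \<in> free_carrier (lpa_gens G)"
    if "\<And>x. x \<in> A \<Longrightarrow> f x \<in> free_carrier (lpa_gens G)"
    for f :: "'b \<Rightarrow> ('a,'b) lpa_gen word \<Rightarrow>\<^sub>0 'c" and A
    using that by (induction A rule: infinite_finite_induct) (auto simp: zero add)
  have "(lpa_relations G :: (('a,'b) lpa_gen word \<Rightarrow>\<^sub>0 'c) set) \<subseteq> free_carrier (lpa_gens G)"
  proof
    fix p :: "('a,'b) lpa_gen word \<Rightarrow>\<^sub>0 'c"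
    assume "p \<in> lpa_relations G"
    then show "p \<in> free_carrier (lpa_gens G)"
      by induction (auto intro!: diff mult sum gens zero)
  qed
  then show ?thesis
    unfolding leavitt_path_algebra_def by (rule nonunital_ring_quotient)
qed

end

theory Submission
  imports Defs "HOL-Library.Sublist"
begin

text \<open>
  Let \<open>F\<close> be the free algebra on the vertices \<open>v\<close>, the arcs \<open>e\<close> and their ghosts \<open>e\<^sup>*\<close>, and let \<open>I\<close> be
  the ideal of the relations. Modulo \<open>I\<close>, the space \<open>F\<close> is spanned by the monomials \<open>\<alpha>\<beta>\<^sup>*\<close> for pairs
  of paths \<open>\<alpha>\<close>, \<open>\<beta>\<close> with the same end (lemma \<open>F_lspan\<close>). If there are vertices, the Leavitt path algebra
  is primitive if and only if there is a maximal left ideal \<open>J \<supseteq> I\<close> of \<open>F\<close> such that \<open>pF \<subseteq> J\<close> implies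
  \<open>p \<in> I\<close>, that is, such that the simple module \<open>F / J\<close> is faithful. The proof is about such left
  ideals, which are called primitive ideals below.

  Necessity. No vertex is in \<open>I\<close>, because of a representation on a space of functions. Let \<open>J\<close> be a
  primitive ideal. As \<open>F / J\<close> is simple and faithful, \<open>vFw\<close> is not contained in \<open>I\<close> for vertices \<open>v\<close>
  and \<open>w\<close>, so that some monomial \<open>\<alpha>\<beta>\<^sup>*\<close> has \<open>\<alpha>\<close> starting at \<open>v\<close> and \<open>\<beta>\<close> at \<open>w\<close>; their common end proves
  (MT3). For the Countable Separation Property, fix \<open>x \<notin> J\<close>. For each vertex \<open>w\<close>, the ideal generated
  by \<open>w\<close> contains an element \<open>a w\<close> with \<open>(a w) x - x \<in> J\<close>. Hence no product \<open>(a z) (a w)\<close> is in \<open>I\<close>, and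
  paths that occur in \<open>a z\<close> and \<open>a w\<close> are comparable under the prefix order; a diagonal argument shows
  that countably many of the \<open>a w\<close> contain enough vertices (lemma \<open>CSP_if_primitive_ideal\<close>). If a cycle
  \<open>c\<close> at \<open>v\<close> has no exit, then \<open>vFv\<close> is commutative modulo \<open>I\<close>. A commutative ring with a simple
  faithful module is a field, so that \<open>v - c\<close> would be invertible in it, which the representation
  excludes (lemma \<open>L_if_primitive_ideal\<close>).

  Sufficiency. By (MT3) and the Countable Separation Property there are paths \<open>l 0, l 1, \<dots>\<close>, each
  an extension of the preceding one, such that every vertex reaches the end of some \<open>l n\<close>. The
  idempotents \<open>f n = (l n)(l n)\<^sup>*\<close> decrease, so that \<open>{a. \<exists>n. a (f n) \<in> I}\<close> is a left ideal. It does not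
  contain the source \<open>v\<close> of the paths, and a left ideal \<open>J\<close> that contains it and is maximal among those
  without \<open>v\<close> is a maximal left ideal. The annihilator \<open>H\<close> of \<open>F / J\<close> contains no vertex: with a vertex
  it would contain the end of some \<open>l n\<close>, hence \<open>f n\<close>, and as \<open>v - f n \<in> J\<close> this gives \<open>v \<in> J\<close>. Finally,
  under Condition (L) every two-sided ideal without vertices is contained in \<open>I\<close> (lemma
  \<open>two_sided_no_vertex\<close>).
\<close>

section \<open>The unital free algebra\<close>

lemma poly_mapping_expand:
  "p = (\<Sum>w\<in>Poly_Mapping.keys p. Poly_Mapping.single w (Poly_Mapping.lookup p w))"
  by (rule poly_mapping_eqI)
    (simp add: lookup_sum lookup_single when_def not_in_keys_iff_lookup_eq_zero)

lemma poly_mapping_single_induct [case_names zero add]: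
  fixes p :: "'a \<Rightarrow>\<^sub>0 'b::comm_monoid_add"
  assumes "P 0" and "\<And>w c p. P p \<Longrightarrow> P (Poly_Mapping.single w c + p)"
  shows "P p"
proof -
  have "P (\<Sum>w\<in>W. Poly_Mapping.single w (Poly_Mapping.lookup p w))" if "finite W" for W
    using that by (induction W) (auto intro: assms)
  then show ?thesis
    using poly_mapping_expand[of p] finite_keys by metis
qed

lemma scalar_central:
  fixes p :: "'x::monoid_add \<Rightarrow>\<^sub>0 'k::comm_ring_1"
  shows "p * Poly_Mapping.single 0 c = Poly_Mapping.single 0 c * p"
  by (induction p rule: poly_mapping_single_induct)
    (simp_all add: algebra_simps mult_single)

lemma lookup_times_single:
  fixes p :: "'x word \<Rightarrow>\<^sub>0 'k::field"
  shows "Poly_Mapping.lookup (p * Poly_Mapping.single (Word [x]) 1) (w + Word [x]) =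
    Poly_Mapping.lookup p w"
  by (induction p rule: poly_mapping_single_induct)
    (auto simp: algebra_simps mult_single lookup_add lookup_single plus_word_def when_def word.expand)

text \<open>
  The unital free algebra on \<open>X\<close>. The non-unital one, \<^term>\<open>free_carrier X\<close>, is an ideal in it, and
  so is every algebra ideal of \<^term>\<open>free_carrier X\<close>.
\<close>

definition unital_carrier :: "'x set \<Rightarrow> ('x word \<Rightarrow>\<^sub>0 'k::field) set" where
  "unital_carrier X = {p. \<forall>w\<in>Poly_Mapping.keys p. set (letters w) \<subseteq> X}"

lemma unital_carrier_closed:
  shows "0 \<in> unital_carrier X" "1 \<in> unital_carrier X"
    "Poly_Mapping.single 0 c \<in> unital_carrier X"
    "p \<in> unital_carrier X \<Longrightarrow> q \<in> unital_carrier X \<Longrightarrow> p + q \<in> unital_carrier X"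
    "p \<in> unital_carrier X \<Longrightarrow> q \<in> unital_carrier X \<Longrightarrow> p - q \<in> unital_carrier X"
    "p \<in> unital_carrier X \<Longrightarrow> q \<in> unital_carrier X \<Longrightarrow> p * q \<in> unital_carrier X"
    "p \<in> unital_carrier X \<Longrightarrow> - p \<in> unital_carrier X"
  unfolding unital_carrier_def
        apply (simp_all add: zero_word_def)
  using keys_add[of p q] apply blast
  using keys_diff[of p q] apply blast
  using keys_mult[of p q] apply (fastforce simp: plus_word_def)
  done

lemma free_carrier_closed:
  shows "0 \<in> free_carrier X"
    "p \<in> free_carrier X \<Longrightarrow> q \<in> free_carrier X \<Longrightarrow> p + q \<in> free_carrier X"
    "p \<in> free_carrier X \<Longrightarrow> q \<in> free_carrier X \<Longrightarrow> p - q \<in> free_carrier X"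
    "p \<in> unital_carrier X \<Longrightarrow> q \<in> free_carrier X \<Longrightarrow> p * q \<in> free_carrier X"
    "p \<in> free_carrier X \<Longrightarrow> q \<in> unital_carrier X \<Longrightarrow> p * q \<in> free_carrier X"
    "p \<in> free_carrier X \<Longrightarrow> - p \<in> free_carrier X"
  unfolding free_carrier_def unital_carrier_def
       apply simp_all
  using keys_add[of p q] apply blast
  using keys_diff[of p q] apply blast
  using keys_mult[of p q] apply (fastforce simp: plus_word_def)
  using keys_mult[of p q] apply (fastforce simp: plus_word_def)
  done

lemma free_carrier_subset: "free_carrier X \<subseteq> unital_carrier X"
  by (auto simp: free_carrier_def unital_carrier_def)

lemma unital_carrier_decomp:
  assumes "a \<in> unital_carrier X"
  obtains c p where "a = Poly_Mapping.single 0 c + p" "p \<in> free_carrier X"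
proof
  let ?c = "Poly_Mapping.lookup a 0" and ?p = "a - Poly_Mapping.single 0 (Poly_Mapping.lookup a 0)"
  show "a = Poly_Mapping.single 0 ?c + ?p" by simp
  have "Poly_Mapping.keys ?p \<subseteq> Poly_Mapping.keys a - {0}"
    by (auto simp: in_keys_iff lookup_minus lookup_single when_def split: if_splits)
  then show "?p \<in> free_carrier X"
    using assms unfolding free_carrier_def unital_carrier_def
    by (fastforce simp: zero_word_def word.expand)
qed

lemma algebra_ideal_unital:
  assumes "a \<in> unital_carrier X" "p \<in> algebra_ideal X S"
  shows "a * p \<in> algebra_ideal X S" "p * a \<in> algebra_ideal X S"
proof -
  obtain c q where a: "a = Poly_Mapping.single 0 c + q" "q \<in> free_carrier X"
    using unital_carrier_decomp[OF assms(1)] .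
  show "a * p \<in> algebra_ideal X S"
    using a assms(2) by (auto simp: algebra_simps intro: algebra_ideal.intros)
  show "p * a \<in> algebra_ideal X S"
    using a assms(2) by (auto simp: algebra_simps scalar_central intro: algebra_ideal.intros)
qed

section \<open>Calculation modulo the relations\<close>

text \<open>The parameter \<open>K\<close> only fixes the type of the scalars.\<close>

locale leavitt_path = wf_digraph G for G :: "('v,'e) pre_digraph" (structure) +
  fixes K :: "'k::field itself"
begin

text \<open>
  The free algebra \<open>F\<close>, the free unital algebra \<open>A\<close>, and the ideal \<open>I\<close>. The unit of \<open>A\<close> serves as the
  trivial path in products of arcs.
\<close>

definition F :: "(('v,'e) lpa_gen word \<Rightarrow>\<^sub>0 'k) set" where
  "F = free_carrier (lpa_gens G)"

definition A :: "(('v,'e) lpa_gen word \<Rightarrow>\<^sub>0 'k) set" where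
  "A = unital_carrier (lpa_gens G)"

definition I :: "(('v,'e) lpa_gen word \<Rightarrow>\<^sub>0 'k) set" where
  "I = algebra_ideal (lpa_gens G) (lpa_relations G)"

abbreviation C :: "'k \<Rightarrow> ('v,'e) lpa_gen word \<Rightarrow>\<^sub>0 'k" where
  "C c \<equiv> Poly_Mapping.single 0 c"

abbreviation V :: "'v \<Rightarrow> ('v,'e) lpa_gen word \<Rightarrow>\<^sub>0 'k" where
  "V v \<equiv> gen (Vertex v)"

abbreviation Ed :: "'e \<Rightarrow> ('v,'e) lpa_gen word \<Rightarrow>\<^sub>0 'k" where
  "Ed e \<equiv> gen (Edge e)"

abbreviation Gh :: "'e \<Rightarrow> ('v,'e) lpa_gen word \<Rightarrow>\<^sub>0 'k" where
  "Gh e \<equiv> gen (Ghost e)"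

text \<open>
  The elements \<open>P \<alpha> = \<alpha>\<close> and \<open>S \<alpha> = \<alpha>\<^sup>*\<close> for a list \<open>\<alpha>\<close> of arcs. Both are \<^term>\<open>1\<close> for the empty
  list, so that the vertex at which a trivial path sits has to be given by a separate factor.
\<close>

definition P :: "'e list \<Rightarrow> ('v,'e) lpa_gen word \<Rightarrow>\<^sub>0 'k" where
  "P \<alpha> = Poly_Mapping.single (Word (map Edge \<alpha>)) 1"

definition S :: "'e list \<Rightarrow> ('v,'e) lpa_gen word \<Rightarrow>\<^sub>0 'k" where
  "S \<alpha> = Poly_Mapping.single (Word (map Ghost (rev \<alpha>))) 1"

text \<open>Equality in the Leavitt path algebra, extended to \<open>A\<close>; membership in \<open>A\<close> is part of the relation.\<close>

definition eqv :: "(('v,'e) lpa_gen word \<Rightarrow>\<^sub>0 'k) \<Rightarrow> _ \<Rightarrow> bool" (infix "\<approx>" 50) where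
  "p \<approx> q \<longleftrightarrow> p \<in> A \<and> q \<in> A \<and> p - q \<in> I"

lemma P_Nil [simp]: "P [] = 1" and S_Nil [simp]: "S [] = 1"
  by (simp_all add: P_def S_def flip: zero_word_def)

lemma P_append: "P (\<alpha> @ \<beta>) = P \<alpha> * P \<beta>"
  by (simp add: P_def mult_single plus_word_def)

lemma S_append: "S (\<alpha> @ \<beta>) = S \<beta> * S \<alpha>"
  by (simp add: S_def mult_single plus_word_def)

lemma P_single: "P [e] = Ed e" and S_single: "S [e] = Gh e"
  by (simp_all add: P_def S_def gen_def)

lemma P_Cons: "P (e # \<alpha>) = Ed e * P \<alpha>"
  using P_append[of "[e]" \<alpha>] by (simp add: P_single)

lemma S_Cons: "S (e # \<alpha>) = S \<alpha> * Gh e"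
  using S_append[of "[e]" \<alpha>] by (simp add: S_single)

lemma C_central: "p * C c = C c * p"
  by (rule scalar_central)

lemma C_left: "p * (C c * q) = C c * (p * q)"
  by (metis C_central mult.assoc)

lemma C_mult: "C c * C d = C (c * d)"
  by (simp add: mult_single)

lemma A_closed [simp, intro]:
  "0 \<in> A" "1 \<in> A" "C c \<in> A"
  "p \<in> A \<Longrightarrow> q \<in> A \<Longrightarrow> p + q \<in> A" "p \<in> A \<Longrightarrow> q \<in> A \<Longrightarrow> p - q \<in> A"
  "p \<in> A \<Longrightarrow> q \<in> A \<Longrightarrow> p * q \<in> A" "p \<in> A \<Longrightarrow> - p \<in> A"
  unfolding A_def by (fact unital_carrier_closed)+

lemma A_sum [intro]: "(\<And>x. x \<in> M \<Longrightarrow> f x \<in> A) \<Longrightarrow> sum f M \<in> A"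
  by (induction M rule: infinite_finite_induct) auto

lemma F_closed [simp, intro]:
  "0 \<in> F" "p \<in> F \<Longrightarrow> q \<in> F \<Longrightarrow> p + q \<in> F" "p \<in> F \<Longrightarrow> q \<in> F \<Longrightarrow> p - q \<in> F"
  "p \<in> A \<Longrightarrow> q \<in> F \<Longrightarrow> p * q \<in> F" "p \<in> F \<Longrightarrow> q \<in> A \<Longrightarrow> p * q \<in> F" "p \<in> F \<Longrightarrow> - p \<in> F"
  unfolding A_def F_def by (fact free_carrier_closed)+

lemma F_in_A [simp, intro]: "p \<in> F \<Longrightarrow> p \<in> A"
  unfolding A_def F_def using free_carrier_subset by blast

lemma F_sum [intro]: "(\<And>x. x \<in> M \<Longrightarrow> f x \<in> F) \<Longrightarrow> sum f M \<in> F"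
  by (induction M rule: infinite_finite_induct) auto

lemma gens_F [simp, intro]:
  "v \<in> verts G \<Longrightarrow> V v \<in> F" "e \<in> arcs G \<Longrightarrow> Ed e \<in> F" "e \<in> arcs G \<Longrightarrow> Gh e \<in> F"
  by (auto simp: F_def free_carrier_def gen_def lpa_gens_def)

lemma P_A [simp, intro]: "set \<alpha> \<subseteq> arcs G \<Longrightarrow> P \<alpha> \<in> A"
  and S_A [simp, intro]: "set \<alpha> \<subseteq> arcs G \<Longrightarrow> S \<alpha> \<in> A"
  by (auto simp: P_def S_def A_def unital_carrier_def lpa_gens_def)

lemma relations_F: "p \<in> lpa_relations G \<Longrightarrow> p \<in> F"
  by (induction rule: lpa_relations.induct) (auto intro!: F_closed F_sum)

lemma I_F [simp, intro]: "p \<in> I \<Longrightarrow> p \<in> F"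
  unfolding I_def using algebra_ideal_subset[of "lpa_relations G" "lpa_gens G"] relations_F
  unfolding F_def by blast

lemma I_closed [simp, intro]:
  "0 \<in> I" "p \<in> I \<Longrightarrow> q \<in> I \<Longrightarrow> p + q \<in> I" "p \<in> I \<Longrightarrow> - p \<in> I"
  "p \<in> A \<Longrightarrow> q \<in> I \<Longrightarrow> p * q \<in> I" "p \<in> I \<Longrightarrow> q \<in> A \<Longrightarrow> p * q \<in> I"
  unfolding I_def A_def
  by (auto intro: algebra_ideal.intros uminus_algebra_ideal algebra_ideal_unital)

lemma I_diff [simp, intro]: "p \<in> I \<Longrightarrow> q \<in> I \<Longrightarrow> p - q \<in> I"
  using I_closed(2)[of p "- q"] by simp

lemma eqv_A: "p \<approx> q \<Longrightarrow> p \<in> A" "p \<approx> q \<Longrightarrow> q \<in> A"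
  by (simp_all add: eqv_def)

lemma eqv_refl [simp, intro]: "p \<in> A \<Longrightarrow> p \<approx> p"
  by (simp add: eqv_def)

lemma eqv_sym: "p \<approx> q \<Longrightarrow> q \<approx> p"
  unfolding eqv_def using I_closed(3)[of "p - q"] by simp

lemma eqv_trans [trans]: "p \<approx> q \<Longrightarrow> q \<approx> r \<Longrightarrow> p \<approx> r"
  unfolding eqv_def using I_closed(2)[of "p - q" "q - r"] by simp

lemma eqv_add: "p \<approx> p' \<Longrightarrow> q \<approx> q' \<Longrightarrow> p + q \<approx> p' + q'"
  unfolding eqv_def using I_closed(2)[of "p - p'" "q - q'"] by (simp add: algebra_simps)

lemma eqv_diff: "p \<approx> p' \<Longrightarrow> q \<approx> q' \<Longrightarrow> p - q \<approx> p' - q'"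
  unfolding eqv_def using I_diff[of "p - p'" "q - q'"] by (simp add: algebra_simps)

lemma eqv_mult: "p \<approx> p' \<Longrightarrow> q \<approx> q' \<Longrightarrow> p * q \<approx> p' * q'"
proof -
  assume *: "p \<approx> p'" "q \<approx> q'"
  have "p * q - p' * q' = p * (q - q') + (p - p') * q'"
    by (simp add: algebra_simps)
  moreover have "\<dots> \<in> I"
    using * by (intro I_closed) (auto simp: eqv_def)
  ultimately show ?thesis
    using * by (simp add: eqv_def)
qed

lemma eqv_left: "a \<in> A \<Longrightarrow> p \<approx> q \<Longrightarrow> a * p \<approx> a * q"
  and eqv_right: "a \<in> A \<Longrightarrow> p \<approx> q \<Longrightarrow> p * a \<approx> q * a"
  by (auto intro: eqv_mult)

lemma eqv_sum: "(\<And>x. x \<in> M \<Longrightarrow> f x \<approx> g x) \<Longrightarrow> sum f M \<approx> sum g M"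
  by (induction M rule: infinite_finite_induct) (auto intro: eqv_add)

lemma eqv_0_iff: "p \<approx> 0 \<longleftrightarrow> p \<in> I"
  unfolding eqv_def by (auto intro: I_F F_in_A)

lemma eqv_I: "p \<approx> q \<Longrightarrow> p \<in> I \<longleftrightarrow> q \<in> I"
  unfolding eqv_0_iff[symmetric] using eqv_sym eqv_trans by blast

lemma relation_eqv: "p - q \<in> lpa_relations G \<Longrightarrow> p \<in> A \<Longrightarrow> q \<in> A \<Longrightarrow> p \<approx> q"
  by (simp add: eqv_def I_def algebra_ideal.base)

lemma eqv_V: "v \<in> verts G \<Longrightarrow> w \<in> verts G \<Longrightarrow> V v * V w \<approx> (if v = w then V v else 0)"
  by (rule relation_eqv, rule lpa_relations.V) auto

lemma eqv_VV: "v \<in> verts G \<Longrightarrow> V v * V v \<approx> V v"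
  using eqv_V[of v v] by simp

lemma eqv_V_neq: "v \<in> verts G \<Longrightarrow> w \<in> verts G \<Longrightarrow> v \<noteq> w \<Longrightarrow> V v * V w \<approx> 0"
  using eqv_V[of v w] by simp

lemma eqv_E:
  assumes "e \<in> arcs G"
  shows "V (tail G e) * Ed e \<approx> Ed e" "Ed e * V (head G e) \<approx> Ed e"
    "V (head G e) * Gh e \<approx> Gh e" "Gh e * V (tail G e) \<approx> Gh e"
  using assms by (auto intro!: relation_eqv lpa_relations.intros)

lemma eqv_CK1: "e \<in> arcs G \<Longrightarrow> f \<in> arcs G \<Longrightarrow>
    Gh e * Ed f \<approx> (if e = f then V (head G e) else 0)"
  by (rule relation_eqv, rule lpa_relations.CK1) auto

lemma eqv_CK2: "v \<in> verts G \<Longrightarrow> finite (out_arcs G v) \<Longrightarrow> out_arcs G v \<noteq> {} \<Longrightarrow>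
    V v \<approx> (\<Sum>e\<in>out_arcs G v. Ed e * Gh e)"
  by (rule relation_eqv) (auto intro: lpa_relations.intros)

section \<open>Paths and monomials\<close>

lemma awalk_arcs [simp, intro]: "awalk u \<alpha> w \<Longrightarrow> set \<alpha> \<subseteq> arcs G"
  by (simp add: awalk_def)

lemma awalk_A [simp, intro]: "awalk u \<alpha> w \<Longrightarrow> P \<alpha> \<in> A" "awalk u \<alpha> w \<Longrightarrow> S \<alpha> \<in> A"
  by auto

lemma awalk_V [simp, intro]: "awalk u \<alpha> w \<Longrightarrow> V u \<in> F" "awalk u \<alpha> w \<Longrightarrow> V w \<in> F"
  by auto

lemma eqv_P: "awalk u \<alpha> w \<Longrightarrow> V u * P \<alpha> \<approx> P \<alpha> * V w"
proof (induction \<alpha> arbitrary: u)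
  case Nil
  then show ?case by (auto simp: awalk_Nil_iff)
next
  case (Cons e \<alpha>)
  then have e: "e \<in> arcs G" "u = tail G e" and w: "awalk (head G e) \<alpha> w"
    by (simp_all add: awalk_Cons_iff)
  have "V u * P (e # \<alpha>) = (V (tail G e) * Ed e) * P \<alpha>"
    by (simp add: P_Cons mult.assoc e)
  also have "\<dots> \<approx> Ed e * P \<alpha>"
    using e w by (intro eqv_right eqv_E) auto
  also have "\<dots> \<approx> (Ed e * V (head G e)) * P \<alpha>"
    using e w by (intro eqv_right eqv_sym[OF eqv_E(2)]) auto
  also have "\<dots> = Ed e * (V (head G e) * P \<alpha>)"
    by (simp add: mult.assoc)
  also have "\<dots> \<approx> Ed e * (P \<alpha> * V w)"
    using e by (intro eqv_left Cons.IH w) auto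
  also have "\<dots> = P (e # \<alpha>) * V w"
    by (simp add: P_Cons mult.assoc)
  finally show ?case .
qed

lemma eqv_S: "awalk u \<alpha> w \<Longrightarrow> S \<alpha> * V u \<approx> V w * S \<alpha>"
proof (induction \<alpha> arbitrary: u)
  case Nil
  then show ?case by (auto simp: awalk_Nil_iff)
next
  case (Cons e \<alpha>)
  then have e: "e \<in> arcs G" "u = tail G e" and w: "awalk (head G e) \<alpha> w"
    by (simp_all add: awalk_Cons_iff)
  have "S (e # \<alpha>) * V u = S \<alpha> * (Gh e * V (tail G e))"
    by (simp add: S_Cons mult.assoc e)
  also have "\<dots> \<approx> S \<alpha> * Gh e"
    using e w by (intro eqv_left eqv_E) auto
  also have "\<dots> \<approx> S \<alpha> * (V (head G e) * Gh e)"
    using e w by (intro eqv_left eqv_sym[OF eqv_E(3)]) auto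
  also have "\<dots> = (S \<alpha> * V (head G e)) * Gh e"
    by (simp add: mult.assoc)
  also have "\<dots> \<approx> (V w * S \<alpha>) * Gh e"
    using e by (intro eqv_right Cons.IH w) auto
  also have "\<dots> = V w * S (e # \<alpha>)"
    by (simp add: S_Cons mult.assoc)
  finally show ?case .
qed

text \<open>The laws for paths carry a vertex as a factor, so that they hold for trivial paths as well.\<close>

lemma eqv_VP: "awalk u \<alpha> w \<Longrightarrow> V u * (P \<alpha> * V w) \<approx> P \<alpha> * V w"
proof -
  assume w: "awalk u \<alpha> w"
  have "V u * (P \<alpha> * V w) = (V u * P \<alpha>) * V w"
    by (simp add: mult.assoc)
  also have "\<dots> \<approx> (P \<alpha> * V w) * V w"
    using w by (intro eqv_right eqv_P) auto
  also have "\<dots> = P \<alpha> * (V w * V w)"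
    by (simp add: mult.assoc)
  also have "\<dots> \<approx> P \<alpha> * V w"
    using w by (intro eqv_left eqv_VV) auto
  finally show ?thesis .
qed

lemma eqv_SV: "awalk u \<alpha> w \<Longrightarrow> V w * S \<alpha> * V u \<approx> V w * S \<alpha>"
proof -
  assume w: "awalk u \<alpha> w"
  have "V w * S \<alpha> * V u = V w * (S \<alpha> * V u)"
    by (simp add: mult.assoc)
  also have "\<dots> \<approx> V w * (V w * S \<alpha>)"
    using w by (intro eqv_left eqv_S) auto
  also have "\<dots> = (V w * V w) * S \<alpha>"
    by (simp add: mult.assoc)
  also have "\<dots> \<approx> V w * S \<alpha>"
    using w by (intro eqv_right eqv_VV) auto
  finally show ?thesis .
qed

lemma eqv_SVP: "awalk u \<alpha> w \<Longrightarrow> S \<alpha> * V u * P \<alpha> \<approx> V w"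
proof (induction \<alpha> arbitrary: u)
  case Nil
  then show ?case by (auto simp: awalk_Nil_iff)
next
  case (Cons e \<alpha>)
  then have e: "e \<in> arcs G" "u = tail G e" and w: "awalk (head G e) \<alpha> w"
    by (simp_all add: awalk_Cons_iff)
  have "S (e # \<alpha>) * V u * P (e # \<alpha>) = S \<alpha> * (Gh e * (V u * Ed e)) * P \<alpha>"
    by (simp add: S_Cons P_Cons mult.assoc)
  also have "\<dots> \<approx> S \<alpha> * (Gh e * Ed e) * P \<alpha>"
    unfolding e(2) using e w by (intro eqv_left eqv_right eqv_E) auto
  also have "\<dots> \<approx> S \<alpha> * V (head G e) * P \<alpha>"
    using e w eqv_CK1[of e e] by (intro eqv_left eqv_right) auto
  also have "\<dots> \<approx> V w"
    by (rule Cons.IH[OF w])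
  finally show ?case .
qed

lemma eqv_SPV: "awalk u \<alpha> w \<Longrightarrow> S \<alpha> * P \<alpha> * V w \<approx> V w"
proof -
  assume w: "awalk u \<alpha> w"
  have "S \<alpha> * P \<alpha> * V w = S \<alpha> * (P \<alpha> * V w)"
    by (simp add: mult.assoc)
  also have "\<dots> \<approx> S \<alpha> * (V u * P \<alpha>)"
    using w by (intro eqv_left eqv_sym[OF eqv_P]) auto
  also have "\<dots> \<approx> V w"
    using eqv_SVP[OF w] by (simp add: mult.assoc)
  finally show ?thesis .
qed

lemma eqv_cancel_prefix:
  assumes "awalk u \<alpha> v" "awalk v \<gamma> w"
  shows "S \<alpha> * P (\<alpha> @ \<gamma>) * V w \<approx> P \<gamma> * V w"
proof -
  have "S \<alpha> * P (\<alpha> @ \<gamma>) * V w = S \<alpha> * P \<alpha> * (P \<gamma> * V w)"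
    by (simp add: P_append mult.assoc)
  also have "\<dots> \<approx> S \<alpha> * P \<alpha> * (V v * (P \<gamma> * V w))"
    using assms by (intro eqv_left eqv_sym[OF eqv_VP]) auto
  also have "\<dots> = (S \<alpha> * P \<alpha> * V v) * (P \<gamma> * V w)"
    by (simp add: mult.assoc)
  also have "\<dots> \<approx> V v * (P \<gamma> * V w)"
    using assms by (intro eqv_right eqv_SPV) auto
  also have "\<dots> \<approx> P \<gamma> * V w"
    using assms by (intro eqv_VP)
  finally show ?thesis .
qed

lemma eqv_incomparable:
  assumes "awalk s \<alpha> u" "awalk t \<beta> w" "\<not> prefix \<alpha> \<beta>" "\<not> prefix \<beta> \<alpha>"
  shows "S \<alpha> * P \<beta> \<approx> 0"
  using assms
proof (induction \<alpha> arbitrary: s t \<beta>)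
  case Nil
  then show ?case by simp
next
  case (Cons e \<alpha>)
  then obtain f \<gamma> where \<beta>: "\<beta> = f # \<gamma>"
    by (cases \<beta>) auto
  have w: "e \<in> arcs G" "f \<in> arcs G" "awalk (head G e) \<alpha> u" "awalk (head G f) \<gamma> w"
    using Cons.prems by (auto simp: awalk_Cons_iff \<beta>)
  have *: "S (e # \<alpha>) * P \<beta> = S \<alpha> * (Gh e * Ed f) * P \<gamma>"
    by (simp add: S_Cons P_Cons \<beta> mult.assoc)
  show ?case
  proof (cases "e = f")
    case False
    have "S \<alpha> * (Gh e * Ed f) * P \<gamma> \<approx> S \<alpha> * 0 * P \<gamma>"
      using w False eqv_CK1[of e f] by (intro eqv_left eqv_right) auto
    then show ?thesis
      by (simp add: *)
  next
    case True
    then have inc: "\<not> prefix \<alpha> \<gamma>" "\<not> prefix \<gamma> \<alpha>"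
      using Cons.prems by (auto simp: \<beta>)
    then obtain g \<delta> where \<gamma>: "\<gamma> = g # \<delta>"
      by (cases \<gamma>) auto
    then have g: "g \<in> arcs G" "tail G g = head G e" "awalk (head G g) \<delta> w"
      using w True by (auto simp: awalk_Cons_iff)
    have "S \<alpha> * (Gh e * Ed f) * P \<gamma> \<approx> S \<alpha> * V (head G e) * P \<gamma>"
      using w True eqv_CK1[of e f] by (intro eqv_left eqv_right) auto
    also have "\<dots> = S \<alpha> * (V (tail G g) * Ed g * P \<delta>)"
      by (simp add: \<gamma> P_Cons mult.assoc g)
    also have "\<dots> \<approx> S \<alpha> * (Ed g * P \<delta>)"
      using g w by (intro eqv_left eqv_right eqv_E) auto
    also have "\<dots> = S \<alpha> * P \<gamma>"
      by (simp add: \<gamma> P_Cons)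
    also have "\<dots> \<approx> 0"
      using Cons.IH[OF w(3,4) inc] .
    finally show ?thesis
      by (simp add: *)
  qed
qed

text \<open>The monomial \<open>\<alpha>\<beta>\<^sup>*\<close> of two paths that end at \<open>u\<close>.\<close>

definition mon :: "'e list \<Rightarrow> 'v \<Rightarrow> 'e list \<Rightarrow> ('v,'e) lpa_gen word \<Rightarrow>\<^sub>0 'k" where
  "mon \<alpha> u \<beta> = P \<alpha> * V u * S \<beta>"

lemma mon_F [simp, intro]: "awalk s \<alpha> u \<Longrightarrow> awalk t \<beta> u \<Longrightarrow> mon \<alpha> u \<beta> \<in> F"
  by (auto simp: mon_def)

lemma V_mon: "awalk s \<alpha> u \<Longrightarrow> awalk t \<beta> u \<Longrightarrow> V s * mon \<alpha> u \<beta> \<approx> mon \<alpha> u \<beta>"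
  using eqv_right[OF _ eqv_VP, of "S \<beta>" s \<alpha> u] by (auto simp: mon_def mult.assoc)

lemma mon_V: "awalk s \<alpha> u \<Longrightarrow> awalk t \<beta> u \<Longrightarrow> mon \<alpha> u \<beta> * V t \<approx> mon \<alpha> u \<beta>"
  using eqv_left[OF _ eqv_SV, of "P \<alpha>" t \<beta> u] by (auto simp: mon_def mult.assoc)

lemma left_local_0:
  assumes "V s * p \<approx> p" "V v * V s \<approx> 0" "v \<in> verts G"
  shows "V v * p \<approx> 0"
proof -
  have pA: "p \<in> A" using assms(1) by (auto dest: eqv_A)
  have "V v * p \<approx> V v * (V s * p)"
    using assms by (intro eqv_left eqv_sym[OF assms(1)]) auto
  also have "\<dots> = (V v * V s) * p" by (simp add: mult.assoc)
  also have "\<dots> \<approx> 0 * p" using assms pA by (intro eqv_right) auto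
  finally show ?thesis by simp
qed

lemma right_local_0:
  assumes "p * V s \<approx> p" "V s * V v \<approx> 0" "v \<in> verts G"
  shows "p * V v \<approx> 0"
proof -
  have pA: "p \<in> A" using assms(1) by (auto dest: eqv_A)
  have "p * V v \<approx> (p * V s) * V v"
    using assms by (intro eqv_right eqv_sym[OF assms(1)]) auto
  also have "\<dots> = p * (V s * V v)" by (simp add: mult.assoc)
  also have "\<dots> \<approx> p * 0" using assms pA by (intro eqv_left) auto
  finally show ?thesis by simp
qed

lemma V_mon_0:
  assumes "awalk s \<alpha> u" "awalk t \<beta> u" "v \<in> verts G" "v \<noteq> s"
  shows "V v * mon \<alpha> u \<beta> \<approx> 0"
  using assms by (intro left_local_0[OF V_mon[OF assms(1,2)]] eqv_V_neq) auto

lemma mon_V_0: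
  assumes "awalk s \<alpha> u" "awalk t \<beta> u" "v \<in> verts G" "v \<noteq> t"
  shows "mon \<alpha> u \<beta> * V v \<approx> 0"
  using assms by (intro right_local_0[OF mon_V[OF assms(1,2)]] eqv_V_neq) auto

lemma mon_mult_0:
  assumes "awalk s \<alpha> u" "awalk t \<beta> u" "awalk s' \<gamma> w" "awalk t' \<delta> w"
    and "\<not> prefix \<beta> \<gamma>" "\<not> prefix \<gamma> \<beta>"
  shows "mon \<alpha> u \<beta> * mon \<gamma> w \<delta> \<approx> 0"
proof -
  have "mon \<alpha> u \<beta> * mon \<gamma> w \<delta> = P \<alpha> * V u * (S \<beta> * P \<gamma>) * (V w * S \<delta>)"
    by (simp add: mon_def mult.assoc)
  also have "\<dots> \<approx> P \<alpha> * V u * 0 * (V w * S \<delta>)"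
    using assms by (intro eqv_left eqv_right eqv_incomparable) auto
  finally show ?thesis by simp
qed

text \<open>The monomials \<open>\<alpha>\<beta>\<^sup>*\<close> for paths \<open>\<alpha>\<close>, \<open>\<beta>\<close> with a common end in \<open>U\<close>.\<close>

definition Mon :: "'v set \<Rightarrow> (('v,'e) lpa_gen word \<Rightarrow>\<^sub>0 'k) set" where
  "Mon U = {mon \<alpha> u \<beta> |\<alpha> u \<beta>. u \<in> U \<and> (\<exists>s. awalk s \<alpha> u) \<and> (\<exists>t. awalk t \<beta> u)}"

lemma MonI: "awalk s \<alpha> u \<Longrightarrow> awalk t \<beta> u \<Longrightarrow> u \<in> U \<Longrightarrow> mon \<alpha> u \<beta> \<in> Mon U"
  by (auto simp: Mon_def)

lemma Mon_F: "Mon U \<subseteq> F"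
  by (auto simp: Mon_def)

text \<open>
  Left multiplication by a generator maps a monomial to \<open>0\<close> or to a monomial, and moves the vertex in
  the middle only forward along the graph. The case that shifts it is \<open>e\<^sup>* \<beta>\<^sup>* = (\<beta>e)\<^sup>*\<close>.
\<close>

lemma gen_mon:
  assumes g: "g \<in> lpa_gens G" and w: "awalk s \<alpha> u" "awalk t \<beta> u"
  shows "gen g * mon \<alpha> u \<beta> \<approx> 0 \<or> (\<exists>m\<in>Mon {x. u \<rightarrow>\<^sup>* x}. gen g * mon \<alpha> u \<beta> \<approx> m)"
proof -
  have uu: "u \<rightarrow>\<^sup>* u" using w by auto
  consider (V) v where "g = Vertex v" "v \<in> verts G" | (E) e where "g = Edge e" "e \<in> arcs G"
    | (S) e where "g = Ghost e" "e \<in> arcs G"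
    using g by (auto simp: lpa_gens_def)
  then show ?thesis
  proof cases
    case V
    show ?thesis
    proof (cases "v = s")
      case True
      then show ?thesis using V V_mon[OF w] MonI[OF w] uu by blast
    next
      case False
      then show ?thesis using V V_mon_0[OF w] by blast
    qed
  next
    case E
    show ?thesis
    proof (cases "s = head G e")
      case True
      have "awalk (tail G e) (e # \<alpha>) u" using E w True by (simp add: awalk_Cons_iff)
      moreover have "gen g * mon \<alpha> u \<beta> = mon (e # \<alpha>) u \<beta>"
        using E by (simp add: mon_def P_Cons mult.assoc)
      moreover have "mon (e # \<alpha>) u \<beta> \<in> F" using calculation(1) w by blast
      ultimately show ?thesis
        using MonI[of "tail G e" "e # \<alpha>" u t \<beta> "{x. u \<rightarrow>\<^sup>* x}"] uu w by fastforce
    next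
      case False
      have "V (head G e) * mon \<alpha> u \<beta> \<approx> 0"
        using E w False by (intro V_mon_0[OF w]) auto
      have "gen g * mon \<alpha> u \<beta> \<approx> (Ed e * V (head G e)) * mon \<alpha> u \<beta>"
        using E w unfolding E(1) by (intro eqv_right eqv_sym[OF eqv_E(2)]) auto
      also have "\<dots> = Ed e * (V (head G e) * mon \<alpha> u \<beta>)" by (simp add: mult.assoc)
      also have "\<dots> \<approx> Ed e * 0"
        using E \<open>_ \<approx> 0\<close> by (intro eqv_left) auto
      finally show ?thesis by simp
    qed
  next
    case S
    show ?thesis
    proof (cases \<alpha>)
      case Nil
      then have su: "s = u" using w by (simp add: awalk_Nil_iff)
      show ?thesis
      proof (cases "u = tail G e")
        case True
        have w': "awalk t (\<beta> @ [e]) (head G e)"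
          using w S True by (auto simp: awalk_Cons_iff awalk_Nil_iff)
        have "gen g * mon \<alpha> u \<beta> = Gh e * V (tail G e) * S \<beta>"
          using S by (simp add: mon_def Nil True mult.assoc)
        also have "\<dots> \<approx> Gh e * S \<beta>"
          using S w by (intro eqv_right eqv_E) auto
        also have "\<dots> \<approx> V (head G e) * Gh e * S \<beta>"
          using S w by (intro eqv_right eqv_sym[OF eqv_E(3)]) auto
        also have "\<dots> = mon [] (head G e) (\<beta> @ [e])"
          by (simp add: mon_def S_append S_single mult.assoc)
        finally have "gen g * mon \<alpha> u \<beta> \<approx> mon [] (head G e) (\<beta> @ [e])" .
        moreover have "u \<rightarrow>\<^sup>* head G e"
          using S True by (metis arc_implies_awalk reachable_awalkI)
        ultimately show ?thesis
          using MonI[of "head G e" "[]" "head G e" t "\<beta> @ [e]"] w' S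
          by (auto simp: awalk_Nil_iff)
      next
        case False
        have "gen g * mon \<alpha> u \<beta> \<approx> Gh e * V (tail G e) * mon \<alpha> u \<beta>"
          using S w unfolding S(1) by (intro eqv_right eqv_sym[OF eqv_E(4)]) auto
        also have "\<dots> = Gh e * (V (tail G e) * mon \<alpha> u \<beta>)" by (simp add: mult.assoc)
        also have "\<dots> \<approx> Gh e * 0"
          using S w False su by (intro eqv_left V_mon_0[OF w]) auto
        finally show ?thesis by simp
      qed
    next
      case (Cons f \<alpha>')
      then have f: "f \<in> arcs G" and w': "awalk (head G f) \<alpha>' u"
        using w by (simp_all add: awalk_Cons_iff)
      have *: "gen g * mon \<alpha> u \<beta> = (Gh e * Ed f) * mon \<alpha>' u \<beta>"
        using S by (simp add: mon_def Cons P_Cons mult.assoc)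
      have **: "(Gh e * Ed f) * mon \<alpha>' u \<beta> \<approx> (if e = f then V (head G f) else 0) * mon \<alpha>' u \<beta>"
        using S f w' w eqv_CK1[of e f] by (intro eqv_right) auto
      show ?thesis
      proof (cases "e = f")
        case True
        have "gen g * mon \<alpha> u \<beta> \<approx> mon \<alpha>' u \<beta>"
          using * ** True eqv_trans[OF _ V_mon[OF w' w(2)]] by simp
        then show ?thesis using MonI[OF w' w(2)] uu by blast
      next
        case False
        then show ?thesis using * ** by simp
      qed
    qed
  qed
qed

section \<open>Linear spans modulo the relations\<close>

text \<open>The preimage in \<open>F\<close> of the linear span of the image of \<open>B\<close> in the Leavitt path algebra.\<close>

inductive_set lspan :: "(('v,'e) lpa_gen word \<Rightarrow>\<^sub>0 'k) set \<Rightarrow> (('v,'e) lpa_gen word \<Rightarrow>\<^sub>0 'k) set"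
  for B :: "(('v,'e) lpa_gen word \<Rightarrow>\<^sub>0 'k) set" where
  base: "b \<in> B \<Longrightarrow> b \<in> lspan B"
| ideal: "p \<in> I \<Longrightarrow> p \<in> lspan B"
| add: "p \<in> lspan B \<Longrightarrow> q \<in> lspan B \<Longrightarrow> p + q \<in> lspan B"
| scale: "p \<in> lspan B \<Longrightarrow> C c * p \<in> lspan B"

lemma lspan_F: "p \<in> lspan B \<Longrightarrow> B \<subseteq> F \<Longrightarrow> p \<in> F"
  by (induction rule: lspan.induct) auto

lemma lspan_eqv:
  assumes "p \<in> lspan B" "q \<approx> p" shows "q \<in> lspan B"
proof -
  have "q - p \<in> lspan B" using assms(2) by (auto simp: eqv_def intro: lspan.ideal)
  then have "p + (q - p) \<in> lspan B" using assms(1) by (intro lspan.add)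
  then show ?thesis by simp
qed

lemma lspan_uminus: "p \<in> lspan B \<Longrightarrow> - p \<in> lspan B"
  using lspan.scale[of p B "- 1"] by (simp add: single_uminus)

lemma lspan_diff: "p \<in> lspan B \<Longrightarrow> q \<in> lspan B \<Longrightarrow> p - q \<in> lspan B"
  using lspan.add[OF _ lspan_uminus, of p B q] by simp

lemma lspan_mono: "p \<in> lspan B \<Longrightarrow> B \<subseteq> lspan B' \<Longrightarrow> p \<in> lspan B'"
  by (induction rule: lspan.induct) (auto intro: lspan.intros)

lemma lspan_empty: "p \<in> lspan {} \<Longrightarrow> p \<in> I"
  by (induction rule: lspan.induct) auto

lemma lspan_left:
  assumes "p \<in> lspan B" "a \<in> A" "\<And>b. b \<in> B \<Longrightarrow> a * b \<in> lspan B'"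
  shows "a * p \<in> lspan B'"
  using assms(1)
  by (induction rule: lspan.induct)
    (auto simp: distrib_left C_left intro: lspan.intros assms(2,3))

lemma lspan_right:
  assumes "p \<in> lspan B" "a \<in> A" "\<And>b. b \<in> B \<Longrightarrow> b * a \<in> lspan B'"
  shows "p * a \<in> lspan B'"
  using assms(1)
  by (induction rule: lspan.induct)
    (auto simp: distrib_right mult.assoc intro: lspan.intros assms(2,3))

lemma lspan_finite:
  assumes "p \<in> lspan B" shows "\<exists>B0\<subseteq>B. finite B0 \<and> p \<in> lspan B0"
  using assms
proof (induction rule: lspan.induct)
  case (base b)
  then show ?case by (intro exI[of _ "{b}"]) (auto intro: lspan.base)
next
  case (add p q)
  then obtain B1 B2 where "B1 \<subseteq> B" "finite B1" "p \<in> lspan B1" "B2 \<subseteq> B" "finite B2" "q \<in> lspan B2"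
    by blast
  then show ?case
    by (intro exI[of _ "B1 \<union> B2"]) (auto intro!: lspan.add intro: lspan_mono lspan.base)
qed (auto intro: lspan.intros)

lemma lspan_mult_I:
  assumes "p \<in> lspan B" "q \<in> lspan B'" "B \<subseteq> A" "B' \<subseteq> F"
    and "\<And>b b'. b \<in> B \<Longrightarrow> b' \<in> B' \<Longrightarrow> b * b' \<in> I"
  shows "p * q \<in> I"
proof -
  have "b * q \<in> lspan {}" if "b \<in> B" for b
    using assms that by (intro lspan_left[OF assms(2)]) (auto intro: lspan.ideal)
  then have "p * q \<in> lspan {}"
    using assms lspan_F[OF assms(2,4)] by (intro lspan_right[OF assms(1)]) auto
  then show ?thesis by (rule lspan_empty)
qed

text \<open>
  For a set \<open>U\<close> of vertices that is closed under reachability, the monomials over \<open>U\<close> span a left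
  ideal; it does not matter whether \<open>U\<close> is saturated.
\<close>

lemma Mon_left:
  assumes "p \<in> lspan (Mon U)" "a \<in> A" and U: "\<And>u x. u \<in> U \<Longrightarrow> u \<rightarrow>\<^sup>* x \<Longrightarrow> x \<in> U"
  shows "a * p \<in> lspan (Mon U)"
proof -
  have g: "gen g * q \<in> lspan (Mon U)" if "g \<in> lpa_gens G" "q \<in> lspan (Mon U)" for g q
  proof (rule lspan_left[OF that(2)])
    show "gen g \<in> A" using that(1) by (auto simp: lpa_gens_def)
    fix b assume "b \<in> Mon U"
    then obtain \<alpha> u \<beta> s t where b: "b = mon \<alpha> u \<beta>" "u \<in> U" "awalk s \<alpha> u" "awalk t \<beta> u"
      by (auto simp: Mon_def)
    have "Mon {x. u \<rightarrow>\<^sup>* x} \<subseteq> Mon U"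
      using U[OF b(2)] unfolding Mon_def by blast
    then show "gen g * b \<in> lspan (Mon U)"
      using gen_mon[OF that(1) b(3,4)] b(1)
      by (auto intro: lspan_eqv[OF lspan.base] lspan_eqv[OF lspan.ideal])
  qed
  have w: "Poly_Mapping.single (Word l) 1 * p \<in> lspan (Mon U)" if "set l \<subseteq> lpa_gens G" for l
    using that
  proof (induction l)
    case Nil
    then show ?case using assms by (simp flip: zero_word_def)
  next
    case (Cons x l)
    have "Poly_Mapping.single (Word (x # l)) 1 * p = gen x * (Poly_Mapping.single (Word l) 1 * p)"
      by (simp add: gen_def mult_single plus_word_def flip: mult.assoc)
    then show ?case using Cons g by simp
  qed
  have "(\<Sum>w\<in>W. Poly_Mapping.single w (Poly_Mapping.lookup a w)) * p \<in> lspan (Mon U)"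
    if "finite W" "W \<subseteq> Poly_Mapping.keys a" for W
    using that
  proof (induction W)
    case empty
    then show ?case by (auto intro: lspan.ideal)
  next
    case (insert x W)
    have "Poly_Mapping.single x (Poly_Mapping.lookup a x) * p =
        C (Poly_Mapping.lookup a x) * (Poly_Mapping.single (Word (letters x)) 1 * p)"
      by (simp add: mult_single flip: mult.assoc)
    moreover have "set (letters x) \<subseteq> lpa_gens G"
      using insert.prems assms(2) by (auto simp: A_def unital_carrier_def)
    ultimately show ?case
      using insert w[of "letters x"] by (auto simp: distrib_right intro!: lspan.add lspan.scale)
  qed
  from this[of "Poly_Mapping.keys a"] show ?thesis
    using poly_mapping_expand[of a] by simp
qed

lemma gen_Mon:
  assumes "g \<in> lpa_gens G"
  shows "gen g \<in> lspan (Mon UNIV)"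
proof -
  consider (V) v where "g = Vertex v" "v \<in> verts G" | (E) e where "g = Edge e" "e \<in> arcs G"
    | (S) e where "g = Ghost e" "e \<in> arcs G"
    using assms by (auto simp: lpa_gens_def)
  then show ?thesis
  proof cases
    case V
    then have "gen g = mon [] v []" by (simp add: mon_def)
    then show ?thesis using V by (auto simp: awalk_Nil_iff intro!: lspan.base MonI)
  next
    case E
    have "mon [e] (head G e) [] \<in> lspan (Mon UNIV)"
      using E by (intro lspan.base MonI) (auto simp: awalk_simps)
    moreover have "gen g \<approx> mon [e] (head G e) []"
      using E by (simp add: mon_def P_single eqv_sym[OF eqv_E(2)])
    ultimately show ?thesis by (rule lspan_eqv)
  next
    case S
    have "mon [] (head G e) [e] \<in> lspan (Mon UNIV)"
      using S by (intro lspan.base MonI) (auto simp: awalk_simps)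
    moreover have "gen g \<approx> mon [] (head G e) [e]"
      using S by (simp add: mon_def S_single eqv_sym[OF eqv_E(3)])
    ultimately show ?thesis by (rule lspan_eqv)
  qed
qed

lemma F_lspan:
  assumes "p \<in> F" shows "p \<in> lspan (Mon UNIV)"
proof -
  have w: "Poly_Mapping.single w c \<in> lspan (Mon UNIV)"
    if "letters w \<noteq> []" "set (letters w) \<subseteq> lpa_gens G" for w and c :: 'k
  proof -
    note ne = that(1)
    obtain l x where l: "letters w = l @ [x]"
      using ne by (cases "letters w" rule: rev_cases) auto
    then have "w = Word l + Word [x]" by (simp add: plus_word_def flip: l)
    then have "Poly_Mapping.single w c = Poly_Mapping.single (Word l) c * gen x"
      by (simp add: gen_def mult_single)
    moreover have "Poly_Mapping.single (Word l) c \<in> A"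
      using that l by (auto simp: A_def unital_carrier_def)
    ultimately show ?thesis
      using that l by (auto intro!: Mon_left gen_Mon)
  qed
  have "(\<Sum>w\<in>W. Poly_Mapping.single w (Poly_Mapping.lookup p w)) \<in> lspan (Mon UNIV)"
    if "finite W" "W \<subseteq> Poly_Mapping.keys p" for W
    using that
  proof (induction W)
    case (insert x W)
    then have "letters x \<noteq> [] \<and> set (letters x) \<subseteq> lpa_gens G"
      using assms unfolding F_def free_carrier_def by blast
    then show ?case using insert w by (auto intro!: lspan.add)
  qed (auto intro: lspan.ideal)
  from this[of "Poly_Mapping.keys p"] show ?thesis
    using poly_mapping_expand[of p] by simp
qed

lemma V_F_lspan:
  assumes "w \<in> verts G" "p \<in> F"
  shows "V w * p \<in> lspan (Mon {u. w \<rightarrow>\<^sup>* u})"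
proof (rule lspan_left[OF F_lspan[OF assms(2)]])
  show "V w \<in> A" using assms by auto
  fix b assume "b \<in> Mon UNIV"
  then obtain \<alpha> u \<beta> s t where b: "b = mon \<alpha> u \<beta>" "awalk s \<alpha> u" "awalk t \<beta> u"
    by (auto simp: Mon_def)
  show "V w * b \<in> lspan (Mon {u. w \<rightarrow>\<^sup>* u})"
  proof (cases "w = s")
    case True
    then have "mon \<alpha> u \<beta> \<in> Mon {u. w \<rightarrow>\<^sup>* u}"
      using b by (auto intro!: MonI reachable_awalkI)
    then show ?thesis
      unfolding b(1) using V_mon[OF b(2,3)] True by (auto intro: lspan_eqv[OF lspan.base])
  next
    case False
    then show ?thesis
      unfolding b(1) using V_mon_0[OF b(2,3) assms(1)] by (auto intro: lspan_eqv[OF lspan.ideal])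
  qed
qed

section \<open>A representation on functions\<close>

text \<open>
  A family of injections \<open>h e\<close> of the set of lists into itself such that the images for distinct arcs
  \<open>e\<close> with the same source are disjoint, and cover all lists if these arcs are finite in number
  and there is at least one.
\<close>

definition splitting :: "('e \<Rightarrow> 'e list \<Rightarrow> 'e list) \<Rightarrow> bool" where
  "splitting h \<longleftrightarrow>
     (\<forall>e\<in>arcs G. \<forall>f\<in>arcs G. \<forall>l m. tail G e = tail G f \<longrightarrow> h e l = h f m \<longrightarrow> e = f \<and> l = m) \<and>
     (\<forall>v. finite (out_arcs G v) \<longrightarrow> out_arcs G v \<noteq> {} \<longrightarrow> (\<forall>l. \<exists>e\<in>out_arcs G v. \<exists>m. h e m = l))"

lemma ex_splitting:
  includes cardinal_syntax
  shows "\<exists>h. splitting h"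
proof -
  have "\<exists>g :: 'e \<times> 'e list \<Rightarrow> 'e list. inj_on g (out_arcs G v \<times> UNIV) \<and>
      (finite (out_arcs G v) \<longrightarrow> out_arcs G v \<noteq> {} \<longrightarrow> g ` (out_arcs G v \<times> UNIV) = UNIV)" for v
  proof (cases "finite (out_arcs G v) \<and> out_arcs G v \<noteq> {}")
    case True
    \<comment> \<open>An infinite set is equipotent to its product with a finite non-empty set.\<close>
    have inf: "infinite (UNIV :: 'e list set)"
      by (rule infinite_UNIV_listI)
    have "\<not> |UNIV :: 'e list set| \<le>o |out_arcs G v|"
      using card_of_ordLeq_finite[of "UNIV :: 'e list set" "out_arcs G v"] True inf by argo
    then have "|out_arcs G v| \<le>o |UNIV :: 'e list set|"
      using ordLeq_total[OF card_of_Well_order[of "out_arcs G v"]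
          card_of_Well_order[of "UNIV :: 'e list set"]] by argo
    then have "|out_arcs G v \<times> (UNIV :: 'e list set)| =o |UNIV :: 'e list set|"
      using card_of_Times_infinite[OF inf conjunct2[OF True]] by argo
    then have "\<exists>g. bij_betw g (out_arcs G v \<times> (UNIV :: 'e list set)) (UNIV :: 'e list set)"
      by (rule iffD2[OF card_of_ordIso])
    then obtain g where "bij_betw g (out_arcs G v \<times> (UNIV :: 'e list set)) (UNIV :: 'e list set)"
      by (rule exE)
    then show ?thesis
      by (auto simp: bij_betw_def)
  next
    case False
    then show ?thesis
      by (intro exI[of _ "\<lambda>(e, l). e # l"]) (auto simp: inj_on_def)
  qed
  then obtain g :: "'v \<Rightarrow> 'e \<times> 'e list \<Rightarrow> 'e list" where g: "inj_on (g v) (out_arcs G v \<times> UNIV)"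
    "finite (out_arcs G v) \<Longrightarrow> out_arcs G v \<noteq> {} \<Longrightarrow> g v ` (out_arcs G v \<times> UNIV) = UNIV" for v
    by metis
  have "splitting (\<lambda>e l. g (tail G e) (e, l))"
    unfolding splitting_def
  proof (intro conjI ballI allI impI)
    fix e f l m
    assume "e \<in> arcs G" "f \<in> arcs G" "tail G e = tail G f"
      "g (tail G e) (e, l) = g (tail G f) (f, m)"
    then have "(e, l) = (f, m)"
      by (intro inj_onD[OF g(1)[of "tail G f"]]) auto
    then show "e = f" "l = m" by auto
  next
    fix v l
    assume "finite (out_arcs G v)" "out_arcs G v \<noteq> {}"
    then have "l \<in> g v ` (out_arcs G v \<times> UNIV)" using g(2) by blast
    then show "\<exists>e\<in>out_arcs G v. \<exists>m. g (tail G e) (e, m) = l" by auto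
  qed
  then show ?thesis by blast
qed

definition splitter :: "'e \<Rightarrow> 'e list \<Rightarrow> 'e list" where
  "splitter = (SOME g. splitting g)"

lemma splitting_splitter: "splitting splitter"
  unfolding splitter_def by (rule someI_ex[OF ex_splitting])

lemma splitter_inj:
  "e \<in> arcs G \<Longrightarrow> f \<in> arcs G \<Longrightarrow> tail G e = tail G f \<Longrightarrow>
    splitter e l = splitter f m \<longleftrightarrow> e = f \<and> l = m"
  using splitting_splitter unfolding splitting_def by metis

lemma splitter_surj:
  "finite (out_arcs G v) \<Longrightarrow> out_arcs G v \<noteq> {} \<Longrightarrow> \<exists>e\<in>out_arcs G v. \<exists>m. splitter e m = l"
  using splitting_splitter unfolding splitting_def by metis

lemma inv_splitter [simp]: "e \<in> arcs G \<Longrightarrow> inv_into UNIV (splitter e) (splitter e l) = l"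
  by (rule inv_f_f) (auto simp: inj_def splitter_inj)

text \<open>
  The free algebra acts on all functions \<open>'v \<times> 'e list \<times> int \<Rightarrow> 'k\<close>: a vertex restricts to the points over
  it, and an arc \<open>e\<close> transports along the injection of the points over its range into those over its
  source that is given by \<open>splitter e\<close> and raises the integer by one. Its ghost is the inverse
  transport. As the supports need not be finite, a cycle without exit fixes the function that is
  constantly \<open>1\<close> over its base, although it moves each point.
\<close>

fun act :: "('v,'e) lpa_gen \<Rightarrow> ('v \<times> 'e list \<times> int \<Rightarrow> 'k) \<Rightarrow> 'v \<times> 'e list \<times> int \<Rightarrow> 'k" where
  "act (Vertex v) f (u, l, n) = (if u = v then f (u, l, n) else 0)"
| "act (Edge e) f (u, l, n) =
     (if u = tail G e \<and> l \<in> range (splitter e)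
      then f (head G e, inv_into UNIV (splitter e) l, n - 1) else 0)"
| "act (Ghost e) f (u, l, n) = (if u = head G e then f (tail G e, splitter e l, n + 1) else 0)"

lemma act_add: "act g (\<lambda>b. f b + f' b) = (\<lambda>b. act g f b + act g f' b)"
  by (rule ext, rename_tac b, case_tac b; cases g) auto

lemma act_scale: "act g (\<lambda>b. c * f b) = (\<lambda>b. c * act g f b)"
  by (rule ext, rename_tac b, case_tac b; cases g) auto

definition actw :: "('v,'e) lpa_gen list \<Rightarrow> ('v \<times> 'e list \<times> int \<Rightarrow> 'k) \<Rightarrow> 'v \<times> 'e list \<times> int \<Rightarrow> 'k" where
  "actw l = foldr act l"

lemma actw_add: "actw l (\<lambda>b. f b + f' b) = (\<lambda>b. actw l f b + actw l f' b)"
  by (induction l) (simp_all add: actw_def act_add)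

lemma actw_scale: "actw l (\<lambda>b. c * f b) = (\<lambda>b. c * actw l f b)"
  by (induction l) (simp_all add: actw_def act_scale)

lemma actw_append: "actw (l @ m) f = actw l (actw m f)"
  by (simp add: actw_def)

text \<open>The action of an element of the free algebra, by linear extension.\<close>

definition rep :: "(('v,'e) lpa_gen word \<Rightarrow>\<^sub>0 'k) \<Rightarrow> ('v \<times> 'e list \<times> int \<Rightarrow> 'k) \<Rightarrow> 'v \<times> 'e list \<times> int \<Rightarrow> 'k" where
  "rep p f b = (\<Sum>w\<in>Poly_Mapping.keys p. Poly_Mapping.lookup p w * actw (letters w) f b)"

lemma rep_superset:
  assumes "finite W" "Poly_Mapping.keys p \<subseteq> W"
  shows "rep p f b = (\<Sum>w\<in>W. Poly_Mapping.lookup p w * actw (letters w) f b)"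
  unfolding rep_def using assms by (intro sum.mono_neutral_left) (auto simp: in_keys_iff)

lemma rep_add: "rep (p + q) f = (\<lambda>b. rep p f b + rep q f b)"
proof
  fix b
  let ?W = "Poly_Mapping.keys p \<union> Poly_Mapping.keys q"
  have "Poly_Mapping.keys (p + q) \<subseteq> ?W" by (rule keys_add)
  then show "rep (p + q) f b = rep p f b + rep q f b"
    by (subst (1 2 3) rep_superset[of ?W])
      (auto simp: lookup_add distrib_right sum.distrib)
qed

lemma rep_single: "rep (Poly_Mapping.single w c) f = (\<lambda>b. c * actw (letters w) f b)"
  by (rule ext, subst rep_superset[of "{w}"]) auto

lemma rep_zero [simp]: "rep 0 f = (\<lambda>b. 0)"
  by (rule ext) (simp add: rep_def)

lemma rep_gen: "rep (gen g) f = act g f"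
  by (simp add: gen_def rep_single actw_def)

lemma rep_scale: "rep p (\<lambda>b. c * f b) = (\<lambda>b. c * rep p f b)"
  by (rule ext) (simp add: rep_def actw_scale sum_distrib_left mult.left_commute)

lemma rep_add_right: "rep p (\<lambda>b. f b + f' b) = (\<lambda>b. rep p f b + rep p f' b)"
  by (rule ext) (simp add: rep_def actw_add sum.distrib distrib_left)

lemma rep_0_right: "rep p (\<lambda>b. 0) = (\<lambda>b. 0)"
  using rep_scale[of p 0 "\<lambda>b. 0"] by simp

lemma rep_uminus: "rep (- p) f = (\<lambda>b. - rep p f b)"
  using rep_add[of p "- p" f] by (auto simp: fun_eq_iff eq_neg_iff_add_eq_0 add.commute)

lemma rep_diff: "rep (p - q) f = (\<lambda>b. rep p f b - rep q f b)"
  using rep_add[of p "- q" f] by (simp add: rep_uminus)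

lemma rep_sum: "rep (sum p M) f b = (\<Sum>x\<in>M. rep (p x) f b)"
  by (induction M rule: infinite_finite_induct) (auto simp: rep_add)

lemma rep_mult: "rep (p * q) f = rep p (rep q f)"
proof (induction p rule: poly_mapping_single_induct)
  case zero
  then show ?case by simp
next
  case (add w c p)
  have "rep (Poly_Mapping.single w c * q) f = rep (Poly_Mapping.single w c) (rep q f)"
  proof (induction q rule: poly_mapping_single_induct)
    case zero
    then show ?case by (simp add: rep_0_right)
  next
    case (add w' c' q)
    then show ?case
      by (simp add: distrib_left rep_add mult_single rep_single rep_add_right actw_scale actw_add
          plus_word_def actw_append mult.assoc)
  qed
  then show ?case
    using add by (simp add: distrib_right rep_add)
qed

lemma rep_relation:
  assumes "p \<in> lpa_relations G" shows "rep p f = (\<lambda>b. 0)"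
proof
  fix b :: "'v \<times> 'e list \<times> int"
  obtain u l n where b: "b = (u, l, n)" by (cases b)
  from assms show "rep p f b = 0"
  proof cases
    case (CK1 e f')
    have "act (Ghost e) (act (Edge f') f) b = (if e = f' then act (Vertex (head G e)) f b else 0)"
      using CK1 by (auto simp: b image_iff splitter_inj)
    then show ?thesis
      using CK1 by (simp add: rep_diff rep_mult rep_gen)
  next
    case (CK2 v)
    have "(\<Sum>e\<in>out_arcs G v. act (Edge e) (act (Ghost e) f) b) = act (Vertex v) f b"
    proof (cases "u = v")
      case True
      obtain e m where e: "e \<in> arcs G" "tail G e = v" and l: "l = splitter e m"
        using splitter_surj[OF CK2(3,4), of l] by auto
      have "act (Edge e') (act (Ghost e') f) b = (if e' = e then f b else 0)"
        if "e' \<in> out_arcs G v" for e'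
        using that e by (auto simp: b l True image_iff splitter_inj)
      then have "(\<Sum>e'\<in>out_arcs G v. act (Edge e') (act (Ghost e') f) b) =
          (\<Sum>e'\<in>out_arcs G v. if e' = e then f b else 0)"
        by (intro sum.cong) auto
      also have "\<dots> = f b" using e CK2(3) by simp
      finally show ?thesis by (simp add: b True)
    next
      case False
      then show ?thesis by (simp add: b)
    qed
    then show ?thesis
      using CK2 by (simp add: rep_diff rep_sum rep_mult rep_gen)
  qed (auto simp: rep_diff rep_mult rep_gen b)
qed

lemma rep_I:
  assumes "p \<in> I" shows "rep p f = (\<lambda>b. 0)"
  using assms unfolding I_def
  by (induction arbitrary: f rule: algebra_ideal.induct)
    (simp_all add: rep_relation rep_add rep_mult rep_0_right)

lemma notin_I: "rep p f b \<noteq> 0 \<Longrightarrow> p \<notin> I"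
  using rep_I[of p f] by auto

lemma rep_1 [simp]: "rep 1 f = f"
  using rep_single[of 0 1 f] by (simp add: actw_def) (simp add: zero_word_def)

lemma V_notin_I: "V v \<notin> I"
proof
  assume "V v \<in> I"
  then have "rep (V v) (\<lambda>b. 1) (v, [], 0) = 0" by (simp add: rep_I)
  then show False by (simp add: rep_gen)
qed

lemma rep_P_degree:
  assumes "\<And>u l n. n \<noteq> d \<Longrightarrow> f (u, l, n) = 0" "n \<noteq> d + int (length \<alpha>)"
  shows "rep (P \<alpha>) f (u, l, n) = 0"
  using assms(2)
proof (induction \<alpha> arbitrary: u l n)
  case Nil
  then show ?case using assms(1) by simp
next
  case (Cons e \<alpha>)
  then show ?case by (simp add: P_Cons rep_mult rep_gen)
qed

text \<open>
  Let \<open>T\<close> be a set of vertices each of which emits exactly one arc, into \<open>T\<close> again. For a path in \<open>T\<close>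
  from \<open>u\<close> to \<open>w\<close>, the action is a bijection of the points over \<open>w\<close> onto the points over \<open>u\<close>.
\<close>

lemma rep_P_indicator:
  assumes "\<And>u. u \<in> T \<Longrightarrow> \<exists>e. out_arcs G u = {e} \<and> head G e \<in> T"
    and "awalk u \<alpha> w" "u \<in> T"
  shows "rep (P \<alpha>) (\<lambda>b. if fst b = w then 1 else 0) = (\<lambda>b. if fst b = u then 1 else 0)"
  using assms(2,3)
proof (induction \<alpha> arbitrary: u)
  case Nil
  then show ?case by (simp add: awalk_Nil_iff)
next
  case (Cons e \<alpha>)
  then have e: "e \<in> arcs G" "tail G e = u" "awalk (head G e) \<alpha> w"
    by (auto simp: awalk_Cons_iff)
  obtain e' where "out_arcs G u = {e'}" "head G e' \<in> T"
    using assms(1) Cons.prems by blast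
  moreover have "e \<in> out_arcs G u" using e by simp
  ultimately have out: "out_arcs G u = {e}" "head G e \<in> T"
    by auto
  have IH: "rep (P \<alpha>) (\<lambda>b. if fst b = w then 1 else 0) = (\<lambda>b. if fst b = head G e then 1 else 0)"
    using Cons.IH[OF e(3) out(2)] .
  have "l \<in> range (splitter e)" for l
    using splitter_surj[of u l] unfolding out by auto
  then have "act (Edge e) (\<lambda>b. if fst b = head G e then 1 else 0) (x, l, n) = (if x = u then 1 else 0)"
    for x l n
    using e by simp
  then show ?case
    by (simp add: P_Cons rep_mult IH rep_gen fun_eq_iff)
qed

text \<open>
  So \<open>v - c\<close> is not zero, as it does not annihilate the characteristic function of a point, and it has
  no left inverse, as it annihilates the characteristic function of the points over \<open>v\<close>.
\<close>

lemma exitless_cycle_notin_I: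
  assumes "\<And>u. u \<in> T \<Longrightarrow> \<exists>e. out_arcs G u = {e} \<and> head G e \<in> T"
    and "awalk v c v" "v \<in> T" "c \<noteq> []"
  shows "V v - P c * V v \<notin> I" "V v - r * (V v - P c * V v) \<notin> I"
proof -
  let ?f = "\<lambda>(x, l, n). if x = v \<and> l = [] \<and> n = 0 then 1 else (0 :: 'k)"
  have f: "act (Vertex v) ?f = ?f"
    by auto
  have "rep (V v - P c * V v) ?f (v, [], 0) = 1 - rep (P c) ?f (v, [], 0)"
    by (simp add: rep_diff rep_mult rep_gen f)
  also have "rep (P c) ?f (v, [], 0) = 0"
    using assms(4) by (intro rep_P_degree[where d = 0]) auto
  finally have "rep (V v - P c * V v) ?f (v, [], 0) \<noteq> 0"
    by simp
  then show "V v - P c * V v \<notin> I"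
    by (rule notin_I)
  let ?g = "\<lambda>b. if fst b = v then 1 else (0 :: 'k)"
  have g: "act (Vertex v) ?g = ?g"
    by (simp add: fun_eq_iff)
  have "rep (V v - P c * V v) ?g = (\<lambda>b. 0)"
    using rep_P_indicator[OF assms(1-3)] by (simp add: rep_diff rep_mult rep_gen g)
  then have "rep (V v - r * (V v - P c * V v)) ?g (v, [], 0) \<noteq> 0"
    by (simp add: rep_diff[of "V v" "r * (V v - P c * V v)"] rep_mult[of r] rep_0_right rep_gen)
  then show "V v - r * (V v - P c * V v) \<notin> I"
    by (rule notin_I)
qed

section \<open>Primitivity in terms of left ideals of the free algebra\<close>

definition left_ideal :: "(('v,'e) lpa_gen word \<Rightarrow>\<^sub>0 'k) set \<Rightarrow> bool" where
  "left_ideal J \<longleftrightarrow> J \<subseteq> F \<and> 0 \<in> J \<and> (\<forall>p\<in>J. \<forall>q\<in>J. p + q \<in> J) \<and> (\<forall>p\<in>J. - p \<in> J) \<and>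
     (\<forall>a\<in>F. \<forall>p\<in>J. a * p \<in> J)"

text \<open>
  The maximal left ideals \<open>J\<close> for which the simple module \<open>F / J\<close> is one of the Leavitt path algebra,
  and a faithful one.
\<close>

definition primitive_ideal :: "(('v,'e) lpa_gen word \<Rightarrow>\<^sub>0 'k) set \<Rightarrow> bool" where
  "primitive_ideal J \<longleftrightarrow> left_ideal J \<and> I \<subseteq> J \<and> J \<noteq> F \<and>
     (\<forall>J'. left_ideal J' \<longrightarrow> J \<subseteq> J' \<longrightarrow> J' = J \<or> J' = F) \<and>
     (\<forall>p\<in>F. (\<forall>q\<in>F. p * q \<in> J) \<longrightarrow> p \<in> I)"

lemma left_idealD:
  assumes "left_ideal J"
  shows "J \<subseteq> F" "0 \<in> J" "p \<in> J \<Longrightarrow> q \<in> J \<Longrightarrow> p + q \<in> J" "p \<in> J \<Longrightarrow> - p \<in> J"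
    "a \<in> F \<Longrightarrow> p \<in> J \<Longrightarrow> a * p \<in> J" "p \<in> J \<Longrightarrow> q \<in> J \<Longrightarrow> p - q \<in> J"
proof -
  show "J \<subseteq> F" "0 \<in> J" "a \<in> F \<Longrightarrow> p \<in> J \<Longrightarrow> a * p \<in> J"
    and add: "p \<in> J \<Longrightarrow> q \<in> J \<Longrightarrow> p + q \<in> J" and neg: "p \<in> J \<Longrightarrow> - p \<in> J" for p q
    using assms by (simp_all add: left_ideal_def)
  show "p - q \<in> J" if "p \<in> J" "q \<in> J"
    using add[OF that(1) neg[OF that(2)]] by simp
qed

text \<open>The Leavitt path algebra, and the projection of \<open>F\<close> onto it.\<close>

abbreviation L :: "('v,'e,'k) lpa_elem ring" where
  "L \<equiv> leavitt_path_algebra G"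

definition proj :: "(('v,'e) lpa_gen word \<Rightarrow>\<^sub>0 'k) \<Rightarrow> ('v,'e,'k) lpa_elem" where
  "proj p = {q. q - p \<in> I}"

lemma proj_self [simp]: "p \<in> proj p"
  by (simp add: proj_def)

lemma proj_eq: "proj p = proj q \<longleftrightarrow> p - q \<in> I"
proof
  assume "proj p = proj q"
  then have "p \<in> proj q" using proj_self by blast
  then show "p - q \<in> I" by (simp add: proj_def)
next
  assume pq: "p - q \<in> I"
  have "r - p \<in> I \<longleftrightarrow> r - q \<in> I" for r
    using I_closed(2)[OF _ pq, of "r - p"] I_diff[OF _ pq, of "r - q"] by auto
  then show "proj p = proj q" by (simp add: proj_def)
qed

lemma proj_F: "p \<in> F \<Longrightarrow> q \<in> proj p \<Longrightarrow> q \<in> F"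
  using F_closed(2)[of "q - p" p] by (auto simp: proj_def)

lemma coset_proj: "I +>\<^bsub>free_algebra (lpa_gens G)\<^esub> p = proj p"
  by (force simp: a_r_coset_def' proj_def free_algebra_def algebra_simps)

lemma L_carrier: "carrier L = proj ` F"
  by (auto simp: leavitt_path_algebra_def FactRing_def A_RCOSETS_def' F_def free_algebra_def
      simp flip: coset_proj I_def)

lemma L_zero: "\<zero>\<^bsub>L\<^esub> = proj 0"
  by (simp add: leavitt_path_algebra_def FactRing_def proj_def flip: I_def)

lemma L_add: "proj p \<oplus>\<^bsub>L\<^esub> proj q = proj (p + q)"
proof -
  have "proj p \<oplus>\<^bsub>L\<^esub> proj q = {x + y |x y. x \<in> proj p \<and> y \<in> proj q}"
    by (auto simp: leavitt_path_algebra_def FactRing_def set_add_def' free_algebra_def)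
  also have "\<dots> = proj (p + q)"
  proof (intro equalityI subsetI)
    fix z assume "z \<in> {x + y |x y. x \<in> proj p \<and> y \<in> proj q}"
    then obtain x y where "z = x + y" "x - p \<in> I" "y - q \<in> I"
      by (auto simp: proj_def)
    then show "z \<in> proj (p + q)"
      using I_closed(2)[of "x - p" "y - q"] by (simp add: proj_def algebra_simps)
  next
    fix z assume "z \<in> proj (p + q)"
    then have "z = (z - q) + q" "z - q \<in> proj p" "q \<in> proj q"
      by (simp_all add: proj_def algebra_simps)
    then show "z \<in> {x + y |x y. x \<in> proj p \<and> y \<in> proj q}" by blast
  qed
  finally show ?thesis .
qed

lemma L_mult:
  assumes "p \<in> F" "q \<in> F"
  shows "proj p \<otimes>\<^bsub>L\<^esub> proj q = proj (p * q)"
proof -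
  have "proj p \<otimes>\<^bsub>L\<^esub> proj q = (\<Union>x\<in>proj p. \<Union>y\<in>proj q. proj (x * y))"
    by (simp add: leavitt_path_algebra_def FactRing_def rcoset_mult_def coset_proj flip: I_def)
      (simp add: free_algebra_def)
  also have "\<dots> = (\<Union>x\<in>proj p. \<Union>y\<in>proj q. proj (p * q))"
  proof (intro SUP_cong refl)
    fix x y assume "x \<in> proj p" "y \<in> proj q"
    then have "x \<approx> p" "y \<approx> q"
      using assms proj_F by (auto simp: eqv_def proj_def)
    then show "proj (x * y) = proj (p * q)"
      using eqv_mult by (auto simp: proj_eq eqv_def)
  qed
  also have "\<dots> = proj (p * q)"
    using proj_self[of p] proj_self[of q] by blast
  finally show ?thesis .
qed

lemma L_ring: "nonunital_ring L"
  by (rule nonunital_ring_leavitt_path_algebra) unfold_locales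

lemma submoduleI:
  fixes M :: "(('v,'e,'k) lpa_elem, 'b) module"
  assumes "left_module L M" "N \<subseteq> carrier M" "\<zero>\<^bsub>M\<^esub> \<in> N"
    "\<And>x y. x \<in> N \<Longrightarrow> y \<in> N \<Longrightarrow> x \<oplus>\<^bsub>M\<^esub> y \<in> N" "\<And>x. x \<in> N \<Longrightarrow> \<ominus>\<^bsub>M\<^esub> x \<in> N"
    "\<And>p x. p \<in> F \<Longrightarrow> x \<in> N \<Longrightarrow> proj p \<odot>\<^bsub>M\<^esub> x \<in> N"
  shows "submodule N L M"
  using assms(2-) unfolding a_inv_def by unfold_locales (auto simp: L_carrier)

lemma primitive_ideal_if_left_primitive:
  assumes prim: "left_primitive L" and "verts G \<noteq> {}"
  obtains J where "primitive_ideal J"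
proof -
  obtain M :: "(('v,'e,'k) lpa_elem, ('v,'e,'k) lpa_elem set) module"
    where simple: "simple_left_module L M" and faithful: "faithful_left_module L M"
    using prim unfolding left_primitive_def by blast
  interpret left_module L M
    using simple by (simp add: simple_left_module_def)
  obtain v where v: "v \<in> verts G" using assms(2) by blast
  have cl [simp]: "proj p \<odot>\<^bsub>M\<^esub> x \<in> carrier M" if "p \<in> F" "x \<in> carrier M" for p x
    using that smult_closed L_carrier by blast
  have add: "proj (p + q) \<odot>\<^bsub>M\<^esub> x = proj p \<odot>\<^bsub>M\<^esub> x \<oplus>\<^bsub>M\<^esub> proj q \<odot>\<^bsub>M\<^esub> x"
    if "p \<in> F" "q \<in> F" "x \<in> carrier M" for p q x
    using smult_l_distr[of "proj p" "proj q" x] that by (simp add: L_carrier L_add)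
  have mult: "proj (p * q) \<odot>\<^bsub>M\<^esub> x = proj p \<odot>\<^bsub>M\<^esub> (proj q \<odot>\<^bsub>M\<^esub> x)"
    if "p \<in> F" "q \<in> F" "x \<in> carrier M" for p q x
    using smult_assoc[of "proj p" "proj q" x] that by (simp add: L_carrier L_mult)
  have zero: "proj 0 \<odot>\<^bsub>M\<^esub> x = \<zero>\<^bsub>M\<^esub>" if "x \<in> carrier M" for x
    using add[of 0 0 x] that by (metis F_closed(1) M.add.l_cancel_one' add.right_neutral cl)
  have uminus: "proj (- p) \<odot>\<^bsub>M\<^esub> x = \<ominus>\<^bsub>M\<^esub> (proj p \<odot>\<^bsub>M\<^esub> x)" if "p \<in> F" "x \<in> carrier M" for p x
    using add[of "- p" p x] that zero[of x]
    by (intro M.minus_equality[symmetric]) auto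
  have ideal: "proj p \<odot>\<^bsub>M\<^esub> x = \<zero>\<^bsub>M\<^esub>" if "p \<in> I" "x \<in> carrier M" for p x
    using proj_eq[of p 0] zero[of x] that by simp
  have right_zero: "proj p \<odot>\<^bsub>M\<^esub> \<zero>\<^bsub>M\<^esub> = \<zero>\<^bsub>M\<^esub>" if "p \<in> F" for p
    using mult[of p 0 "\<zero>\<^bsub>M\<^esub>"] zero[of "\<zero>\<^bsub>M\<^esub>"] that by simp
  have "proj (V v) \<noteq> \<zero>\<^bsub>L\<^esub>" "proj (V v) \<in> carrier L"
    using V_notin_I[of v] v by (auto simp: L_zero proj_eq L_carrier)
  then obtain x where x: "x \<in> carrier M" and vx: "proj (V v) \<odot>\<^bsub>M\<^esub> x \<noteq> \<zero>\<^bsub>M\<^esub>"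
    using faithful unfolding faithful_left_module_def by blast
  \<comment> \<open>The module is \<open>F / J\<close> for the annihilator \<open>J\<close> of an element \<open>x\<close> on which the action is not trivial.\<close>
  define J where "J = {p \<in> F. proj p \<odot>\<^bsub>M\<^esub> x = \<zero>\<^bsub>M\<^esub>}"
  have J: "left_ideal J"
    using x by (auto simp: left_ideal_def J_def add mult zero uminus right_zero)
  have sub: "submodule ((\<lambda>p. proj p \<odot>\<^bsub>M\<^esub> x) ` J') L M" if "left_ideal J'" for J'
  proof (rule submoduleI)
    show "left_module L M" by unfold_locales
    note J' = left_idealD[OF that]
    show "(\<lambda>p. proj p \<odot>\<^bsub>M\<^esub> x) ` J' \<subseteq> carrier M"
      using x J'(1) by auto
    show "\<zero>\<^bsub>M\<^esub> \<in> (\<lambda>p. proj p \<odot>\<^bsub>M\<^esub> x) ` J'"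
      using J'(2) zero[OF x] by (intro image_eqI[of _ _ 0]) simp_all
    show "y \<oplus>\<^bsub>M\<^esub> z \<in> (\<lambda>p. proj p \<odot>\<^bsub>M\<^esub> x) ` J'"
      if yz: "y \<in> (\<lambda>p. proj p \<odot>\<^bsub>M\<^esub> x) ` J'" "z \<in> (\<lambda>p. proj p \<odot>\<^bsub>M\<^esub> x) ` J'" for y z
    proof -
      obtain p q where pq: "p \<in> J'" "y = proj p \<odot>\<^bsub>M\<^esub> x" "q \<in> J'" "z = proj q \<odot>\<^bsub>M\<^esub> x"
        using yz by blast
      then show ?thesis
        using J'(1) J'(3)[OF pq(1,3)] x add[of p q x]
        by (intro image_eqI[of _ _ "p + q"]) (simp_all add: subset_iff)
    qed
    show "\<ominus>\<^bsub>M\<^esub> y \<in> (\<lambda>p. proj p \<odot>\<^bsub>M\<^esub> x) ` J'" if "y \<in> (\<lambda>p. proj p \<odot>\<^bsub>M\<^esub> x) ` J'" for y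
    proof -
      obtain p where p: "p \<in> J'" "y = proj p \<odot>\<^bsub>M\<^esub> x"
        using \<open>y \<in> _\<close> by blast
      then show ?thesis
        using J'(1) J'(4)[OF p(1)] x by (intro image_eqI[of _ _ "- p"]) (auto simp: uminus)
    qed
    show "proj q \<odot>\<^bsub>M\<^esub> y \<in> (\<lambda>p. proj p \<odot>\<^bsub>M\<^esub> x) ` J'"
      if q: "q \<in> F" and y: "y \<in> (\<lambda>p. proj p \<odot>\<^bsub>M\<^esub> x) ` J'" for q y
    proof -
      obtain p where p: "p \<in> J'" "y = proj p \<odot>\<^bsub>M\<^esub> x"
        using y by blast
      then show ?thesis
        using J'(1) J'(5)[OF q p(1)] x q
        by (intro image_eqI[of _ _ "q * p"]) (auto simp: mult)
    qed
  qed
  have F_ideal: "left_ideal F" by (auto simp: left_ideal_def)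
  have all: "(\<lambda>p. proj p \<odot>\<^bsub>M\<^esub> x) ` F = carrier M"
    using simple sub[OF F_ideal] vx v unfolding simple_left_module_def by blast
  have "primitive_ideal J"
    unfolding primitive_ideal_def
  proof (intro conjI allI impI ballI J)
    show "I \<subseteq> J" using ideal x by (auto simp: J_def)
    show "J \<noteq> F" using vx v by (auto simp: J_def)
  next
    fix J' assume J': "left_ideal J'" "J \<subseteq> J'"
    note J'D = left_idealD[OF J'(1)]
    have "(\<lambda>p. proj p \<odot>\<^bsub>M\<^esub> x) ` J' = {\<zero>\<^bsub>M\<^esub>} \<or> (\<lambda>p. proj p \<odot>\<^bsub>M\<^esub> x) ` J' = carrier M"
      using simple sub[OF J'(1)] unfolding simple_left_module_def by blast
    then show "J' = J \<or> J' = F"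
    proof
      assume "(\<lambda>p. proj p \<odot>\<^bsub>M\<^esub> x) ` J' = {\<zero>\<^bsub>M\<^esub>}"
      then have "J' \<subseteq> J" using J'D(1) by (auto simp: J_def)
      then show ?thesis using J' by blast
    next
      assume eq: "(\<lambda>p. proj p \<odot>\<^bsub>M\<^esub> x) ` J' = carrier M"
      have "q \<in> J'" if q: "q \<in> F" for q
      proof -
        have "proj q \<odot>\<^bsub>M\<^esub> x \<in> (\<lambda>p. proj p \<odot>\<^bsub>M\<^esub> x) ` J'"
          unfolding eq by (rule cl[OF q x])
        then obtain p where p: "p \<in> J'" "proj q \<odot>\<^bsub>M\<^esub> x = proj p \<odot>\<^bsub>M\<^esub> x"
          by (rule imageE)
        then have "p \<in> F" using J'D(1) by blast
        then have "proj (q + - p) \<odot>\<^bsub>M\<^esub> x = \<zero>\<^bsub>M\<^esub>"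
          using q x p by (subst add) (auto simp: uminus M.r_neg)
        then have "q - p \<in> J'" using J'(2) q \<open>p \<in> F\<close> by (auto simp: J_def)
        then show ?thesis using J'D(3)[OF _ p(1), of "q - p"] by simp
      qed
      then show ?thesis using J'D(1) by blast
    qed
  next
    fix p assume p: "p \<in> F" "\<forall>q\<in>F. p * q \<in> J"
    have "proj p \<odot>\<^bsub>M\<^esub> y = \<zero>\<^bsub>M\<^esub>" if y: "y \<in> carrier M" for y
    proof -
      obtain q where "q \<in> F" "y = proj q \<odot>\<^bsub>M\<^esub> x"
        using y unfolding all[symmetric] by (rule imageE)
      then show ?thesis using p x mult[of p q x] by (auto simp: J_def)
    qed
    then have "proj p = \<zero>\<^bsub>L\<^esub>"
      using faithful p(1) unfolding faithful_left_module_def L_carrier by blast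
    then show "p \<in> I" by (simp add: L_zero proj_eq)
  qed
  then show thesis ..
qed

lemma left_primitive_if_primitive_ideal:
  assumes "primitive_ideal J"
  shows "left_primitive L"
proof -
  have J: "left_ideal J" and IJ: "I \<subseteq> J" and JF: "J \<noteq> F"
    and max: "\<And>J'. left_ideal J' \<Longrightarrow> J \<subseteq> J' \<Longrightarrow> J' = J \<or> J' = F"
    and faith: "\<And>p. p \<in> F \<Longrightarrow> (\<And>q. q \<in> F \<Longrightarrow> p * q \<in> J) \<Longrightarrow> p \<in> I"
    using assms unfolding primitive_ideal_def by blast+
  note JD = left_idealD[OF J]
  \<comment> \<open>The elements of the module \<open>F / J\<close> are chosen representatives of the residue classes.\<close>
  define nf where "nf p = (SOME r. r - p \<in> J)" for p
  have nf: "nf p - p \<in> J" for p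
    unfolding nf_def by (rule someI[of _ p]) (simp add: JD(2))
  have nf_eq: "nf p = nf q \<longleftrightarrow> p - q \<in> J" for p q
  proof
    assume "nf p = nf q"
    then show "p - q \<in> J" using JD(6)[OF nf[of q] nf[of p]] by simp
  next
    assume pq: "p - q \<in> J"
    have "r - p \<in> J \<longleftrightarrow> r - q \<in> J" for r
      using JD(3)[OF _ pq, of "r - p"] JD(6)[OF _ pq, of "r - q"] by auto
    then show "nf p = nf q" by (simp add: nf_def)
  qed
  have nfF: "nf p \<in> F" if "p \<in> F" for p
    using F_closed(2)[of "nf p - p" p] nf[of p] that JD(1) by auto
  define M :: "(('v,'e,'k) lpa_elem, ('v,'e) lpa_gen word \<Rightarrow>\<^sub>0 'k) module" where
    "M = \<lparr>carrier = nf ` F, mult = undefined, one = undefined, zero = nf 0,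
       add = (\<lambda>x y. nf (x + y)), smult = (\<lambda>a x. nf ((SOME p. p \<in> a) * x))\<rparr>"
  have sel [simp]: "carrier M = nf ` F" "\<zero>\<^bsub>M\<^esub> = nf 0"
    by (simp_all add: M_def)
  have add [simp]: "nf p \<oplus>\<^bsub>M\<^esub> nf q = nf (p + q)" for p q
    using JD(3)[OF nf[of p] nf[of q]] by (simp add: M_def nf_eq algebra_simps)
  have smult [simp]: "proj p \<odot>\<^bsub>M\<^esub> nf q = nf (p * q)" if "p \<in> F" "q \<in> F" for p q
  proof -
    define r where "r = (SOME r. r \<in> proj p)"
    have "r \<in> proj p"
      unfolding r_def by (rule someI[of _ p]) simp
    then have r: "r \<in> F" "r - p \<in> I"
      using proj_F[OF that(1)] by (auto simp: proj_def)
    have "r * nf q - p * q = r * (nf q - q) + (r - p) * q"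
      by (simp add: algebra_simps)
    moreover have "(r - p) * q \<in> J"
      using r that IJ I_closed(5)[of "r - p" q] by blast
    then have "r * (nf q - q) + (r - p) * q \<in> J"
      by (rule JD(3)[OF JD(5)[OF r(1) nf[of q]]])
    ultimately show ?thesis
      by (simp add: M_def nf_eq flip: r_def)
  qed
  interpret M: abelian_group M
  proof (rule abelian_groupI)
    show "\<exists>y\<in>carrier M. y \<oplus>\<^bsub>M\<^esub> x = \<zero>\<^bsub>M\<^esub>" if "x \<in> carrier M" for x
    proof -
      obtain p where "p \<in> F" "x = nf p" using \<open>x \<in> _\<close> by auto
      then show ?thesis by (intro bexI[of _ "nf (- p)"]) auto
    qed
  qed (auto simp: algebra_simps)
  interpret L: nonunital_ring L by (rule L_ring)
  have lm: "left_module L M"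
    by unfold_locales (auto simp: L_carrier L_add L_mult algebra_simps)
  have M_inv: "\<ominus>\<^bsub>M\<^esub> nf p = nf (- p)" if "p \<in> F" for p
    using that by (intro M.minus_equality) auto
  have "simple_left_module L M"
    unfolding simple_left_module_def
  proof (intro conjI allI impI lm)
    obtain p where "p \<in> F" "p \<notin> J" using JF JD(1) by blast
    then have "nf p \<in> carrier M" "nf p \<noteq> nf 0" by (auto simp: nf_eq)
    then show "carrier M \<noteq> {\<zero>\<^bsub>M\<^esub>}" by auto
  next
    fix N assume "submodule N L M"
    then interpret N: submodule N L M .
    define J' where "J' = {p \<in> F. nf p \<in> N}"
    have NM: "N \<subseteq> nf ` F" using N.subset by simp
    have neg: "nf (- p) \<in> N" if "p \<in> F" "nf p \<in> N" for p
      using N.m_inv_closed[OF that(2)] M_inv[OF that(1)] by (simp add: a_inv_def)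
    have sum: "nf (p + q) \<in> N" if "nf p \<in> N" "nf q \<in> N" for p q
      using N.m_closed[OF that] by simp
    have sm: "nf (p * q) \<in> N" if "p \<in> F" "q \<in> F" "nf q \<in> N" for p q
      using N.smult_closed[of "proj p" "nf q"] that by (simp add: L_carrier)
    have z: "nf 0 \<in> N" using N.one_closed by simp
    have "left_ideal J'"
      unfolding left_ideal_def J'_def using z sum neg sm by auto
    moreover have "J \<subseteq> J'"
    proof
      fix p assume p: "p \<in> J"
      then have "nf p = nf 0" by (simp add: nf_eq)
      then show "p \<in> J'" using p JD(1) z by (auto simp: J'_def)
    qed
    ultimately have "J' = J \<or> J' = F" by (rule max)
    have N: "N = nf ` J'"
      using NM by (auto simp: J'_def)
    from \<open>J' = J \<or> J' = F\<close> show "N = {\<zero>\<^bsub>M\<^esub>} \<or> N = carrier M"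
    proof
      assume "J' = J"
      then have "nf p = nf 0" if "p \<in> J'" for p using that by (simp add: nf_eq)
      then have "N \<subseteq> {\<zero>\<^bsub>M\<^esub>}" unfolding N by auto
      then show ?thesis using z by auto
    next
      assume "J' = F"
      then show ?thesis using N by simp
    qed
  qed
  moreover have "faithful_left_module L M"
    unfolding faithful_left_module_def
  proof (intro conjI ballI impI lm)
    fix a assume "a \<in> carrier L" and ann: "\<forall>x\<in>carrier M. a \<odot>\<^bsub>M\<^esub> x = \<zero>\<^bsub>M\<^esub>"
    then obtain p where p: "p \<in> F" "a = proj p" by (auto simp: L_carrier)
    have "p * q \<in> J" if "q \<in> F" for q
      using ann that p by (auto simp: nf_eq)
    then show "a = \<zero>\<^bsub>L\<^esub>"
      using faith[OF p(1)] p(2) by (simp add: L_zero proj_eq)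
  qed
  ultimately show ?thesis by (rule left_primitiveI)
qed

text \<open>
  The graph without vertices has the zero algebra, over which every group of prime order is a simple
  faithful module.
\<close>

lemma left_primitive_if_no_vertices:
  assumes "verts G = {}"
  shows "left_primitive L"
proof -
  have "lpa_gens G = {}"
    using assms tail_in_verts by (auto simp: lpa_gens_def)
  then have "F = {0}"
    by (auto simp: F_def free_carrier_def)
  then have L0: "carrier L = {\<zero>\<^bsub>L\<^esub>}"
    by (simp add: L_carrier L_zero)
  define M :: "(('v,'e,'k) lpa_elem, bool) module" where
    "M = \<lparr>carrier = UNIV, mult = undefined, one = undefined, zero = False,
       add = (\<noteq>), smult = (\<lambda>a x. False)\<rparr>"
  have sel [simp]: "carrier M = UNIV" "\<zero>\<^bsub>M\<^esub> = False"
    "\<And>x y. x \<oplus>\<^bsub>M\<^esub> y = (x \<noteq> y)" "\<And>a x. a \<odot>\<^bsub>M\<^esub> x = False"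
    by (simp_all add: M_def)
  interpret L: nonunital_ring L by (rule L_ring)
  interpret M: abelian_group M
    by (rule abelian_groupI) auto
  have lm: "left_module L M"
    by unfold_locales auto
  have "N = {False} \<or> N = UNIV" if "submodule N L M" for N
  proof -
    interpret N: submodule N L M by fact
    have "False \<in> N" using N.one_closed by simp
    then show ?thesis by (cases "True \<in> N") (auto simp: set_eq_iff all_bool_eq)
  qed
  then have "simple_left_module L M"
    using lm by (auto simp: simple_left_module_def)
  moreover have "faithful_left_module L M"
    using lm L0 by (simp add: faithful_left_module_def)
  ultimately show ?thesis by (rule left_primitiveI)
qed

section \<open>Necessity of the three conditions\<close>

lemma primitive_idealD:
  assumes "primitive_ideal J"
  shows "left_ideal J" "p \<in> I \<Longrightarrow> p \<in> J" "J \<noteq> F" "left_ideal J' \<Longrightarrow> J \<subseteq> J' \<Longrightarrow> J' = J \<or> J' = F"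
    "p \<in> F \<Longrightarrow> p \<notin> I \<Longrightarrow> \<exists>q\<in>F. p * q \<notin> J"
  using assms unfolding primitive_ideal_def by blast+

lemma eqv_left_ideal:
  assumes "left_ideal J" "I \<subseteq> J" "p \<approx> q" "q \<in> J"
  shows "p \<in> J"
proof -
  have "(p - q) + q \<in> J"
    using assms by (intro left_idealD(3)) (auto simp: eqv_def)
  then show ?thesis by simp
qed

text \<open>
  For a left ideal \<open>B\<close>, the image of \<open>B x\<close> in the simple module \<open>F / J\<close> is a submodule, hence
  everything if it is not zero.
\<close>

lemma primitive_ideal_generate:
  assumes J: "primitive_ideal J" and B: "left_ideal B" and x: "x \<in> F"
    and b: "b \<in> B" "b * x \<notin> J" and q: "q \<in> F"
  obtains b' where "b' \<in> B" "q - b' * x \<in> J"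
proof -
  note JD = left_idealD[OF primitive_idealD(1)[OF J]] and BD = left_idealD[OF B]
  define J' where "J' = {b * x + j |b j. b \<in> B \<and> j \<in> J}"
  have J'I: "b * x + j \<in> J'" if "b \<in> B" "j \<in> J" for b j
    using that by (auto simp: J'_def)
  have "left_ideal J'"
    unfolding left_ideal_def
  proof (intro conjI ballI)
    show "J' \<subseteq> F" using BD(1) JD(1) x by (auto simp: J'_def)
    show "0 \<in> J'" using J'I[OF BD(2) JD(2)] by simp
  next
    fix p q assume "p \<in> J'" "q \<in> J'"
    then obtain b j c k where "p = b * x + j" "q = c * x + k" "b \<in> B" "c \<in> B" "j \<in> J" "k \<in> J"
      unfolding J'_def by blast
    then show "p + q \<in> J'"
      using J'I[OF BD(3) JD(3), of b c j k] by (simp add: algebra_simps)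
  next
    fix p assume "p \<in> J'"
    then obtain b j where "p = b * x + j" "b \<in> B" "j \<in> J"
      unfolding J'_def by blast
    then show "- p \<in> J'"
      using J'I[OF BD(4) JD(4), of b j] by (simp add: algebra_simps)
  next
    fix a p assume "a \<in> F" "p \<in> J'"
    then obtain b j where "p = b * x + j" "b \<in> B" "j \<in> J"
      unfolding J'_def by blast
    then show "a * p \<in> J'"
      using J'I[OF BD(5) JD(5), of a b a j] \<open>a \<in> F\<close> by (simp add: algebra_simps)
  qed
  moreover have "J \<subseteq> J'"
    using J'I[OF BD(2)] by auto
  moreover have "b * x \<in> J'"
    using J'I[OF b(1) JD(2)] by simp
  ultimately have "J' = F"
    using primitive_idealD(4)[OF J, of J'] b(2) by blast
  then have "q \<in> J'" using q by simp
  then obtain b' j where "q = b' * x + j" "b' \<in> B" "j \<in> J"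
    unfolding J'_def by blast
  then show thesis by (intro that[of b']) auto
qed

lemma left_ideal_F: "left_ideal F"
  by (auto simp: left_ideal_def)

text \<open>No element but \<open>0\<close> of the faithful simple module is annihilated by the whole algebra.\<close>

lemma primitive_ideal_cyclic:
  assumes J: "primitive_ideal J" and x: "x \<in> F" "x \<notin> J" and ne: "verts G \<noteq> {}"
  obtains b where "b \<in> F" "b * x \<notin> J"
proof (rule ccontr)
  note JD = left_idealD[OF primitive_idealD(1)[OF J]]
  assume "\<not> thesis"
  then have x0: "b * x \<in> J" if "b \<in> F" for b using that \<open>\<And>b. b \<in> F \<Longrightarrow> b * x \<notin> J \<Longrightarrow> thesis\<close> by blast
  define J' where "J' = {y \<in> F. \<forall>b\<in>F. b * y \<in> J}"
  have "left_ideal J'"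
    unfolding left_ideal_def J'_def
    by (auto simp: distrib_left JD(2,3,4) simp flip: mult.assoc)
  moreover have "J \<subseteq> J'" using JD by (auto simp: J'_def)
  moreover have "x \<in> J'" using x x0 by (simp add: J'_def)
  ultimately have J': "J' = F" using primitive_idealD(4)[OF J] x(2) by blast
  obtain v where v: "v \<in> verts G" using ne by blast
  then obtain q where "q \<in> F" "V v * q \<notin> J"
    using primitive_idealD(5)[OF J, of "V v"] V_notin_I by auto
  moreover have "q \<in> J'" using \<open>q \<in> F\<close> J' by simp
  ultimately show False using v by (auto simp: J'_def)
qed

lemma MT3_if_primitive_ideal:
  assumes J: "primitive_ideal J"
  shows "condition_MT3 G"
  unfolding condition_MT3_def
proof (intro ballI)
  fix v w assume v: "v \<in> verts G" and w: "w \<in> verts G"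
  note JD = left_idealD[OF primitive_idealD(1)[OF J]]
  have IJ: "I \<subseteq> J" using primitive_idealD(2)[OF J] by blast
  obtain q where q: "q \<in> F" "V w * q \<notin> J"
    using primitive_idealD(5)[OF J, of "V w"] V_notin_I w by auto
  obtain q' where q': "q' \<in> F" "V v * q' \<notin> J"
    using primitive_idealD(5)[OF J, of "V v"] V_notin_I v by auto
  have "V w * (V w * q) \<notin> J"
  proof
    assume "V w * (V w * q) \<in> J"
    moreover have "V w * q \<approx> V w * (V w * q)"
      using eqv_right[OF _ eqv_sym[OF eqv_VV[OF w]], of q] q by (simp add: mult.assoc)
    ultimately show False
      using eqv_left_ideal[OF primitive_idealD(1)[OF J] IJ] q by blast
  qed
  then obtain r where r: "r \<in> F" "q' - r * (V w * q) \<in> J"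
    using primitive_ideal_generate[OF J left_ideal_F _ _ _ q'(1), of "V w * q" "V w"] w q by auto
  have "V v * r * V w \<notin> I"
  proof
    assume "V v * r * V w \<in> I"
    then have "V v * r * V w * q \<in> J" using q IJ by (auto intro: I_closed)
    moreover have "V v * (q' - r * (V w * q)) \<in> J" using r v by (intro JD(5)) auto
    ultimately have "V v * (q' - r * (V w * q)) + V v * r * V w * q \<in> J"
      by (rule JD(3)[rotated])
    then show False using q'(2) by (simp add: algebra_simps)
  qed
  moreover have "V v * r * V w \<in> I" if no: "\<not> (\<exists>u\<in>verts G. v \<rightarrow>\<^sup>* u \<and> w \<rightarrow>\<^sup>* u)"
  proof -
    have "V v * r * V w \<in> lspan {}"
    proof (rule lspan_right[OF V_F_lspan[OF v r(1)]])
      show "V w \<in> A" using w by auto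
      fix b assume "b \<in> Mon {u. v \<rightarrow>\<^sup>* u}"
      then obtain \<alpha> u \<beta> s t where b: "b = mon \<alpha> u \<beta>" "awalk s \<alpha> u" "awalk t \<beta> u" "v \<rightarrow>\<^sup>* u"
        by (auto simp: Mon_def)
      then have "\<not> w \<rightarrow>\<^sup>* u" using no by auto
      then have "w \<noteq> t" using b(3) by (auto intro: reachable_awalkI)
      then have "b * V w \<approx> 0" unfolding b(1) using b w by (intro mon_V_0)
      then show "b * V w \<in> lspan {}" by (simp add: eqv_0_iff lspan.ideal)
    qed
    then show ?thesis by (rule lspan_empty)
  qed
  ultimately show "\<exists>u\<in>verts G. v \<rightarrow>\<^sup>* u \<and> w \<rightarrow>\<^sup>* u" by blast
qed

text \<open>
  The two-sided ideal generated by \<open>w\<close>, which is spanned by the monomials \<open>\<alpha>\<beta>\<^sup>*\<close> whose middle vertex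
  is reachable from \<open>w\<close>, contains an element that fixes \<open>x\<close> modulo \<open>J\<close>.
\<close>

lemma primitive_ideal_fix:
  assumes J: "primitive_ideal J" and x: "x \<in> F" "x \<notin> J" and w: "w \<in> verts G"
  obtains T a where "finite T"
    "\<And>\<alpha> u \<beta>. (\<alpha>, u, \<beta>) \<in> T \<Longrightarrow> w \<rightarrow>\<^sup>* u \<and> (\<exists>s. awalk s \<alpha> u) \<and> (\<exists>t. awalk t \<beta> u)"
    "a \<in> lspan ((\<lambda>(\<alpha>, u, \<beta>). mon \<alpha> u \<beta>) ` T)" "x - a * x \<in> J"
proof -
  note JD = left_idealD[OF primitive_idealD(1)[OF J]]
  let ?B = "lspan (Mon {u. w \<rightarrow>\<^sup>* u})"
  have BF: "?B \<subseteq> F" using lspan_F Mon_F by blast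
  have B: "left_ideal ?B"
    unfolding left_ideal_def
    using BF by (auto intro: lspan.ideal lspan.add lspan_uminus Mon_left reachable_trans)
  obtain q where q: "q \<in> F" "V w * q \<notin> J"
    using primitive_idealD(5)[OF J, of "V w"] V_notin_I w by auto
  obtain c where c: "c \<in> F" "c * x \<notin> J"
    using primitive_ideal_cyclic[OF J x] w by blast
  obtain r where r: "r \<in> F" "q - r * x \<in> J"
    using primitive_ideal_generate[OF J left_ideal_F x(1) c q(1)] by blast
  have wr: "V w * r * x \<notin> J"
  proof
    assume *: "V w * r * x \<in> J"
    have "V w * (q - r * x) \<in> J" using r w by (intro JD(5)) auto
    from JD(3)[OF this *] show False using q(2) by (simp add: algebra_simps)
  qed
  obtain a where a: "a \<in> ?B" "x - a * x \<in> J"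
    using primitive_ideal_generate[OF J B x(1) V_F_lspan[OF w r(1)] wr x(1)] by blast
  obtain B0 where B0: "B0 \<subseteq> Mon {u. w \<rightarrow>\<^sup>* u}" "finite B0" "a \<in> lspan B0"
    using lspan_finite[OF a(1)] by blast
  have "B0 \<subseteq> (\<lambda>(\<alpha>, u, \<beta>). mon \<alpha> u \<beta>) `
      {(\<alpha>, u, \<beta>). w \<rightarrow>\<^sup>* u \<and> (\<exists>s. awalk s \<alpha> u) \<and> (\<exists>t. awalk t \<beta> u)}"
  proof
    fix b assume "b \<in> B0"
    then have "b \<in> Mon {u. w \<rightarrow>\<^sup>* u}" using B0(1) by blast
    then obtain \<alpha> u \<beta> s t where "b = mon \<alpha> u \<beta>" "w \<rightarrow>\<^sup>* u" "awalk s \<alpha> u" "awalk t \<beta> u"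
      by (auto simp: Mon_def)
    then show "b \<in> (\<lambda>(\<alpha>, u, \<beta>). mon \<alpha> u \<beta>) `
        {(\<alpha>, u, \<beta>). w \<rightarrow>\<^sup>* u \<and> (\<exists>s. awalk s \<alpha> u) \<and> (\<exists>t. awalk t \<beta> u)}"
      by (intro image_eqI[of _ _ "(\<alpha>, u, \<beta>)"]) auto
  qed
  from finite_subset_image[OF B0(2) this] obtain T where
    T: "T \<subseteq> {(\<alpha>, u, \<beta>). w \<rightarrow>\<^sup>* u \<and> (\<exists>s. awalk s \<alpha> u) \<and> (\<exists>t. awalk t \<beta> u)}"
    "finite T" "B0 = (\<lambda>(\<alpha>, u, \<beta>). mon \<alpha> u \<beta>) ` T"
    by (elim exE conjE)
  show thesis
    by (rule that[of T a]) (use T B0(3) a(2) in auto)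
qed

lemma mon_mult_0_start:
  assumes "awalk s \<alpha> u" "awalk t \<beta> u" "awalk s' \<gamma> w" "awalk t' \<delta> w" "t \<noteq> s'"
  shows "mon \<alpha> u \<beta> * mon \<gamma> w \<delta> \<approx> 0"
proof -
  have "mon \<alpha> u \<beta> * mon \<gamma> w \<delta> \<approx> mon \<alpha> u \<beta> * (V s' * mon \<gamma> w \<delta>)"
    using assms by (intro eqv_left eqv_sym[OF V_mon]) auto
  also have "\<dots> = (mon \<alpha> u \<beta> * V s') * mon \<gamma> w \<delta>" by (simp add: mult.assoc)
  also have "\<dots> \<approx> 0 * mon \<gamma> w \<delta>"
    using assms by (intro eqv_right mon_V_0[OF assms(1,2)]) auto
  finally show ?thesis by simp
qed

text \<open>The end of an initial part of \<open>\<gamma>\<close> is the end of \<open>\<gamma>\<close> or the source of an arc of \<open>\<gamma>\<close>.\<close>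

lemma prefix_end:
  assumes "awalk s \<gamma> u" "awalk s \<beta> v" "prefix \<beta> \<gamma>"
  shows "v \<in> insert u (tail G ` set \<gamma>)"
proof -
  obtain \<epsilon> where \<epsilon>: "\<gamma> = \<beta> @ \<epsilon>" using assms(3) by (auto simp: prefix_def)
  then have "awalk v \<epsilon> u" using assms by simp
  then show ?thesis using \<epsilon> by (cases \<epsilon>) (auto simp: awalk_Nil_iff awalk_Cons_iff)
qed

text \<open>
  If the property fails, there is a sequence of vertices each of which reaches none of the finitely
  many vertices on the paths that occur in the elements \<open>a w\<close> for the preceding \<open>w\<close>, and a vertex
  \<open>z\<close> that reaches none of those for the whole sequence. The element \<open>a z * a w\<close> fixes \<open>x\<close> modulo \<open>J\<close>
  for all \<open>w\<close> in the sequence, so it is not zero, and some path occurring in \<open>a z\<close> is an extension of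
  a path in \<open>a w\<close>. As only finitely many vertices lie on the paths in \<open>a z\<close>, two vertices \<open>w\<close> in the
  sequence reach the same one among them, on a path in \<open>a w\<close> for each. This contradicts the choice of
  the later \<open>w\<close>.
\<close>

lemma CSP_if_primitive_ideal:
  assumes J: "primitive_ideal J"
  shows "countable_separation_property G (verts G)"
proof (rule ccontr)
  assume not_CSP: "\<not> countable_separation_property G (verts G)"
  have not_sep: "\<exists>w\<in>verts G. \<forall>v\<in>C. \<not> w \<rightarrow>\<^sup>* v" if C: "countable C" for C
  proof -
    have "countable (C \<inter> verts G)"
      using C by (rule countable_subset[rotated]) simp
    then have "\<not> (\<forall>w\<in>verts G. \<exists>v\<in>C \<inter> verts G. w \<rightarrow>\<^sup>* v)"
      using not_CSP unfolding countable_separation_property_def by (meson inf_le2)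
    then obtain w where w: "w \<in> verts G" "\<forall>v\<in>C \<inter> verts G. \<not> w \<rightarrow>\<^sup>* v"
      by blast
    have "\<not> w \<rightarrow>\<^sup>* v" if "v \<in> C" for v
    proof
      assume r: "w \<rightarrow>\<^sup>* v"
      then have "v \<in> verts G" by (rule reachable_in_vertsE)
      then show False using w(2) r that by blast
    qed
    then show ?thesis using w(1) by blast
  qed
  note JD = left_idealD[OF primitive_idealD(1)[OF J]]
  obtain x where x: "x \<in> F" "x \<notin> J"
    using primitive_idealD(3)[OF J] JD(1) by blast
  \<comment> \<open>\<open>T\<close> indexes the monomials of an element \<open>a\<close> as obtained for the vertex \<open>w\<close>.\<close>
  define mon3 where "mon3 = (\<lambda>(\<alpha>, u, \<beta>). mon \<alpha> u \<beta>)"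
  define fixing where "fixing w T a \<longleftrightarrow> finite T \<and>
    (\<forall>\<alpha> u \<beta>. (\<alpha>, u, \<beta>) \<in> T \<longrightarrow> w \<rightarrow>\<^sup>* u \<and> (\<exists>s. awalk s \<alpha> u) \<and> (\<exists>t. awalk t \<beta> u)) \<and>
    a \<in> lspan (mon3 ` T) \<and> x - a * x \<in> J" for w T a
  have "\<exists>T a. fixing w T a" if "w \<in> verts G" for w
    unfolding fixing_def mon3_def by (rule primitive_ideal_fix[OF J x that]) blast
  then obtain T a where Ta: "\<And>w. w \<in> verts G \<Longrightarrow> fixing w (T w) (a w)"
    by metis
  have fin: "finite (T w)" and valid: "(\<alpha>, u, \<beta>) \<in> T w \<Longrightarrow> w \<rightarrow>\<^sup>* u"
      "(\<alpha>, u, \<beta>) \<in> T w \<Longrightarrow> \<exists>s. awalk s \<alpha> u" "(\<alpha>, u, \<beta>) \<in> T w \<Longrightarrow> \<exists>t. awalk t \<beta> u"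
    and a: "a w \<in> lspan (mon3 ` T w)" "x - a w * x \<in> J"
    if "w \<in> verts G" for w \<alpha> u \<beta>
    using Ta[OF that] unfolding fixing_def by blast+
  have TF: "mon3 ` T w \<subseteq> F" if w: "w \<in> verts G" for w
  proof
    fix b assume "b \<in> mon3 ` T w"
    then obtain \<alpha> u \<beta> where b: "b = mon \<alpha> u \<beta>" "(\<alpha>, u, \<beta>) \<in> T w"
      by (auto simp: mon3_def)
    then show "b \<in> F" using valid(2,3)[OF w b(2)] by blast
  qed
  have aF: "a w \<in> F" if "w \<in> verts G" for w
    using lspan_F[OF a(1) TF] that by blast
  have comparable: "\<exists>\<alpha> u \<beta> \<gamma> u' \<delta> s. (\<alpha>, u, \<beta>) \<in> T w \<and> (\<gamma>, u', \<delta>) \<in> T w' \<and>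
      awalk s \<beta> u \<and> awalk s \<gamma> u' \<and> (prefix \<beta> \<gamma> \<or> prefix \<gamma> \<beta>)"
    if w: "w \<in> verts G" "w' \<in> verts G" for w w'
  proof (rule ccontr)
    assume no: "\<not> ?thesis"
    have "a w * a w' \<in> I"
    proof (rule lspan_mult_I)
      show "a w \<in> lspan (mon3 ` T w)" "a w' \<in> lspan (mon3 ` T w')"
        using a(1) w by blast+
      show "mon3 ` T w \<subseteq> A" "mon3 ` T w' \<subseteq> F" using TF w by blast+
      fix b b' assume b: "b \<in> mon3 ` T w" "b' \<in> mon3 ` T w'"
      obtain \<alpha> u \<beta> where 1: "b = mon \<alpha> u \<beta>" "(\<alpha>, u, \<beta>) \<in> T w"
        using b(1) by (auto simp: mon3_def)
      obtain \<gamma> u' \<delta> where 2: "b' = mon \<gamma> u' \<delta>" "(\<gamma>, u', \<delta>) \<in> T w'"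
        using b(2) by (auto simp: mon3_def)
      obtain s t where st: "awalk s \<alpha> u" "awalk t \<beta> u" using valid(2,3)[OF w(1) 1(2)] by blast
      obtain s' t' where st': "awalk s' \<gamma> u'" "awalk t' \<delta> u'" using valid(2,3)[OF w(2) 2(2)] by blast
      show "b * b' \<in> I"
      proof (cases "t = s'")
        case True
        then have "\<not> prefix \<beta> \<gamma>" "\<not> prefix \<gamma> \<beta>" using no 1 2 st st' by blast+
        then show ?thesis unfolding 1 2 using mon_mult_0[OF st st'] by (simp add: eqv_0_iff)
      next
        case False
        then show ?thesis unfolding 1 2 using mon_mult_0_start[OF st st'] by (simp add: eqv_0_iff)
      qed
    qed
    then have "a w * a w' * x \<in> J" using x primitive_idealD(2)[OF J] by auto
    moreover have "a w * (x - a w' * x) \<in> J" using a w aF by (intro JD(5)) auto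
    ultimately have "a w * (x - a w' * x) + a w * a w' * x \<in> J" by (rule JD(3)[rotated])
    then have "a w * x \<in> J" by (simp add: algebra_simps)
    then have "(x - a w * x) + a w * x \<in> J" using a w by (intro JD(3)) auto
    then show False using x by simp
  qed
  \<comment> \<open>The vertices on the paths that occur in \<open>a w\<close>.\<close>
  define D where "D w = (\<Union>(\<gamma>, u, \<delta>)\<in>T w. insert u (tail G ` (set \<gamma> \<union> set \<delta>)))" for w
  have D_fin: "finite (D w)" if "w \<in> verts G" for w
    using fin[OF that] by (auto simp: D_def)
  have D_end: "v \<in> D w" if "(\<gamma>, u, \<delta>) \<in> T w" "v \<in> insert u (tail G ` (set \<gamma> \<union> set \<delta>))" for v w \<gamma> u \<delta>
    using that unfolding D_def by blast
  have "\<exists>W :: nat \<Rightarrow> 'v. \<forall>n. W n \<in> verts G \<and> (\<forall>i<n. \<forall>v\<in>D (W i). \<not> W n \<rightarrow>\<^sup>* v)"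
  proof (rule dependent_wf_choice[where R = less_than and
        P = "\<lambda>W n r. r \<in> verts G \<and> (\<forall>i<n. \<forall>v\<in>D (W i). \<not> r \<rightarrow>\<^sup>* v)"])
    show "wf less_than" by (rule wf_less_than)
    show "(r \<in> verts G \<and> (\<forall>i<n. \<forall>v\<in>D (f i). \<not> r \<rightarrow>\<^sup>* v)) =
        (r \<in> verts G \<and> (\<forall>i<n. \<forall>v\<in>D (g i). \<not> r \<rightarrow>\<^sup>* v))"
      if "\<And>z. (z, n) \<in> less_than \<Longrightarrow> f z = g z" for f g :: "nat \<Rightarrow> 'v" and n r
      using that by auto
    show "\<exists>r. r \<in> verts G \<and> (\<forall>i<n. \<forall>v\<in>D (f i). \<not> r \<rightarrow>\<^sup>* v)"
      if f: "\<And>y. (y, n) \<in> less_than \<Longrightarrow> f y \<in> verts G \<and> (\<forall>i<y. \<forall>v\<in>D (f i). \<not> f y \<rightarrow>\<^sup>* v)" for n f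
    proof -
      have "countable (\<Union>i<n. D (f i))"
        using f D_fin by (intro countable_finite finite_UN_I) auto
      from not_sep[OF this] show ?thesis by blast
    qed
  qed
  then obtain W :: "nat \<Rightarrow> 'v" where
    W_all: "\<forall>n. W n \<in> verts G \<and> (\<forall>i<n. \<forall>v\<in>D (W i). \<not> W n \<rightarrow>\<^sup>* v)"
    by (rule exE)
  have W: "W n \<in> verts G" "i < n \<Longrightarrow> v \<in> D (W i) \<Longrightarrow> \<not> W n \<rightarrow>\<^sup>* v" for n i v
    using W_all by simp_all
  have "countable (\<Union>n. D (W n))"
    by (rule countable_UN) (simp_all add: countable_finite D_fin W(1))
  from not_sep[OF this] obtain z where z_all: "z \<in> verts G" "\<forall>v\<in>\<Union>n. D (W n). \<not> z \<rightarrow>\<^sup>* v"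
    by (rule bexE)
  have z: "z \<in> verts G" "v \<in> D (W n) \<Longrightarrow> \<not> z \<rightarrow>\<^sup>* v" for n v
    using z_all by auto
  have "\<exists>u. u \<in> D z \<and> u \<in> D (W n) \<and> W n \<rightarrow>\<^sup>* u" for n
  proof -
    obtain \<alpha> u \<beta> \<gamma> u' \<delta> s where c: "(\<alpha>, u, \<beta>) \<in> T z" "(\<gamma>, u', \<delta>) \<in> T (W n)"
      "awalk s \<beta> u" "awalk s \<gamma> u'" "prefix \<beta> \<gamma> \<or> prefix \<gamma> \<beta>"
      using comparable[OF z(1) W(1)[of n]] by blast
    \<comment> \<open>Else \<open>z\<close> would reach the end of \<open>\<beta>\<close>, a vertex on the path \<open>\<gamma>\<close>.\<close>
    have "\<not> prefix \<beta> \<gamma>"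
    proof
      assume "prefix \<beta> \<gamma>"
      then have "u \<in> D (W n)"
        using prefix_end[OF c(4,3)] by (intro D_end[OF c(2)]) auto
      then show False using z(2) valid(1)[OF z(1) c(1)] by blast
    qed
    then have "u' \<in> D z"
      using c(5) prefix_end[OF c(3,4)] by (intro D_end[OF c(1)]) auto
    moreover have "u' \<in> D (W n)" by (rule D_end[OF c(2)]) simp
    ultimately show ?thesis using valid(1)[OF W(1) c(2)] by blast
  qed
  then obtain U where U: "\<And>n. U n \<in> D z" "\<And>n. U n \<in> D (W n)" "\<And>n. W n \<rightarrow>\<^sup>* U n"
    by metis
  have "finite (range U)"
    using U(1) by (intro finite_subset[OF _ D_fin[OF z(1)]]) auto
  then have "\<not> inj U"
    using finite_imageD infinite_UNIV_nat by blast
  then obtain n m where "n < m" "U n = U m"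
    by (metis injI linorder_neqE_nat)
  then show False using W(2)[of n m "U n"] U(2)[of n] U(3)[of m] by auto
qed

section \<open>Cycles without exit\<close>

text \<open>A set of vertices each of which emits exactly one arc, into the set again.\<close>

definition exitless :: "'v set \<Rightarrow> bool" where
  "exitless T \<longleftrightarrow> T \<subseteq> verts G \<and> (\<forall>u\<in>T. \<exists>e. out_arcs G u = {e} \<and> head G e \<in> T)"

lemma exitless_cycle:
  assumes c: "awalk v c v" "c \<noteq> []" and no: "\<not> (\<exists>e. is_exit G e c)"
  shows "exitless (tail G ` set c)" "v \<in> tail G ` set c"
proof -
  show v: "v \<in> tail G ` set c"
    using c by (cases c) (auto simp: awalk_Cons_iff)
  show "exitless (tail G ` set c)"
    unfolding exitless_def
  proof (intro conjI ballI)
    show "tail G ` set c \<subseteq> verts G" using awalk_arcs[OF c(1)] by auto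
    fix u assume "u \<in> tail G ` set c"
    then obtain e where e: "e \<in> set c" "u = tail G e" by blast
    obtain i where i: "i < length c" "e = c ! i" using e(1) by (metis in_set_conv_nth)
    have "f = e" if "f \<in> out_arcs G u" for f
    proof (rule ccontr)
      assume "f \<noteq> e"
      then have "is_exit G f c" using that e(2) i by (auto simp: is_exit_def)
      then show False using no by blast
    qed
    moreover have "e \<in> out_arcs G u" using e awalk_arcs[OF c(1)] by auto
    ultimately have out: "out_arcs G u = {e}" by blast
    obtain xs ys where xy: "c = xs @ e # ys" using e(1) by (metis split_list)
    then have "awalk (head G e) ys v" using c(1) by (simp add: awalk_Cons_iff)
    then have "head G e \<in> tail G ` set c"
      using v xy by (cases ys) (auto simp: awalk_Nil_iff awalk_Cons_iff)
    then show "\<exists>e. out_arcs G u = {e} \<and> head G e \<in> tail G ` set c" using out by blast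
  qed
qed

lemma exitless_arc:
  assumes "exitless T" "u \<in> T" "e \<in> arcs G" "tail G e = u"
  shows "out_arcs G u = {e}" "head G e \<in> T"
proof -
  obtain f where f: "out_arcs G u = {f}" "head G f \<in> T"
    using assms(1,2) unfolding exitless_def by blast
  moreover have "e \<in> out_arcs G u" using assms by simp
  ultimately show "out_arcs G u = {e}" "head G e \<in> T" by simp_all
qed

lemma exitless_end: "exitless T \<Longrightarrow> u \<in> T \<Longrightarrow> awalk u \<alpha> w \<Longrightarrow> w \<in> T"
  by (induction \<alpha> arbitrary: u) (auto simp: awalk_Nil_iff awalk_Cons_iff dest: exitless_arc(2))

lemma exitless_unique:
  assumes "exitless T" "u \<in> T" "awalk u \<alpha> w" "awalk u \<beta> w'" "length \<alpha> = length \<beta>"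
  shows "\<alpha> = \<beta> \<and> w = w'"
  using assms(2-)
proof (induction \<alpha> arbitrary: u \<beta>)
  case Nil
  then show ?case by (auto simp: awalk_Nil_iff)
next
  case (Cons e \<alpha>)
  then obtain f \<gamma> where \<beta>: "\<beta> = f # \<gamma>" by (cases \<beta>) auto
  have e: "e \<in> arcs G" "tail G e = u" "awalk (head G e) \<alpha> w"
    and f: "f \<in> arcs G" "tail G f = u" "awalk (head G f) \<gamma> w'"
    using Cons.prems by (auto simp: \<beta> awalk_Cons_iff)
  have "e = f"
    using exitless_arc(1)[OF assms(1) Cons.prems(1) e(1,2)]
      exitless_arc(1)[OF assms(1) Cons.prems(1) f(1,2)]
    by simp
  then show ?case
    using Cons.IH[OF exitless_arc(2)[OF assms(1) Cons.prems(1) e(1,2)] e(3), of \<gamma>] f Cons.prems(4) \<beta>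
    by simp
qed

lemma exitless_extend:
  assumes "exitless T" "u \<in> T"
  obtains \<epsilon> w where "awalk u \<epsilon> w" "length \<epsilon> = n"
proof -
  have "\<exists>\<epsilon> w. awalk u \<epsilon> w \<and> length \<epsilon> = n"
    using assms(2)
  proof (induction n arbitrary: u)
    case 0
    then have "awalk u [] u" using assms(1) by (auto simp: awalk_Nil_iff exitless_def)
    then show ?case by blast
  next
    case (Suc n)
    then obtain e where e: "out_arcs G u = {e}" "head G e \<in> T"
      using assms(1) unfolding exitless_def by blast
    then have "e \<in> out_arcs G u" by simp
    moreover obtain \<epsilon> w where "awalk (head G e) \<epsilon> w" "length \<epsilon> = n"
      using Suc.IH[OF e(2)] by blast
    ultimately show ?case
      by (intro exI[of _ "e # \<epsilon>"] exI[of _ w]) (simp add: awalk_Cons_iff)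
  qed
  then show thesis using that by blast
qed

text \<open>By (CK2), \<open>\<epsilon>\<epsilon>\<^sup>*\<close> is the source of \<open>\<epsilon>\<close> for each path \<open>\<epsilon>\<close> in \<open>T\<close>.\<close>

lemma exitless_eqv:
  assumes "exitless T" "u \<in> T" "awalk u \<epsilon> w"
  shows "V u \<approx> mon \<epsilon> w \<epsilon>"
  using assms(2-)
proof (induction \<epsilon> arbitrary: u)
  case Nil
  then show ?case by (auto simp: mon_def awalk_Nil_iff)
next
  case (Cons e \<epsilon>)
  then have e: "e \<in> arcs G" "tail G e = u" "awalk (head G e) \<epsilon> w"
    by (auto simp: awalk_Cons_iff)
  note out = exitless_arc[OF assms(1) Cons.prems(1) e(1,2)]
  have "V u \<approx> Ed e * Gh e"
    using eqv_CK2[of u] out(1) e by auto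
  also have "\<dots> \<approx> (Ed e * V (head G e)) * Gh e"
    using e by (intro eqv_right eqv_sym[OF eqv_E(2)]) auto
  also have "\<dots> \<approx> (Ed e * mon \<epsilon> w \<epsilon>) * Gh e"
    using e by (intro eqv_right eqv_left Cons.IH out(2) e(3)) auto
  also have "\<dots> = mon (e # \<epsilon>) w (e # \<epsilon>)"
    by (simp add: mon_def P_Cons S_Cons mult.assoc)
  finally show ?case .
qed

lemma mon_extend:
  assumes "exitless T" "u \<in> T" "awalk s \<alpha> u" "awalk t \<beta> u" "awalk u \<epsilon> w"
  shows "mon \<alpha> u \<beta> \<approx> mon (\<alpha> @ \<epsilon>) w (\<beta> @ \<epsilon>)"
proof -
  have "P \<alpha> * V u * S \<beta> \<approx> P \<alpha> * mon \<epsilon> w \<epsilon> * S \<beta>"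
    using assms by (intro eqv_left eqv_right exitless_eqv) auto
  then show ?thesis by (simp add: mon_def P_append S_append mult.assoc)
qed

lemma mon_mult_match:
  assumes "awalk s \<alpha> u" "awalk v \<beta> u" "awalk t \<delta> u"
  shows "mon \<alpha> u \<beta> * mon \<beta> u \<delta> \<approx> mon \<alpha> u \<delta>"
proof -
  have "mon \<alpha> u \<beta> * mon \<beta> u \<delta> = P \<alpha> * (V u * (S \<beta> * P \<beta> * V u)) * S \<delta>"
    by (simp add: mon_def mult.assoc)
  also have "\<dots> \<approx> P \<alpha> * (V u * V u) * S \<delta>"
    using assms by (intro eqv_left eqv_right eqv_SPV) auto
  also have "\<dots> \<approx> P \<alpha> * V u * S \<delta>"
    using assms by (intro eqv_left eqv_right eqv_VV) auto
  finally show ?thesis by (simp add: mon_def)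
qed

text \<open>
  Paths from \<open>v \<in> T\<close> are determined by their lengths. The product of two monomials at \<open>v\<close> is a monomial
  whose two lengths are the sums, so that the order of the factors does not matter.
\<close>

lemma exitless_mult:
  assumes T: "exitless T" "v \<in> T"
    and w: "awalk v \<alpha> u" "awalk v \<beta> u" "awalk v \<alpha>' u'" "awalk v \<beta>' u'"
  obtains \<gamma> x \<delta> where "awalk v \<gamma> x" "awalk v \<delta> x" "length \<gamma> = length \<alpha> + length \<alpha>'"
    "length \<delta> = length \<beta> + length \<beta>'" "mon \<alpha> u \<beta> * mon \<alpha>' u' \<beta>' \<approx> mon \<gamma> x \<delta>"
proof -
  have u: "u \<in> T" "u' \<in> T" using exitless_end[OF T] w by blast+
  obtain \<epsilon> x where \<epsilon>: "awalk u \<epsilon> x" "length \<epsilon> = length \<alpha>'" using exitless_extend[OF T(1) u(1)] by blast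
  obtain \<epsilon>' x' where \<epsilon>': "awalk u' \<epsilon>' x'" "length \<epsilon>' = length \<beta>" using exitless_extend[OF T(1) u(2)] by blast
  have ends: "awalk v (\<alpha> @ \<epsilon>) x" "awalk v (\<beta> @ \<epsilon>) x" "awalk v (\<alpha>' @ \<epsilon>') x'" "awalk v (\<beta>' @ \<epsilon>') x'"
    using w \<epsilon> \<epsilon>' awalk_appendI by blast+
  have eq: "\<beta> @ \<epsilon> = \<alpha>' @ \<epsilon>'" "x = x'"
    using exitless_unique[OF T ends(2,3)] \<epsilon>(2) \<epsilon>'(2) by auto
  have "mon \<alpha> u \<beta> * mon \<alpha>' u' \<beta>' \<approx> mon (\<alpha> @ \<epsilon>) x (\<beta> @ \<epsilon>) * mon (\<alpha>' @ \<epsilon>') x' (\<beta>' @ \<epsilon>')"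
    using mon_extend[OF T(1) u(1) w(1,2) \<epsilon>(1)] mon_extend[OF T(1) u(2) w(3,4) \<epsilon>'(1)] by (rule eqv_mult)
  also have "\<dots> \<approx> mon (\<alpha> @ \<epsilon>) x (\<beta>' @ \<epsilon>')"
    unfolding eq(1) eq(2) by (rule mon_mult_match[OF ends(1)[unfolded eq(2)] ends(3,4)])
  finally have "mon \<alpha> u \<beta> * mon \<alpha>' u' \<beta>' \<approx> mon (\<alpha> @ \<epsilon>) x (\<beta>' @ \<epsilon>')" .
  then show thesis
    using ends eq(2) \<epsilon>(2) \<epsilon>'(2) by (intro that[of "\<alpha> @ \<epsilon>" x "\<beta>' @ \<epsilon>'"]) auto
qed

text \<open>The monomials \<open>\<alpha>\<beta>\<^sup>*\<close> for paths \<open>\<alpha>\<close>, \<open>\<beta>\<close> from \<open>v\<close> with a common end. They span \<open>vFv\<close>.\<close>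

definition corner :: "'v \<Rightarrow> (('v,'e) lpa_gen word \<Rightarrow>\<^sub>0 'k) set" where
  "corner v = {mon \<alpha> u \<beta> |\<alpha> u \<beta>. awalk v \<alpha> u \<and> awalk v \<beta> u}"

lemma corner_F: "corner v \<subseteq> F"
  by (auto simp: corner_def)

lemma corner_commute:
  assumes T: "exitless T" "v \<in> T" and b: "b \<in> corner v" "b' \<in> corner v"
  shows "b * b' \<approx> b' * b"
proof -
  obtain \<alpha> u \<beta> \<alpha>' u' \<beta>' where 1: "b = mon \<alpha> u \<beta>" "b' = mon \<alpha>' u' \<beta>'"
    and w: "awalk v \<alpha> u" "awalk v \<beta> u" "awalk v \<alpha>' u'" "awalk v \<beta>' u'"
    using b unfolding corner_def by blast
  obtain \<gamma> x \<delta> where 2: "awalk v \<gamma> x" "awalk v \<delta> x" "length \<gamma> = length \<alpha> + length \<alpha>'"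
    "length \<delta> = length \<beta> + length \<beta>'" "b * b' \<approx> mon \<gamma> x \<delta>"
    unfolding 1 using exitless_mult[OF T w] by blast
  obtain \<gamma>' x' \<delta>' where 3: "awalk v \<gamma>' x'" "awalk v \<delta>' x'" "length \<gamma>' = length \<alpha>' + length \<alpha>"
    "length \<delta>' = length \<beta>' + length \<beta>" "b' * b \<approx> mon \<gamma>' x' \<delta>'"
    unfolding 1 using exitless_mult[OF T w(3,4,1,2)] by blast
  have "\<gamma> = \<gamma>' \<and> x = x'" "\<delta> = \<delta>' \<and> x = x'"
    using exitless_unique[OF T 2(1) 3(1)] exitless_unique[OF T 2(2) 3(2)] 2 3 by simp_all
  then show ?thesis using 2(5) eqv_sym[OF 3(5)] eqv_trans by blast
qed

lemma lspan_commute: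
  assumes "p \<in> lspan B" "a \<in> F" "B \<subseteq> F" "\<And>b. b \<in> B \<Longrightarrow> a * b \<approx> b * a"
  shows "a * p \<approx> p * a"
  using assms(1)
proof (induction rule: lspan.induct)
  case (base b)
  then show ?case using assms(4) by simp
next
  case (ideal p)
  then show ?case using assms(2) by (auto simp: eqv_def intro!: I_diff I_closed F_in_A)
next
  case (add p q)
  then show ?case by (simp add: distrib_left distrib_right eqv_add)
next
  case (scale p c)
  then show ?case using eqv_left[OF _ scale.IH, of "C c"] by (simp add: C_left mult.assoc)
qed

lemma lspan_fix_right:
  assumes "p \<in> lspan B" "a \<in> A" "\<And>b. b \<in> B \<Longrightarrow> b * a \<approx> b"
  shows "p * a \<approx> p"
  using assms(1)
proof (induction rule: lspan.induct)
  case (base b)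
  then show ?case using assms(3) by simp
next
  case (ideal p)
  then show ?case using assms(2) by (auto simp: eqv_def intro!: I_diff I_closed F_in_A)
next
  case (add p q)
  then show ?case by (simp add: distrib_right eqv_add)
next
  case (scale p c)
  then show ?case using eqv_left[OF _ scale.IH, of "C c"] by (simp add: mult.assoc)
qed

lemma lspan_fix_left:
  assumes "p \<in> lspan B" "a \<in> A" "\<And>b. b \<in> B \<Longrightarrow> a * b \<approx> b"
  shows "a * p \<approx> p"
  using assms(1)
proof (induction rule: lspan.induct)
  case (base b)
  then show ?case using assms(3) by simp
next
  case (ideal p)
  then show ?case using assms(2) by (auto simp: eqv_def intro!: I_diff I_closed F_in_A)
next
  case (add p q)
  then show ?case by (simp add: distrib_left eqv_add)
next
  case (scale p c)
  then show ?case using eqv_left[OF _ scale.IH, of "C c"] by (simp add: C_left)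
qed

lemma lspan_corner_commute:
  assumes T: "exitless T" "v \<in> T" and p: "p \<in> lspan (corner v)" and q: "q \<in> lspan (corner v)"
  shows "p * q \<approx> q * p"
proof (rule lspan_commute[OF q _ corner_F])
  show pF: "p \<in> F" using lspan_F[OF p corner_F] .
  fix b assume b: "b \<in> corner v"
  have "b * p \<approx> p * b"
    using b corner_F by (intro lspan_commute[OF p _ corner_F] corner_commute[OF T]) auto
  then show "p * b \<approx> b * p" by (rule eqv_sym)
qed

lemma VFV_corner:
  assumes v: "v \<in> verts G" and r: "r \<in> F"
  shows "V v * r * V v \<in> lspan (corner v)"
proof -
  have "V v * r \<in> lspan ((*) (V v) ` Mon UNIV)"
    using v by (intro lspan_left[OF F_lspan[OF r]] lspan.base) auto
  then show ?thesis
  proof (rule lspan_right)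
    show "V v \<in> A" using v by auto
    fix b assume "b \<in> (*) (V v) ` Mon UNIV"
    then obtain \<alpha> u \<beta> s t where b: "b = V v * mon \<alpha> u \<beta>" and w: "awalk s \<alpha> u" "awalk t \<beta> u"
      by (auto simp: Mon_def)
    show "b * V v \<in> lspan (corner v)"
    proof (cases "s = v \<and> t = v")
      case True
      have "b * V v \<approx> mon \<alpha> u \<beta> * V v"
        unfolding b using V_mon[OF w] True v by (intro eqv_right) auto
      also have "\<dots> \<approx> mon \<alpha> u \<beta>" using mon_V[OF w] True by simp
      finally show ?thesis
        using w True by (intro lspan_eqv[OF lspan.base]) (auto simp: corner_def)
    next
      case False
      have "b * V v \<approx> 0"
      proof (cases "s = v")
        case True
        then have "V v * (mon \<alpha> u \<beta> * V v) \<approx> V v * 0"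
          using False v by (intro eqv_left mon_V_0[OF w]) auto
        then show ?thesis by (simp add: b mult.assoc)
      next
        case False
        then have "(V v * mon \<alpha> u \<beta>) * V v \<approx> 0 * V v"
          using v by (intro eqv_right V_mon_0[OF w]) auto
        then show ?thesis by (simp add: b)
      qed
      then show ?thesis by (simp add: eqv_0_iff lspan.ideal)
    qed
  qed
qed

lemma corner_V:
  assumes "p \<in> lspan (corner v)" "v \<in> verts G"
  shows "p * V v \<approx> p" "V v * p \<approx> p"
  using assms(2)
  by (auto intro!: lspan_fix_right[OF assms(1)] lspan_fix_left[OF assms(1)] mon_V V_mon
      simp: corner_def)

text \<open>
  For a cycle \<open>c\<close> at \<open>v\<close> without exit, the corner at \<open>v\<close> is commutative. If \<open>F / J\<close> were simple and
  faithful, then \<open>v - c\<close>, which is not zero, would act injectively on the part of \<open>F / J\<close> at \<open>v\<close>, and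
  would have an inverse in the corner.
\<close>

lemma L_if_primitive_ideal:
  assumes J: "primitive_ideal J"
  shows "condition_L G"
  unfolding condition_L_def
proof (intro allI impI, rule ccontr)
  fix c assume "cycle c" and no: "\<not> (\<exists>e. is_exit G e c)"
  then obtain v where c: "awalk v c v" "c \<noteq> []" unfolding cycle_def by blast
  define T where "T = tail G ` set c"
  have T: "exitless T" "v \<in> T" using exitless_cycle[OF c no] by (simp_all add: T_def)
  have v: "v \<in> verts G" using c by auto
  have outT: "\<exists>e. out_arcs G u = {e} \<and> head G e \<in> T" if "u \<in> T" for u
    using T(1) that unfolding exitless_def by blast
  note JD = left_idealD[OF primitive_idealD(1)[OF J]]
  have IJ: "I \<subseteq> J" using primitive_idealD(2)[OF J] by blast
  note J_eqv = eqv_left_ideal[OF primitive_idealD(1)[OF J] IJ]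
  let ?C = "lspan (corner v)"
  have CF: "p \<in> F" if "p \<in> ?C" for p using lspan_F[OF that corner_F] .
  define z where "z = V v - P c * V v"
  have walk_C: "P \<alpha> * V v \<in> ?C" if "awalk v \<alpha> v" for \<alpha>
  proof -
    have "P \<alpha> * V v = mon \<alpha> v []" by (simp add: mon_def)
    moreover have "awalk v [] v" using v by (simp add: awalk_Nil_iff)
    ultimately show ?thesis using that by (intro lspan.base) (auto simp: corner_def)
  qed
  have VvC: "V v \<in> ?C"
    using walk_C[of "[]"] v by (simp add: awalk_Nil_iff)
  have "P c * V v \<in> ?C"
    by (rule walk_C[OF c(1)])
  then have z: "z \<in> ?C" unfolding z_def using VvC by (intro lspan_diff)
  have zI: "z \<notin> I" "V v - r * z \<notin> I" for r
    using exitless_cycle_notin_I[OF outT c(1) T(2) c(2)] by (simp_all add: z_def)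
  note comm = lspan_corner_commute[OF T]
  obtain q where q: "q \<in> F" "V v * q \<notin> J"
    using primitive_idealD(5)[OF J, of "V v"] V_notin_I v by auto
  define x where "x = V v * q"
  have x: "x \<in> F" "x \<notin> J" using q v by (auto simp: x_def)
  have Vx: "V v * x \<approx> x"
    using eqv_right[OF _ eqv_VV[OF v], of q] q by (simp add: x_def mult.assoc)
  have gen_x: "\<exists>r\<in>F. q' - r * y \<in> J" if "y \<in> F" "y \<notin> J" "q' \<in> F" for y q'
  proof -
    have "verts G \<noteq> {}" using v by blast
    from primitive_ideal_cyclic[OF J that(1,2) this] obtain b where "b \<in> F" "b * y \<notin> J" .
    from primitive_ideal_generate[OF J left_ideal_F that(1) this that(3)] show ?thesis by blast
  qed
  \<comment> \<open>An element of the corner moves past each element of \<open>F\<close> that is applied to \<open>x\<close>.\<close>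
  have pass: "p * (r * x) \<in> J" if p: "p \<in> ?C" "p * x \<in> J" and r: "r \<in> F" for p r
  proof -
    have "p * (r * x) \<approx> (p * V v) * (r * (V v * x))"
      using CF[OF p(1)] r x v Vx by (intro eqv_mult[OF eqv_sym[OF corner_V(1)[OF p(1) v]]]
          eqv_left eqv_sym[OF Vx]) auto
    also have "\<dots> = (p * (V v * r * V v)) * x" by (simp add: mult.assoc)
    also have "\<dots> \<approx> ((V v * r * V v) * p) * x"
      using x by (intro eqv_right comm[OF p(1) VFV_corner[OF v r]]) auto
    finally have "p * (r * x) \<approx> (V v * r * V v) * (p * x)" by (simp add: mult.assoc)
    moreover have "(V v * r * V v) * (p * x) \<in> J"
      using p(2) r v by (intro JD(5)[of "V v * r * V v"]) auto
    ultimately show ?thesis by (rule J_eqv)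
  qed
  have kill: "p \<in> I" if p: "p \<in> ?C" "p * x \<in> J" for p
  proof (rule ccontr)
    assume "p \<notin> I"
    then obtain q' where q': "q' \<in> F" "p * q' \<notin> J"
      using primitive_idealD(5)[OF J CF[OF p(1)]] by blast
    then obtain r where r: "r \<in> F" "q' - r * x \<in> J" using gen_x[OF x] by blast
    have "p * (q' - r * x) \<in> J" using CF[OF p(1)] r by (intro JD(5))
    then have "p * (q' - r * x) + p * (r * x) \<in> J" using pass[OF p r(1)] by (rule JD(3))
    then show False using q'(2) by (simp add: algebra_simps)
  qed
  have "z * x \<notin> J" using kill[OF z] zI(1) by blast
  then obtain r where r: "r \<in> F" "x - r * (z * x) \<in> J"
    using gen_x[of "z * x" x] x CF[OF z] by auto
  define y where "y = V v - (V v * r) * z"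
  have "V v * (r * z) * V v \<in> ?C" using r CF[OF z] by (intro VFV_corner v) auto
  moreover have "V v * r * z \<approx> V v * (r * z) * V v"
    using eqv_left[OF _ eqv_sym[OF corner_V(1)[OF z v]], of "V v * r"] v r by (simp add: mult.assoc)
  ultimately have "V v * r * z \<in> ?C" by (rule lspan_eqv)
  then have yC: "y \<in> ?C" unfolding y_def using VvC by (intro lspan_diff)
  have "V v * (x - r * (z * x)) \<in> J" using r v by (intro JD(5)) auto
  then have "y * x \<in> J" by (simp add: y_def algebra_simps)
  then have "y \<in> I" using kill[OF yC] by blast
  then show False using zI(2) by (simp add: y_def)
qed

section \<open>Ideals without vertices\<close>

text \<open>
  Two-sided ideals of the Leavitt path algebra, as subsets of \<open>F\<close>. Closure under scalars is not
  required; for an element with a local unit it follows from the closure under products.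
\<close>

definition two_sided :: "(('v,'e) lpa_gen word \<Rightarrow>\<^sub>0 'k) set \<Rightarrow> bool" where
  "two_sided H \<longleftrightarrow> H \<subseteq> F \<and> I \<subseteq> H \<and> (\<forall>p\<in>H. \<forall>q\<in>H. p + q \<in> H) \<and> (\<forall>p\<in>H. - p \<in> H) \<and>
     (\<forall>a\<in>F. \<forall>p\<in>H. a * p \<in> H \<and> p * a \<in> H)"

lemma two_sidedD:
  assumes "two_sided H"
  shows "p \<in> H \<Longrightarrow> p \<in> F" "p \<in> I \<Longrightarrow> p \<in> H" "p \<in> H \<Longrightarrow> q \<in> H \<Longrightarrow> p + q \<in> H"
    "a \<in> F \<Longrightarrow> p \<in> H \<Longrightarrow> a * p \<in> H" "a \<in> F \<Longrightarrow> p \<in> H \<Longrightarrow> p * a \<in> H" "p \<in> H \<Longrightarrow> - p \<in> H"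
  using assms by (auto simp: two_sided_def)

lemma two_sided_diff: "two_sided H \<Longrightarrow> p \<in> H \<Longrightarrow> q \<in> H \<Longrightarrow> p - q \<in> H"
  using two_sidedD(3)[OF _ _ two_sidedD(6), of H p q] by simp

lemma two_sided_eqv:
  assumes "two_sided H" "p \<approx> q" "q \<in> H"
  shows "p \<in> H"
proof -
  have "(p - q) + q \<in> H"
    using assms by (intro two_sidedD(3)) (auto simp: eqv_def intro: two_sidedD(2))
  then show ?thesis by simp
qed

lemma is_exit_iff: "is_exit G e p \<longleftrightarrow> e \<in> arcs G \<and> (\<exists>f\<in>set p. tail G e = tail G f \<and> e \<noteq> f)"
  unfolding is_exit_def by (metis in_set_conv_nth)

lemma closed_walk_exit:
  assumes L: "condition_L G" and "awalk u p u" "p \<noteq> []"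
  shows "\<exists>e. is_exit G e p"
  using assms(2,3)
proof (induction "length p" arbitrary: p u rule: less_induct)
  case less
  show ?case
  proof (cases "distinct (tl (awalk_verts u p))")
    case True
    then have "cycle p" using less.prems by (auto simp: cycle_def)
    then show ?thesis using L by (simp add: condition_L_def)
  next
    case False
    obtain e es where p: "p = e # es" using less.prems(2) by (cases p) auto
    then have "awalk (head G e) es u" "\<not> distinct (awalk_verts (head G e) es)"
      using False less.prems(1) by (auto simp: awalk_Cons_iff)
    then obtain q r s w where r: "es = q @ r @ s" "awalk w r w" "r \<noteq> []"
      using awalk_not_distinct_decomp by (metis length_greater_0_conv)
    then have "length r < length p" using p by simp
    then obtain e' where "is_exit G e' r" using less.hyps r(2,3) by blast
    then show ?thesis using r(1) p by (auto simp: is_exit_iff)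
  qed
qed

text \<open>A path that leaves the closed walk \<open>\<gamma>\<close> is not a prefix of a power of \<open>\<gamma>\<close>.\<close>

lemma aperiodic_path:
  assumes L: "condition_L G" and \<gamma>: "awalk v \<gamma> v" "\<gamma> \<noteq> []"
  obtains \<mu> w where "awalk v \<mu> w" "\<not> prefix \<mu> (\<gamma> @ \<mu>)"
proof -
  obtain e f where e: "e \<in> arcs G" "f \<in> set \<gamma>" "tail G e = tail G f" "e \<noteq> f"
    using closed_walk_exit[OF assms] by (auto simp: is_exit_iff)
  obtain xs ys where xy: "\<gamma> = xs @ f # ys" using e(2) by (metis split_list)
  have "awalk v xs (tail G f)"
    using \<gamma>(1) unfolding xy by (metis awalk_Cons_iff awalk_append_iff)
  then have "awalk v (xs @ [e]) (head G e)"
    using e by (intro awalk_appendI) (auto simp: awalk_Cons_iff awalk_Nil_iff)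
  moreover have "\<not> prefix (xs @ [e]) (\<gamma> @ xs @ [e])"
    using e(4) by (auto simp: xy)
  ultimately show thesis by (rule that)
qed

text \<open>
  The linear combination of the paths \<open>\<gamma>\<close>, all ending at \<open>u\<close>, with the coefficients \<open>c\<close> that are
  listed in \<open>xs\<close>. Repetitions in the list are allowed.
\<close>

definition pathsum :: "'v \<Rightarrow> ('k \<times> 'e list) list \<Rightarrow> ('v,'e) lpa_gen word \<Rightarrow>\<^sub>0 'k" where
  "pathsum u xs = (\<Sum>(c, \<gamma>)\<leftarrow>xs. C c * (P \<gamma> * V u))"

text \<open>All paths in the list are closed walks at \<open>u\<close> of positive length.\<close>

definition closed_walks :: "'v \<Rightarrow> ('k \<times> 'e list) list \<Rightarrow> bool" where
  "closed_walks u xs \<longleftrightarrow> (\<forall>(c, \<gamma>)\<in>set xs. \<gamma> \<noteq> [] \<and> awalk u \<gamma> u)"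

lemma pathsum_simps [simp]:
  "pathsum u [] = 0" "pathsum u ((c, \<gamma>) # xs) = C c * (P \<gamma> * V u) + pathsum u xs"
  by (simp_all add: pathsum_def)

lemma closed_walks_simps [simp]:
  "closed_walks u []" "closed_walks u ((c, \<gamma>) # xs) \<longleftrightarrow> \<gamma> \<noteq> [] \<and> awalk u \<gamma> u \<and> closed_walks u xs"
  by (auto simp: closed_walks_def)

text \<open>
  The map \<open>p \<mapsto> \<mu>\<^sup>*p\<mu>\<close> takes the start of \<open>\<mu>\<close> to its end, and a closed walk \<open>\<gamma>\<close> at the start to \<open>0\<close>, or to
  a closed walk of the same length at the end; the latter happens only if \<open>\<mu>\<close> is a prefix of \<open>\<gamma>\<mu>\<close>.
\<close>

lemma compress_closed_walk:
  assumes \<gamma>: "awalk u \<gamma> u" "\<gamma> \<noteq> []" and \<mu>: "awalk u \<mu> w"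
  defines "T \<equiv> \<lambda>p. (V w * S \<mu>) * p * (P \<mu> * V w)"
  shows "prefix \<mu> (\<gamma> @ \<mu>) \<Longrightarrow> \<exists>\<delta>. \<delta> \<noteq> [] \<and> awalk w \<delta> w \<and> T (P \<gamma> * V u) \<approx> P \<delta> * V w"
    "\<not> prefix \<mu> (\<gamma> @ \<mu>) \<Longrightarrow> T (P \<gamma> * V u) \<approx> 0"
proof -
  have w: "awalk u (\<gamma> @ \<mu>) w" using \<gamma>(1) \<mu> by (rule awalk_appendI)
  have "T (P \<gamma> * V u) = (V w * S \<mu>) * (P \<gamma> * (V u * (P \<mu> * V w)))"
    by (simp add: T_def mult.assoc)
  also have "\<dots> \<approx> (V w * S \<mu>) * (P \<gamma> * (P \<mu> * V w))"
    using \<gamma> \<mu> by (intro eqv_left eqv_VP) auto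
  also have "\<dots> = V w * (S \<mu> * P (\<gamma> @ \<mu>) * V w)"
    by (simp add: P_append mult.assoc)
  finally have eq: "T (P \<gamma> * V u) \<approx> V w * (S \<mu> * P (\<gamma> @ \<mu>) * V w)" .
  show "\<exists>\<delta>. \<delta> \<noteq> [] \<and> awalk w \<delta> w \<and> T (P \<gamma> * V u) \<approx> P \<delta> * V w" if "prefix \<mu> (\<gamma> @ \<mu>)"
  proof -
    obtain \<delta> where \<delta>: "\<gamma> @ \<mu> = \<mu> @ \<delta>" using \<open>prefix _ _\<close> by (auto simp: prefix_def)
    then have "length \<delta> = length \<gamma>" by (metis add_left_cancel length_append add.commute)
    then have "\<delta> \<noteq> []" using \<gamma>(2) by auto
    have \<delta>w: "awalk w \<delta> w" using w \<mu> unfolding \<delta> by auto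
    have "V w * (S \<mu> * P (\<gamma> @ \<mu>) * V w) \<approx> V w * (P \<delta> * V w)"
      unfolding \<delta> using \<mu> \<delta>w by (intro eqv_left eqv_cancel_prefix) auto
    also have "\<dots> \<approx> P \<delta> * V w" using \<delta>w by (rule eqv_VP)
    finally show ?thesis using eq \<open>\<delta> \<noteq> []\<close> \<delta>w eqv_trans by blast
  qed
  show "T (P \<gamma> * V u) \<approx> 0" if "\<not> prefix \<mu> (\<gamma> @ \<mu>)"
  proof -
    have "\<not> prefix (\<gamma> @ \<mu>) \<mu>" using \<gamma>(2) by (auto dest: prefix_length_le)
    then have "V w * (S \<mu> * P (\<gamma> @ \<mu>) * V w) \<approx> V w * (0 * V w)"
      using that \<mu> w by (intro eqv_left eqv_right eqv_incomparable[OF \<mu> w]) auto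
    then show ?thesis using eq eqv_trans by fastforce
  qed
qed

lemma compress_vertex:
  assumes \<mu>: "awalk u \<mu> w"
  shows "(V w * S \<mu>) * V u * (P \<mu> * V w) \<approx> V w"
proof -
  have "(V w * S \<mu>) * V u * (P \<mu> * V w) = V w * (S \<mu> * V u * P \<mu>) * V w"
    by (simp add: mult.assoc)
  also have "\<dots> \<approx> V w * V w * V w"
    using \<mu> by (intro eqv_left eqv_right eqv_SVP) auto
  also have "\<dots> \<approx> V w * V w"
    using \<mu> by (intro eqv_right eqv_VV) auto
  also have "\<dots> \<approx> V w" using \<mu> by (intro eqv_VV) auto
  finally show ?thesis .
qed

lemma compress_pathsum:
  assumes \<mu>: "awalk u \<mu> w" and "closed_walks u xs"
  shows "\<exists>ys. length ys \<le> length xs \<and> closed_walks w ys \<and>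
    (V w * S \<mu>) * pathsum u xs * (P \<mu> * V w) \<approx> pathsum w ys"
  using assms(2)
proof (induction xs)
  case Nil
  then show ?case by (intro exI[of _ "[]"]) simp
next
  case (Cons x xs)
  obtain c \<gamma> where x: "x = (c, \<gamma>)" by (cases x)
  then have \<gamma>: "\<gamma> \<noteq> []" "awalk u \<gamma> u" "closed_walks u xs" using Cons.prems by auto
  let ?T = "\<lambda>p. (V w * S \<mu>) * p * (P \<mu> * V w)"
  obtain ys where ys: "length ys \<le> length xs" "closed_walks w ys" "?T (pathsum u xs) \<approx> pathsum w ys"
    using Cons.IH \<gamma>(3) by blast
  have T: "?T (pathsum u (x # xs)) = C c * ?T (P \<gamma> * V u) + ?T (pathsum u xs)"
    by (simp add: x distrib_left distrib_right C_left mult.assoc)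
  show ?case
  proof (cases "prefix \<mu> (\<gamma> @ \<mu>)")
    case True
    then obtain \<delta> where \<delta>: "\<delta> \<noteq> []" "awalk w \<delta> w" "?T (P \<gamma> * V u) \<approx> P \<delta> * V w"
      using compress_closed_walk(1)[OF \<gamma>(2,1) \<mu>] by blast
    have "?T (pathsum u (x # xs)) \<approx> pathsum w ((c, \<delta>) # ys)"
      unfolding T pathsum_simps using \<delta>(3) ys(3) by (intro eqv_add eqv_left) auto
    then show ?thesis using ys \<delta> by (intro exI[of _ "(c, \<delta>) # ys"]) simp
  next
    case False
    have "?T (pathsum u (x # xs)) \<approx> C c * 0 + pathsum w ys"
      unfolding T using compress_closed_walk(2)[OF \<gamma>(2,1) \<mu> False] ys(3)
      by (intro eqv_add eqv_left) auto
    then show ?thesis using ys by (intro exI[of _ ys]) simp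
  qed
qed

text \<open>
  A combination of a vertex and closed walks of positive length at it can be compressed to a multiple
  of a vertex, as each closed walk can be removed by a path \<open>\<mu>\<close> that leaves it.
\<close>

lemma vertex_coefficient_0:
  assumes L: "condition_L G" and H: "two_sided H" and no: "\<And>v. v \<in> verts G \<Longrightarrow> V v \<notin> H"
    and "u \<in> verts G" "closed_walks u xs" "C k * V u + pathsum u xs \<in> H"
  shows "k = 0"
  using assms(4-)
proof (induction "length xs" arbitrary: u xs rule: less_induct)
  case less
  show ?case
  proof (cases xs)
    case Nil
    show ?thesis
    proof (rule ccontr)
      assume k: "k \<noteq> 0"
      have "(C (inverse k) * V u) * (C k * V u) \<in> H"
        using less.prems Nil
        by (intro two_sidedD(4)[OF H, where a = "C (inverse k) * V u" and p = "C k * V u"]) auto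
      moreover have "(C (inverse k) * V u) * (C k * V u) = C (inverse k) * (C k * (V u * V u))"
        unfolding mult.assoc C_left[of "V u"] by (rule refl)
      then have "(C (inverse k) * V u) * (C k * V u) = C (inverse k * k) * (V u * V u)"
        unfolding C_mult[symmetric] by (simp only: mult.assoc)
      then have "(C (inverse k) * V u) * (C k * V u) = V u * V u"
        using k by simp
      ultimately have "V u \<in> H"
        using two_sided_eqv[OF H eqv_sym[OF eqv_VV]] less.prems(1) by metis
      then show False using no less.prems(1) by blast
    qed
  next
    case (Cons x xs')
    obtain c \<gamma> where x: "x = (c, \<gamma>)" by (cases x)
    then have \<gamma>: "\<gamma> \<noteq> []" "awalk u \<gamma> u" "closed_walks u xs'" using less.prems Cons by auto
    obtain \<mu> w where \<mu>: "awalk u \<mu> w" "\<not> prefix \<mu> (\<gamma> @ \<mu>)" using aperiodic_path[OF L \<gamma>(2,1)] .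
    let ?T = "\<lambda>p. (V w * S \<mu>) * p * (P \<mu> * V w)"
    obtain ys where ys: "length ys \<le> length xs'" "closed_walks w ys" "?T (pathsum u xs') \<approx> pathsum w ys"
      using compress_pathsum[OF \<mu>(1) \<gamma>(3)] by blast
    have "?T (C k * V u + pathsum u xs) = C k * ?T (V u) + (C c * ?T (P \<gamma> * V u) + ?T (pathsum u xs'))"
      by (simp add: x Cons distrib_left distrib_right C_left mult.assoc)
    also have "\<dots> \<approx> C k * V w + (C c * 0 + pathsum w ys)"
      using compress_vertex[OF \<mu>(1)] compress_closed_walk(2)[OF \<gamma>(2,1) \<mu>] ys(3)
      by (intro eqv_add eqv_left) auto
    finally have "C k * V w + pathsum w ys \<approx> ?T (C k * V u + pathsum u xs)"
      using eqv_sym by simp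
    moreover have "?T (C k * V u + pathsum u xs) \<in> H"
      using less.prems(3) \<mu>(1) by (intro two_sidedD(4,5)[OF H]) auto
    ultimately have "C k * V w + pathsum w ys \<in> H" by (rule two_sided_eqv[OF H])
    then show ?thesis
      using less.hyps[of ys w] ys Cons \<mu>(1) by auto
  qed
qed

text \<open>The linear combinations of paths that end at \<open>u\<close>, as elements of the free algebra.\<close>

definition paths_to :: "'v \<Rightarrow> (('v,'e) lpa_gen word \<Rightarrow>\<^sub>0 'k) set" where
  "paths_to u = {b. \<forall>w\<in>Poly_Mapping.keys b. \<exists>\<alpha> s. w = Word (map Edge \<alpha>) \<and> awalk s \<alpha> u}"

lemma paths_to_closed:
  "0 \<in> paths_to u" "b \<in> paths_to u \<Longrightarrow> b' \<in> paths_to u \<Longrightarrow> b + b' \<in> paths_to u"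
  "b \<in> paths_to u \<Longrightarrow> C c * b \<in> paths_to u" "awalk s \<alpha> u \<Longrightarrow> P \<alpha> \<in> paths_to u"
proof -
  show "0 \<in> paths_to u" by (simp add: paths_to_def)
  show "b + b' \<in> paths_to u" if "b \<in> paths_to u" "b' \<in> paths_to u"
    using that keys_add[of b b'] unfolding paths_to_def by blast
  show "C c * b \<in> paths_to u" if b: "b \<in> paths_to u"
  proof -
    have "Poly_Mapping.keys (C c * b) \<subseteq> Poly_Mapping.keys b"
      using keys_mult[of "C c" b] by (auto split: if_splits)
    then show ?thesis using b unfolding paths_to_def by blast
  qed
  show "P \<alpha> \<in> paths_to u" if "awalk s \<alpha> u"
    using that by (auto simp: paths_to_def P_def)
qed

lemma paths_to_A: "b \<in> paths_to u \<Longrightarrow> b \<in> A"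
  by (fastforce simp: paths_to_def A_def unital_carrier_def lpa_gens_def dest: awalk_arcs)

lemma paths_to_Ed:
  assumes "b \<in> paths_to (tail G f)" "f \<in> arcs G"
  shows "b * Ed f \<in> paths_to (head G f)" "b * Ed f = 0 \<Longrightarrow> b = 0"
proof -
  show "b * Ed f \<in> paths_to (head G f)"
    unfolding paths_to_def
  proof (intro CollectI ballI)
    fix w assume "w \<in> Poly_Mapping.keys (b * Ed f)"
    then obtain w' where "w = w' + Word [Edge f]" "w' \<in> Poly_Mapping.keys b"
      using keys_mult[of b "Ed f"] by (auto simp: gen_def)
    moreover from this(2) obtain \<alpha> s where "w' = Word (map Edge \<alpha>)" "awalk s \<alpha> (tail G f)"
      using assms(1) unfolding paths_to_def by blast
    ultimately show "\<exists>\<alpha> s. w = Word (map Edge \<alpha>) \<and> awalk s \<alpha> (head G f)"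
      using assms(2)
      by (intro exI[of _ "\<alpha> @ [f]"] exI[of _ s])
        (auto simp: plus_word_def awalk_Cons_iff awalk_Nil_iff)
  qed
  show "b = 0" if "b * Ed f = 0"
  proof (rule poly_mapping_eqI)
    fix w
    show "Poly_Mapping.lookup b w = Poly_Mapping.lookup 0 w"
      using lookup_times_single[of b "Edge f" w] that by (simp add: gen_def)
  qed
qed

text \<open>
  Multiplication by \<open>\<alpha>\<^sup>*\<close> for a shortest path \<open>\<alpha>\<close> in \<open>b\<close> turns \<open>b\<close> into a combination of the vertex \<open>u\<close>,
  with the coefficient of \<open>\<alpha>\<close>, and of closed walks of positive length at \<open>u\<close>.
\<close>

lemma paths_to_notin:
  assumes L: "condition_L G" and H: "two_sided H" and no: "\<And>v. v \<in> verts G \<Longrightarrow> V v \<notin> H"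
    and b: "b \<in> paths_to u" "b * V u \<in> H" and u: "u \<in> verts G"
  shows "b = 0"
proof (rule ccontr)
  assume "b \<noteq> 0"
  then have "\<exists>w. w \<in> Poly_Mapping.keys b"
    by (metis keys_eq_empty ex_in_conv)
  then obtain w0 where w0: "w0 \<in> Poly_Mapping.keys b"
    and min: "\<And>w. w \<in> Poly_Mapping.keys b \<Longrightarrow> length (letters w0) \<le> length (letters w)"
    using ex_has_least_nat[of "\<lambda>w. w \<in> Poly_Mapping.keys b" _ "\<lambda>w. length (letters w)"] by blast
  obtain \<alpha>0 s0 where \<alpha>0: "w0 = Word (map Edge \<alpha>0)" "awalk s0 \<alpha>0 u"
    using b(1) w0 unfolding paths_to_def by blast
  let ?T = "\<lambda>p. (V u * S \<alpha>0) * p * V u"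
  have sing: "Poly_Mapping.single (Word (map Edge \<alpha>)) c = C c * P \<alpha>" for \<alpha> c
    by (simp add: P_def mult_single)
  have rest: "\<exists>xs. closed_walks u xs \<and>
      ?T (\<Sum>w\<in>W. Poly_Mapping.single w (Poly_Mapping.lookup b w)) \<approx> pathsum u xs"
    if "finite W" "W \<subseteq> Poly_Mapping.keys b - {w0}" for W
    using that
  proof (induction W)
    case empty
    then show ?case by (intro exI[of _ "[]"]) simp
  next
    case (insert w W)
    then obtain xs where xs: "closed_walks u xs"
      "?T (\<Sum>w\<in>W. Poly_Mapping.single w (Poly_Mapping.lookup b w)) \<approx> pathsum u xs"
      by auto
    have w: "w \<in> Poly_Mapping.keys b" "w \<noteq> w0" using insert.prems by auto
    then obtain \<alpha> s where \<alpha>: "w = Word (map Edge \<alpha>)" "awalk s \<alpha> u"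
      using b(1) unfolding paths_to_def by blast
    let ?c = "Poly_Mapping.lookup b w"
    have len: "length \<alpha>0 \<le> length \<alpha>" "\<alpha> \<noteq> \<alpha>0"
      using min[OF w(1)] w(2) \<alpha>(1) \<alpha>0(1) by auto
    have T: "?T (\<Sum>w\<in>insert w W. Poly_Mapping.single w (Poly_Mapping.lookup b w)) =
        C ?c * ?T (P \<alpha>) + ?T (\<Sum>w\<in>W. Poly_Mapping.single w (Poly_Mapping.lookup b w))"
      using insert.hyps by (simp add: \<alpha>(1) sing distrib_left distrib_right C_left mult.assoc)
    have "(\<exists>\<delta>. \<delta> \<noteq> [] \<and> awalk u \<delta> u \<and> ?T (P \<alpha>) \<approx> P \<delta> * V u) \<or> ?T (P \<alpha>) \<approx> 0"
    proof (cases "prefix \<alpha>0 \<alpha>")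
      case True
      then obtain \<delta> where \<delta>: "\<alpha> = \<alpha>0 @ \<delta>" by (auto simp: prefix_def)
      then obtain x where x: "awalk s \<alpha>0 x" "awalk x \<delta> u" using \<alpha>(2) by auto
      have "?T (P \<alpha>) = V u * (S \<alpha>0 * P (\<alpha>0 @ \<delta>) * V u)" by (simp add: \<delta> mult.assoc)
      also have "\<dots> \<approx> V u * (P \<delta> * V u)"
        using x u by (intro eqv_left eqv_cancel_prefix) auto
      finally have T\<alpha>: "?T (P \<alpha>) \<approx> V u * (P \<delta> * V u)" .
      show ?thesis
      proof (cases "x = u")
        case True
        have "\<delta> \<noteq> []" using len(2) \<delta> by auto
        moreover have "?T (P \<alpha>) \<approx> P \<delta> * V u"
          using T\<alpha> eqv_VP[OF x(2)] True eqv_trans by blast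
        ultimately show ?thesis using x(2) True by blast
      next
        case False
        have "V u * (P \<delta> * V u) \<approx> 0"
          using x False u by (intro left_local_0[OF eqv_VP[OF x(2)]] eqv_V_neq) auto
        then show ?thesis using T\<alpha> eqv_trans by blast
      qed
    next
      case False
      moreover have "\<not> prefix \<alpha> \<alpha>0"
        using len by (auto simp: prefix_def)
      ultimately have "V u * (S \<alpha>0 * P \<alpha>) * V u \<approx> V u * 0 * V u"
        using u by (intro eqv_left eqv_right eqv_incomparable[OF \<alpha>0(2) \<alpha>(2)]) auto
      then show ?thesis by (simp add: mult.assoc)
    qed
    then show ?case
    proof (elim disjE exE conjE)
      fix \<delta> assume \<delta>: "\<delta> \<noteq> []" "awalk u \<delta> u" "?T (P \<alpha>) \<approx> P \<delta> * V u"
      show ?thesis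
        unfolding T using \<delta> xs
        by (intro exI[of _ "(?c, \<delta>) # xs"]) (auto intro!: eqv_add eqv_left)
    next
      assume "?T (P \<alpha>) \<approx> 0"
      then have "C ?c * ?T (P \<alpha>) + ?T (\<Sum>w\<in>W. Poly_Mapping.single w (Poly_Mapping.lookup b w)) \<approx>
          C ?c * 0 + pathsum u xs"
        using xs(2) by (intro eqv_add eqv_left) auto
      then show ?thesis unfolding T using xs(1) by auto
    qed
  qed
  let ?k = "Poly_Mapping.lookup b w0"
  obtain xs where xs: "closed_walks u xs"
    "?T (\<Sum>w\<in>Poly_Mapping.keys b - {w0}. Poly_Mapping.single w (Poly_Mapping.lookup b w)) \<approx> pathsum u xs"
    using rest[of "Poly_Mapping.keys b - {w0}"] by auto
  have "b = C ?k * P \<alpha>0 + (\<Sum>w\<in>Poly_Mapping.keys b - {w0}. Poly_Mapping.single w (Poly_Mapping.lookup b w))"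
    using poly_mapping_expand[of b] sum.remove[OF finite_keys w0] sing \<alpha>0(1) by metis
  then have "?T b = ?T (C ?k * P \<alpha>0 +
      (\<Sum>w\<in>Poly_Mapping.keys b - {w0}. Poly_Mapping.single w (Poly_Mapping.lookup b w)))"
    by (rule arg_cong)
  also have "\<dots> = C ?k * (V u * (S \<alpha>0 * P \<alpha>0 * V u)) +
      ?T (\<Sum>w\<in>Poly_Mapping.keys b - {w0}. Poly_Mapping.single w (Poly_Mapping.lookup b w))"
    by (simp add: distrib_left distrib_right C_left mult.assoc)
  also have "\<dots> \<approx> C ?k * (V u * V u) + pathsum u xs"
    using u \<alpha>0 by (intro eqv_add xs(2) eqv_left eqv_SPV) auto
  also have "\<dots> \<approx> C ?k * V u + pathsum u xs"
    using u eqv_A(2)[OF xs(2)] by (intro eqv_add eqv_left eqv_VV) auto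
  finally have "C ?k * V u + pathsum u xs \<approx> ?T b" by (rule eqv_sym)
  moreover have "(V u * S \<alpha>0) * (b * V u) \<in> H"
    using u \<alpha>0(2) b(2)
    by (intro two_sidedD(4)[OF H, where a = "V u * S \<alpha>0" and p = "b * V u"]) auto
  then have "?T b \<in> H" by (simp add: mult.assoc)
  ultimately have "C ?k * V u + pathsum u xs \<in> H" by (rule two_sided_eqv[OF H])
  then have "?k = 0" using vertex_coefficient_0[OF L H no u xs(1)] by blast
  then show False using w0 by (simp add: in_keys_iff)
qed

lemma I_sum: "(\<And>x. x \<in> M \<Longrightarrow> g x \<in> I) \<Longrightarrow> sum g M \<in> I"
  by (induction M rule: infinite_finite_induct) auto

text \<open>The monomials \<open>\<alpha>\<beta>\<^sup>*\<close> with \<open>\<beta>\<close> a path from \<open>v\<close> of length at most \<open>n\<close>.\<close>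

definition Mon_to :: "nat \<Rightarrow> 'v \<Rightarrow> (('v,'e) lpa_gen word \<Rightarrow>\<^sub>0 'k) set" where
  "Mon_to n v = {mon \<alpha> u \<beta> |\<alpha> u \<beta>. (\<exists>s. awalk s \<alpha> u) \<and> awalk v \<beta> u \<and> length \<beta> \<le> n}"

lemma Mon_toI: "awalk s \<alpha> u \<Longrightarrow> awalk v \<beta> u \<Longrightarrow> length \<beta> \<le> n \<Longrightarrow> mon \<alpha> u \<beta> \<in> Mon_to n v"
  unfolding Mon_to_def by blast

lemma mon_mult_Ed:
  assumes "awalk s \<alpha> u" "awalk (tail G e) (e # \<beta>) u" "f \<in> arcs G"
  shows "mon \<alpha> u (e # \<beta>) * Ed f \<approx> (if e = f then mon \<alpha> u \<beta> else 0)"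
proof -
  have e: "e \<in> arcs G" "awalk (head G e) \<beta> u" using assms(2) by (auto simp: awalk_Cons_iff)
  have "mon \<alpha> u (e # \<beta>) * Ed f = mon \<alpha> u \<beta> * (Gh e * Ed f)"
    by (simp add: mon_def S_Cons mult.assoc)
  also have "\<dots> \<approx> mon \<alpha> u \<beta> * (if e = f then V (head G e) else 0)"
    using e assms by (intro eqv_left eqv_CK1) auto
  also have "\<dots> \<approx> (if e = f then mon \<alpha> u \<beta> else 0)"
    using mon_V[OF assms(1) e(2)] by auto
  finally show ?thesis .
qed

lemma mon_Nil_mult_Ed:
  assumes "awalk s \<alpha> (tail G f)" "f \<in> arcs G"
  shows "mon \<alpha> (tail G f) [] * Ed f \<approx> mon (\<alpha> @ [f]) (head G f) []"
proof -
  have "mon \<alpha> (tail G f) [] * Ed f = P \<alpha> * (V (tail G f) * Ed f)"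
    by (simp add: mon_def mult.assoc)
  also have "\<dots> \<approx> P \<alpha> * Ed f" using assms by (intro eqv_left eqv_E) auto
  also have "\<dots> \<approx> P \<alpha> * (Ed f * V (head G f))"
    using assms by (intro eqv_left eqv_sym[OF eqv_E(2)]) auto
  also have "\<dots> = mon (\<alpha> @ [f]) (head G f) []"
    by (simp add: mon_def P_append P_single mult.assoc)
  finally show ?thesis .
qed

lemma Mon_to_Ed:
  assumes a: "a \<in> lspan (Mon_to (Suc n) (tail G f))" and f: "f \<in> arcs G"
  shows "a * Ed f \<in> lspan (Mon_to n (head G f))"
  using a
proof (rule lspan_right)
  show "Ed f \<in> A" using f by auto
  fix b assume "b \<in> Mon_to (Suc n) (tail G f)"
  then obtain \<alpha> u \<beta> s where b: "b = mon \<alpha> u \<beta>" "awalk s \<alpha> u" "awalk (tail G f) \<beta> u" "length \<beta> \<le> Suc n"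
    by (auto simp: Mon_to_def)
  show "b * Ed f \<in> lspan (Mon_to n (head G f))"
  proof (cases \<beta>)
    case Nil
    then have u: "u = tail G f" using b(3) by (simp add: awalk_Nil_iff)
    have "awalk s (\<alpha> @ [f]) (head G f)"
      using b(2) f u by (intro awalk_appendI) (auto simp: awalk_simps)
    moreover have "awalk (head G f) [] (head G f)" using f by (simp add: awalk_Nil_iff)
    ultimately have "mon (\<alpha> @ [f]) (head G f) [] \<in> Mon_to n (head G f)"
      by (intro Mon_toI) auto
    moreover have "b * Ed f \<approx> mon (\<alpha> @ [f]) (head G f) []"
      using mon_Nil_mult_Ed[OF b(2)[unfolded u] f] by (simp add: b(1) Nil u)
    ultimately show ?thesis by (intro lspan_eqv[OF lspan.base])
  next
    case (Cons e \<beta>')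
    then have e: "tail G e = tail G f" "awalk (head G e) \<beta>' u" using b(3) by (auto simp: awalk_Cons_iff)
    have "awalk (tail G e) (e # \<beta>') u" using b(3) Cons e(1) by simp
    from mon_mult_Ed[OF b(2) this f]
    have *: "b * Ed f \<approx> (if e = f then mon \<alpha> u \<beta>' else 0)"
      by (simp only: b(1) Cons)
    show ?thesis
    proof (cases "e = f")
      case True
      then have "mon \<alpha> u \<beta>' \<in> Mon_to n (head G f)"
        using b Cons e by (intro Mon_toI) auto
      then show ?thesis using * True by (auto intro: lspan_eqv[OF lspan.base])
    next
      case False
      then show ?thesis using * by (auto simp: eqv_0_iff intro: lspan.ideal)
    qed
  qed
qed

text \<open>The monomials \<open>\<alpha>\<beta>\<^sup>*\<close> with \<open>\<beta>\<close> a path from \<open>v\<close> of positive length whose first arc is in \<open>M\<close>.\<close>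

definition Mon_arcs :: "'e set \<Rightarrow> 'v \<Rightarrow> (('v,'e) lpa_gen word \<Rightarrow>\<^sub>0 'k) set" where
  "Mon_arcs M v = {mon \<alpha> u (e # \<beta>) |\<alpha> u e \<beta>. e \<in> M \<and> (\<exists>s. awalk s \<alpha> u) \<and> awalk v (e # \<beta>) u}"

text \<open>
  An element separates into a combination of paths, and one of monomials \<open>\<alpha>\<beta>\<^sup>*\<close> in which the first
  arc of \<open>\<beta>\<close> is one of finitely many.
\<close>

lemma Mon_to_split:
  assumes "a \<in> lspan (Mon_to n v)" "v \<in> verts G"
  shows "\<exists>b M a'. b \<in> paths_to v \<and> finite M \<and> M \<subseteq> out_arcs G v \<and> a' \<in> lspan (Mon_arcs M v) \<and>
    a \<approx> b * V v + a'"
  using assms(1)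
proof (induction rule: lspan.induct)
  case (base b)
  then obtain \<alpha> u \<beta> s where b: "b = mon \<alpha> u \<beta>" "awalk s \<alpha> u" "awalk v \<beta> u"
    by (auto simp: Mon_to_def)
  show ?case
  proof (cases \<beta>)
    case Nil
    then have "b = P \<alpha> * V v + 0" "awalk s \<alpha> v"
      using b by (auto simp: mon_def awalk_Nil_iff)
    moreover from this have "b \<approx> P \<alpha> * V v + 0"
      using assms(2) by auto
    ultimately show ?thesis
      by (intro exI[of _ "P \<alpha>"] exI[of _ "{}"] exI[of _ 0]) (auto intro: paths_to_closed lspan.ideal)
  next
    case (Cons e \<beta>')
    then have "b \<in> Mon_arcs {e} v"
      using b unfolding Mon_arcs_def by blast
    moreover have "e \<in> out_arcs G v"
      using b(3) Cons by (simp add: awalk_Cons_iff)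
    moreover have "b \<in> F" using b by auto
    ultimately show ?thesis
      by (intro exI[of _ 0] exI[of _ "{e}"] exI[of _ b]) (auto intro: paths_to_closed lspan.base)
  qed
next
  case (ideal p)
  then show ?case
    by (intro exI[of _ 0] exI[of _ "{}"] exI[of _ p]) (auto intro: paths_to_closed lspan.ideal)
next
  case (add p q)
  then obtain b M a' b' M' a'' where
    1: "b \<in> paths_to v" "finite M" "M \<subseteq> out_arcs G v" "a' \<in> lspan (Mon_arcs M v)" "p \<approx> b * V v + a'" and
    2: "b' \<in> paths_to v" "finite M'" "M' \<subseteq> out_arcs G v" "a'' \<in> lspan (Mon_arcs M' v)" "q \<approx> b' * V v + a''"
    by metis
  have sub: "Mon_arcs M v \<subseteq> lspan (Mon_arcs (M \<union> M') v)" "Mon_arcs M' v \<subseteq> lspan (Mon_arcs (M \<union> M') v)"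
    unfolding Mon_arcs_def by (blast intro: lspan.base)+
  have "p + q \<approx> (b * V v + a') + (b' * V v + a'')"
    using 1(5) 2(5) by (rule eqv_add)
  then have "p + q \<approx> (b + b') * V v + (a' + a'')"
    by (simp add: algebra_simps)
  moreover have "a' + a'' \<in> lspan (Mon_arcs (M \<union> M') v)"
    using lspan_mono[OF 1(4) sub(1)] lspan_mono[OF 2(4) sub(2)] by (rule lspan.add)
  ultimately show ?case
    using 1 2 by (intro exI[of _ "b + b'"] exI[of _ "M \<union> M'"] exI[of _ "a' + a''"])
      (auto intro: paths_to_closed)
next
  case (scale p c)
  then obtain b M a' where
    1: "b \<in> paths_to v" "finite M" "M \<subseteq> out_arcs G v" "a' \<in> lspan (Mon_arcs M v)" "p \<approx> b * V v + a'"
    by blast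
  have "C c * p \<approx> C c * (b * V v + a')"
    using 1(5) by (intro eqv_left) auto
  then have "C c * p \<approx> (C c * b) * V v + C c * a'"
    by (simp add: algebra_simps)
  then show ?case
    using 1 by (intro exI[of _ "C c * b"] exI[of _ M] exI[of _ "C c * a'"])
      (auto intro: paths_to_closed lspan.scale)
qed

lemma Mon_arcs_eqv:
  assumes a: "a \<in> lspan (Mon_arcs M v)" and M: "finite M" "M \<subseteq> arcs G"
  shows "a \<approx> (\<Sum>e\<in>M. a * Ed e * Gh e)"
proof -
  let ?s = "\<Sum>e\<in>M. Ed e * Gh e"
  have sA: "?s \<in> A" using M by (intro A_sum) auto
  have "a * ?s \<approx> a"
  proof (rule lspan_fix_right[OF a sA])
    fix b assume "b \<in> Mon_arcs M v"
    then obtain \<alpha> u e \<beta> s where b: "b = mon \<alpha> u (e # \<beta>)" "e \<in> M" "awalk s \<alpha> u" "awalk v (e # \<beta>) u"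
      by (auto simp: Mon_arcs_def)
    then have w: "e \<in> arcs G" "awalk (head G e) \<beta> u" "awalk (tail G e) (e # \<beta>) u"
      by (auto simp: awalk_Cons_iff)
    have *: "b * Ed f * Gh f \<approx> (if e = f then b else 0)" if f: "f \<in> M" for f
    proof -
      have fA: "f \<in> arcs G" using f M by blast
      have "b * Ed f * Gh f \<approx> (if e = f then mon \<alpha> u \<beta> else 0) * Gh f"
        unfolding b(1) using fA by (intro eqv_right mon_mult_Ed[OF b(3) w(3)]) auto
      moreover have "(if e = f then mon \<alpha> u \<beta> else 0) * Gh f = (if e = f then b else 0)"
        by (simp add: b(1) mon_def S_Cons mult.assoc)
      ultimately show ?thesis by simp
    qed
    have "b * ?s = (\<Sum>f\<in>M. b * Ed f * Gh f)" by (simp add: sum_distrib_left mult.assoc)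
    also have "\<dots> \<approx> (\<Sum>f\<in>M. if e = f then b else 0)" by (intro eqv_sum *)
    also have "\<dots> = b" using M(1) b(2) by simp
    finally show "b * ?s \<approx> b" .
  qed
  then have "a \<approx> a * ?s" by (rule eqv_sym)
  then show ?thesis by (simp add: sum_distrib_left mult.assoc)
qed

text \<open>
  By induction on the length \<open>n\<close> of the ghost paths. For each arc \<open>e\<close> from \<open>v\<close> the element \<open>ae\<close> of \<open>H\<close>
  involves only shorter ones, so that it is zero. If \<open>v\<close> emits finitely many arcs, but not none, then
  \<open>a\<close> is the sum of the elements \<open>aee\<^sup>*\<close>. Otherwise the combination \<open>b\<close> of paths in \<open>a\<close> turns out to be
  zero, and the rest of \<open>a\<close> is the sum of the elements \<open>aee\<^sup>*\<close> for the finitely many arcs \<open>e\<close> in it.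
\<close>

lemma Mon_to_in_I:
  assumes L: "condition_L G" and H: "two_sided H" and no: "\<And>v. v \<in> verts G \<Longrightarrow> V v \<notin> H"
    and "v \<in> verts G" "a \<in> lspan (Mon_to n v)" "a \<in> H"
  shows "a \<in> I"
  using assms(4-)
proof (induction n arbitrary: v a)
  case 0
  have "a \<in> lspan ((\<lambda>b. b * V v) ` paths_to v)"
    using 0(2)
  proof (rule lspan_mono)
    show "Mon_to 0 v \<subseteq> lspan ((\<lambda>b. b * V v) ` paths_to v)"
    proof
      fix p assume "p \<in> Mon_to 0 v"
      then obtain \<alpha> u s where "p = P \<alpha> * V v" "awalk s \<alpha> v"
        by (auto simp: Mon_to_def mon_def awalk_Nil_iff)
      then show "p \<in> lspan ((\<lambda>b. b * V v) ` paths_to v)"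
        by (auto intro!: lspan.base paths_to_closed)
    qed
  qed
  then have "\<exists>b\<in>paths_to v. a \<approx> b * V v"
  proof (induction rule: lspan.induct)
    case (base p)
    then obtain b where b: "b \<in> paths_to v" "p = b * V v" by blast
    then have "p \<approx> b * V v" using 0(1) paths_to_A[OF b(1)] by auto
    then show ?case using b(1) by blast
  next
    case (ideal p)
    then show ?case by (intro bexI[of _ 0]) (auto simp: eqv_0_iff paths_to_closed)
  next
    case (add p q)
    then obtain b b' where "b \<in> paths_to v" "b' \<in> paths_to v" "p \<approx> b * V v" "q \<approx> b' * V v" by blast
    then show ?case
      using eqv_add[of p "b * V v" q "b' * V v"]
      by (intro bexI[of _ "b + b'"]) (auto simp: distrib_right paths_to_closed)
  next
    case (scale p c)
    then obtain b where "b \<in> paths_to v" "p \<approx> b * V v" by blast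
    then show ?case
      using eqv_left[of "C c" p "b * V v"]
      by (intro bexI[of _ "C c * b"]) (auto simp: mult.assoc paths_to_closed)
  qed
  then obtain b where b: "b \<in> paths_to v" "a \<approx> b * V v" by blast
  then have "b * V v \<in> H" using two_sided_eqv[OF H eqv_sym] 0(3) by blast
  then have "b = 0" using paths_to_notin[OF L H no b(1) _ 0(1)] by blast
  then show ?case using b(2) by (simp add: eqv_0_iff)
next
  case (Suc n)
  have aF: "a \<in> F" using Suc.prems(3) two_sidedD(1)[OF H] by blast
  have aE: "a * Ed e \<in> I" if e: "e \<in> out_arcs G v" for e
  proof (rule Suc.IH)
    show "head G e \<in> verts G" using e by simp
    show "a * Ed e \<in> lspan (Mon_to n (head G e))"
      using Mon_to_Ed[of a n e] Suc.prems(2) e by simp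
    show "a * Ed e \<in> H" using e Suc.prems(3) by (intro two_sidedD(5)[OF H]) auto
  qed
  have aEG: "(\<Sum>e\<in>M. a * Ed e * Gh e) \<in> I" if "M \<subseteq> out_arcs G v" for M
  proof (rule I_sum)
    fix e assume "e \<in> M"
    then have e: "e \<in> out_arcs G v" using that by blast
    then show "a * Ed e * Gh e \<in> I" using I_closed(5)[OF aE[OF e], of "Gh e"] by auto
  qed
  show ?case
  proof (cases "finite (out_arcs G v) \<and> out_arcs G v \<noteq> {}")
    case True
    have "a * V v \<approx> a"
      using Suc.prems(1)
      by (intro lspan_fix_right[OF Suc.prems(2)]) (auto simp: Mon_to_def intro: mon_V)
    then have "a \<approx> a * V v" by (rule eqv_sym)
    also have "\<dots> \<approx> a * (\<Sum>e\<in>out_arcs G v. Ed e * Gh e)"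
      using True aF Suc.prems(1) by (intro eqv_left eqv_CK2) auto
    also have "\<dots> = (\<Sum>e\<in>out_arcs G v. a * Ed e * Gh e)"
      by (simp add: sum_distrib_left mult.assoc)
    finally show ?thesis using aEG[of "out_arcs G v"] eqv_I by blast
  next
    case not_regular: False
    obtain b M a' where b: "b \<in> paths_to v" and M: "finite M" "M \<subseteq> out_arcs G v"
      and a': "a' \<in> lspan (Mon_arcs M v)" and aba: "a \<approx> b * V v + a'"
      using Mon_to_split[OF Suc.prems(2,1)] by blast
    have a'A: "a' \<in> A"
      using lspan_F[OF a'] by (auto simp: Mon_arcs_def)
    have a'e: "a' * Ed e \<in> I" if e: "e \<in> arcs G" "e \<notin> M" for e
    proof -
      have "a' * Ed e \<in> lspan {}"
        using a'
      proof (rule lspan_right)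
        show "Ed e \<in> A" using e by auto
        fix p assume "p \<in> Mon_arcs M v"
        then obtain \<alpha> u f \<beta> s where p: "p = mon \<alpha> u (f # \<beta>)" "f \<in> M" "awalk s \<alpha> u" "awalk v (f # \<beta>) u"
          by (auto simp: Mon_arcs_def)
        then have "awalk (tail G f) (f # \<beta>) u" by (simp add: awalk_Cons_iff)
        from mon_mult_Ed[OF p(3) this e(1)] have "p * Ed e \<approx> 0"
          using p(1,2) e(2) by (auto split: if_splits)
        then show "p * Ed e \<in> lspan {}" by (simp add: eqv_0_iff lspan.ideal)
      qed
      then show ?thesis by (rule lspan_empty)
    qed
    have bV: "b * V v \<in> A" using b Suc.prems(1) paths_to_A by auto
    have "b = 0"
    proof (cases "out_arcs G v = {}")
      case True
      then have "a' \<in> I" using a' M by (auto simp: Mon_arcs_def intro: lspan_empty)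
      then have "(b * V v + a') - a' \<in> H"
        using two_sided_eqv[OF H eqv_sym[OF aba] Suc.prems(3)] two_sidedD(2)[OF H]
        by (intro two_sided_diff[OF H]) auto
      then show ?thesis using paths_to_notin[OF L H no b _ Suc.prems(1)] by simp
    next
      case False
      then have "infinite (out_arcs G v)" using not_regular by blast
      \<comment> \<open>An arc that annihilates the part with ghost paths, but preserves the paths in \<open>b\<close>.\<close>
      then obtain f where f: "f \<in> out_arcs G v" "f \<notin> M"
        using M(1) by (meson finite_subset subsetI)
      then have fG: "f \<in> arcs G" "tail G f = v" by auto
      have "(b * V v + a') * Ed f \<in> I"
        using eqv_I[OF eqv_right[OF _ aba, of "Ed f"]] aE[OF f(1)] fG by auto
      then have "(b * V v + a') * Ed f - a' * Ed f \<in> I"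
        using a'e[OF fG(1) f(2)] by (rule I_diff)
      then have "b * V v * Ed f \<in> I" by (simp add: algebra_simps)
      moreover have "b * V v * Ed f \<approx> b * Ed f * V (head G f)"
      proof -
        have "b * V v * Ed f = b * (V (tail G f) * Ed f)" by (simp add: fG mult.assoc)
        also have "\<dots> \<approx> b * Ed f" using fG b paths_to_A by (intro eqv_left eqv_E) auto
        also have "\<dots> \<approx> b * (Ed f * V (head G f))"
          using fG b paths_to_A by (intro eqv_left eqv_sym[OF eqv_E(2)]) auto
        finally show ?thesis by (simp add: mult.assoc)
      qed
      ultimately have "b * Ed f * V (head G f) \<in> H"
        using eqv_I two_sidedD(2)[OF H] by blast
      then have "b * Ed f = 0"
        using paths_to_notin[OF L H no paths_to_Ed(1)] b fG by auto
      then show ?thesis using paths_to_Ed(2)[of b f] b fG by auto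
    qed
    then have aa': "a \<approx> a'" using aba by simp
    have "a' \<approx> (\<Sum>e\<in>M. a' * Ed e * Gh e)"
      using M by (intro Mon_arcs_eqv[OF a']) auto
    also have "\<dots> \<approx> (\<Sum>e\<in>M. a * Ed e * Gh e)"
      using M by (intro eqv_sum eqv_right eqv_sym[OF aa']) auto
    finally have "a' \<in> I" using aEG[OF M(2)] eqv_I by blast
    then show ?thesis using aa' eqv_I by blast
  qed
qed

lemma Mon_to_mono: "n \<le> m \<Longrightarrow> Mon_to n v \<subseteq> lspan (Mon_to m v)"
  unfolding Mon_to_def using le_trans by (blast intro: lspan.base)

lemma F_mult_V:
  assumes "p \<in> F" "v \<in> verts G"
  shows "\<exists>n. p * V v \<in> lspan (Mon_to n v)"
  using F_lspan[OF assms(1)]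
proof (induction rule: lspan.induct)
  case (base b)
  then obtain \<alpha> u \<beta> s t where b: "b = mon \<alpha> u \<beta>" "awalk s \<alpha> u" "awalk t \<beta> u"
    by (auto simp: Mon_def)
  show ?case
  proof (cases "t = v")
    case True
    then have "b \<in> Mon_to (length \<beta>) v" unfolding b(1) using b by (intro Mon_toI) auto
    moreover have "b * V v \<approx> b" using mon_V[OF b(2,3)] b(1) True by simp
    ultimately show ?thesis using lspan_eqv[OF lspan.base] by blast
  next
    case False
    then have "b * V v \<approx> 0" unfolding b(1) using assms(2) by (intro mon_V_0[OF b(2,3)]) auto
    then show ?thesis by (auto simp: eqv_0_iff intro: lspan.ideal)
  qed
next
  case (ideal p)
  then have "p * V v \<in> I" using assms(2) by auto
  then show ?case by (intro exI[of _ 0] lspan.ideal)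
next
  case (add p q)
  then obtain n m where nm: "p * V v \<in> lspan (Mon_to n v)" "q * V v \<in> lspan (Mon_to m v)" by blast
  have "Mon_to n v \<subseteq> lspan (Mon_to (max n m) v)" "Mon_to m v \<subseteq> lspan (Mon_to (max n m) v)"
    by (rule Mon_to_mono, simp)+
  then have "p * V v + q * V v \<in> lspan (Mon_to (max n m) v)"
    using nm by (intro lspan.add) (blast intro: lspan_mono)+
  then show ?case by (auto simp: distrib_right)
next
  case (scale p c)
  then obtain n where "p * V v \<in> lspan (Mon_to n v)" by blast
  from lspan.scale[OF this, of c] show ?case by (auto simp: mult.assoc)
qed

text \<open>Finite sums of vertices are local units.\<close>

lemma local_units:
  assumes "p \<in> F"
  shows "\<exists>W. finite W \<and> W \<subseteq> verts G \<and> p \<approx> (\<Sum>v\<in>W. p * V v)"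
proof -
  obtain B where B: "B \<subseteq> Mon UNIV" "finite B" "p \<in> lspan B"
    using lspan_finite[OF F_lspan[OF assms]] by blast
  have "\<exists>t. b * V t \<approx> b \<and> t \<in> verts G \<and> (\<forall>v\<in>verts G. v \<noteq> t \<longrightarrow> b * V v \<approx> 0)" if "b \<in> B" for b
  proof -
    obtain \<alpha> u \<beta> s t where b: "b = mon \<alpha> u \<beta>" and w: "awalk s \<alpha> u" "awalk t \<beta> u"
      using \<open>b \<in> B\<close> B(1) by (auto simp: Mon_def)
    show ?thesis
      unfolding b using mon_V[OF w] mon_V_0[OF w] w by (intro exI[of _ t]) auto
  qed
  then obtain t where t: "\<And>b. b \<in> B \<Longrightarrow> b * V (t b) \<approx> b \<and> t b \<in> verts G \<and>
      (\<forall>v\<in>verts G. v \<noteq> t b \<longrightarrow> b * V v \<approx> 0)"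
    by metis
  have W: "finite (t ` B)" "t ` B \<subseteq> verts G" using B(2) t by auto
  have "p * (\<Sum>v\<in>t ` B. V v) \<approx> p"
  proof (rule lspan_fix_right[OF B(3)])
    show "(\<Sum>v\<in>t ` B. V v) \<in> A" using W by (intro A_sum) auto
    fix b assume b: "b \<in> B"
    have "b * (\<Sum>v\<in>t ` B. V v) = (\<Sum>v\<in>t ` B. b * V v)" by (rule sum_distrib_left)
    also have "\<dots> \<approx> (\<Sum>v\<in>t ` B. if v = t b then b else 0)"
      using t[OF b] W(2) by (intro eqv_sum) auto
    also have "\<dots> = b" using W(1) b by simp
    finally show "b * (\<Sum>v\<in>t ` B. V v) \<approx> b" .
  qed
  then show ?thesis
    using W by (intro exI[of _ "t ` B"]) (auto simp: sum_distrib_left intro: eqv_sym)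
qed

text \<open>A form of the Cuntz--Krieger uniqueness theorem.\<close>

lemma two_sided_no_vertex:
  assumes L: "condition_L G" and H: "two_sided H" and no: "\<And>v. v \<in> verts G \<Longrightarrow> V v \<notin> H"
    and a: "a \<in> H"
  shows "a \<in> I"
proof -
  have aF: "a \<in> F" using two_sidedD(1)[OF H a] .
  obtain W where W: "finite W" "W \<subseteq> verts G" "a \<approx> (\<Sum>v\<in>W. a * V v)"
    using local_units[OF aF] by blast
  have "a * V v \<in> I" if "v \<in> W" for v
  proof -
    have v: "v \<in> verts G" using that W(2) by blast
    obtain n where "a * V v \<in> lspan (Mon_to n v)" using F_mult_V[OF aF v] by blast
    moreover have "a * V v \<in> H" using a v by (intro two_sidedD(5)[OF H]) auto
    ultimately show ?thesis using Mon_to_in_I[OF L H no v] by blast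
  qed
  then have "(\<Sum>v\<in>W. a * V v) \<in> I"
    by (rule I_sum)
  then show ?thesis using eqv_I[OF W(3)] by blast
qed

section \<open>Sufficiency of the three conditions\<close>

lemma compress_mon:
  assumes "awalk s \<alpha> u"
  shows "S \<alpha> * mon \<alpha> u \<alpha> * (P \<alpha> * V u) \<approx> V u"
proof -
  have "S \<alpha> * mon \<alpha> u \<alpha> * (P \<alpha> * V u) = (S \<alpha> * P \<alpha> * V u) * (S \<alpha> * P \<alpha> * V u)"
    by (simp add: mon_def mult.assoc)
  also have "\<dots> \<approx> V u * V u"
    using assms by (intro eqv_mult eqv_SPV)
  also have "\<dots> \<approx> V u" using assms by (intro eqv_VV) auto
  finally show ?thesis .
qed

lemma mon_mult_extend:
  assumes "awalk s \<alpha> u" "awalk u \<epsilon> w" "awalk t \<delta> w"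
  shows "mon \<alpha> u \<alpha> * mon (\<alpha> @ \<epsilon>) w \<delta> \<approx> mon (\<alpha> @ \<epsilon>) w \<delta>"
proof -
  have "mon \<alpha> u \<alpha> * mon (\<alpha> @ \<epsilon>) w \<delta> = P \<alpha> * (V u * (S \<alpha> * P (\<alpha> @ \<epsilon>) * V w)) * S \<delta>"
    by (simp add: mon_def mult.assoc)
  also have "\<dots> \<approx> P \<alpha> * (V u * (P \<epsilon> * V w)) * S \<delta>"
    using assms by (intro eqv_left eqv_right eqv_cancel_prefix) auto
  also have "\<dots> \<approx> P \<alpha> * (P \<epsilon> * V w) * S \<delta>"
    using assms by (intro eqv_left eqv_right eqv_VP) auto
  finally show ?thesis by (simp add: mon_def P_append mult.assoc)
qed

text \<open>
  The paths \<open>l n\<close> from \<open>v0\<close> to \<open>v n\<close> extend each other. The idempotents \<open>f n\<close> decrease, and the left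
  ideal \<open>J0\<close> of elements that are annihilated by some \<open>f n\<close> on the right does not contain \<open>v0\<close>. A left
  ideal above \<open>J0\<close> that is maximal among those without \<open>v0\<close> is a primitive ideal.
\<close>

lemma primitive_ideal_exists:
  assumes L: "condition_L G"
    and l: "\<And>n. awalk v0 (l n) (v n)" "\<And>n. \<exists>\<epsilon>. awalk (v n) \<epsilon> (v (Suc n)) \<and> l (Suc n) = l n @ \<epsilon>"
    and l0: "l 0 = []" and reach: "\<And>w. w \<in> verts G \<Longrightarrow> \<exists>n. w \<rightarrow>\<^sup>* v n"
  shows "\<exists>J. primitive_ideal J"
proof -
  define f where "f n = mon (l n) (v n) (l n)" for n
  have f0: "f 0 = V v0"
    using l(1)[of 0] l0 by (simp add: f_def mon_def awalk_Nil_iff)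
  have v0: "v0 \<in> verts G" using l(1)[of 0] by auto
  have fF: "f n \<in> F" for n using l(1) by (auto simp: f_def)
  have f_notin: "f n \<notin> I" for n
  proof
    assume "f n \<in> I"
    then have "S (l n) * f n * (P (l n) * V (v n)) \<in> I"
      using l(1)[of n] by (intro I_closed) auto
    then have "V (v n) \<in> I"
      using compress_mon[OF l(1)[of n]] eqv_I unfolding f_def by blast
    then show False by (simp add: V_notin_I)
  qed
  have ext: "\<exists>\<epsilon>. awalk (v n) \<epsilon> (v m) \<and> l m = l n @ \<epsilon>" if "n \<le> m" for n m
    using that
  proof (induction m rule: dec_induct)
    case base
    then show ?case using l(1)[of n] by (intro exI[of _ "[]"]) (auto simp: awalk_Nil_iff)
  next
    case (step m)
    then obtain \<epsilon> \<epsilon>' where "awalk (v n) \<epsilon> (v m)" "l m = l n @ \<epsilon>"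
      "awalk (v m) \<epsilon>' (v (Suc m))" "l (Suc m) = l m @ \<epsilon>'"
      using l(2) by metis
    then show ?case by (intro exI[of _ "\<epsilon> @ \<epsilon>'"]) (auto intro: awalk_appendI)
  qed
  have f_mult: "f n * f m \<approx> f m" if nm: "n \<le> m" for n m
  proof -
    obtain \<epsilon> where "awalk (v n) \<epsilon> (v m)" "l m = l n @ \<epsilon>" using ext[OF nm] by blast
    then show ?thesis
      using mon_mult_extend[OF l(1)[of n] _ l(1)[of m]] by (simp add: f_def)
  qed
  define J0 where "J0 = {a \<in> F. \<exists>n. a * f n \<in> I}"
  have J0_mono: "a * f m \<in> I" if a: "a * f n \<in> I" "a \<in> F" and nm: "n \<le> m" for a n m
  proof -
    have "a * f m \<approx> a * (f n * f m)"
      using a by (intro eqv_left eqv_sym[OF f_mult[OF nm]]) auto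
    moreover have "a * (f n * f m) \<in> I"
      using a(1) fF by (simp flip: mult.assoc)
    ultimately show ?thesis using eqv_I by blast
  qed
  have J0: "left_ideal J0"
    unfolding left_ideal_def
  proof (intro conjI ballI)
    fix p q assume pq: "p \<in> J0" "q \<in> J0"
    then obtain n m where nm: "p \<in> F" "q \<in> F" "p * f n \<in> I" "q * f m \<in> I"
      by (auto simp: J0_def)
    then have "p * f (max n m) \<in> I" "q * f (max n m) \<in> I"
      by (auto intro: J0_mono)
    then have "(p + q) * f (max n m) \<in> I"
      unfolding distrib_right by (rule I_closed(2))
    then show "p + q \<in> J0" using nm by (auto simp: J0_def)
  next
    fix a p assume ap: "a \<in> F" "p \<in> J0"
    then obtain n where "p \<in> F" "p * f n \<in> I" by (auto simp: J0_def)
    then have "a * p * f n \<in> I" using ap(1) by (auto simp: mult.assoc)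
    then show "a * p \<in> J0" using ap by (auto simp: J0_def)
  qed (auto simp: J0_def)
  have I_J0: "I \<subseteq> J0" using fF by (auto simp: J0_def)
  \<comment> \<open>Modulo \<open>J0\<close>, the vertex \<open>v0\<close> is a right unit, so that proper left ideals above \<open>J0\<close> omit it.\<close>
  have mod: "a - a * V v0 \<in> J0" if a: "a \<in> F" for a
  proof -
    have "a * V v0 * V v0 \<approx> a * V v0"
      using eqv_left[OF F_in_A[OF a] eqv_VV[OF v0]] by (simp add: mult.assoc)
    then have "a * V v0 - a * V v0 * V v0 \<in> I"
      using eqv_sym by (auto simp: eqv_def)
    then have "(a - a * V v0) * f 0 \<in> I" by (simp add: f0 algebra_simps)
    then show ?thesis using a v0 by (auto simp: J0_def)
  qed
  have diff: "V v0 - f n \<in> J0" for n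
  proof -
    have "V v0 * f n \<approx> f n"
      unfolding f_def by (rule V_mon[OF l(1) l(1)])
    then have "(V v0 - f n) * f n \<approx> f n - f n"
      unfolding left_diff_distrib using f_mult[of n n] by (intro eqv_diff) auto
    then have "(V v0 - f n) * f n \<in> I" by (simp add: eqv_0_iff)
    then show ?thesis using v0 fF by (auto simp: J0_def)
  qed
  have "V v0 \<notin> J0"
  proof
    assume "V v0 \<in> J0"
    then obtain n where "V v0 * f n \<in> I" by (auto simp: J0_def)
    moreover have "V v0 * f n \<approx> f n"
      unfolding f_def by (rule V_mon[OF l(1) l(1)])
    ultimately show False using f_notin eqv_I by blast
  qed
  define \<J> where "\<J> = {J. left_ideal J \<and> J0 \<subseteq> J \<and> V v0 \<notin> J}"
  have "\<exists>J\<in>\<J>. \<forall>J'\<in>\<J>. J \<subseteq> J' \<longrightarrow> J' = J"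
  proof (rule subset_Zorn_nonempty)
    show "\<J> \<noteq> {}" using J0 \<open>V v0 \<notin> J0\<close> by (auto simp: \<J>_def)
    fix \<C> assume \<C>: "\<C> \<noteq> {}" "subset.chain \<J> \<C>"
    then have li: "left_ideal J" "J0 \<subseteq> J" "V v0 \<notin> J" if "J \<in> \<C>" for J
      using that by (auto simp: \<J>_def subset.chain_def)
    have "left_ideal (\<Union>\<C>)"
      unfolding left_ideal_def
    proof (intro conjI ballI)
      show "\<Union>\<C> \<subseteq> F" using li(1) left_idealD(1) by blast
      show "0 \<in> \<Union>\<C>" using \<C>(1) li(1) left_idealD(2) by blast
      show "- p \<in> \<Union>\<C>" if "p \<in> \<Union>\<C>" for p using that li(1) left_idealD(4) by blast
      show "a * p \<in> \<Union>\<C>" if "a \<in> F" "p \<in> \<Union>\<C>" for a p using that li(1) left_idealD(5) by blast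
      fix p q assume "p \<in> \<Union>\<C>" "q \<in> \<Union>\<C>"
      then obtain J J' where JJ: "J \<in> \<C>" "J' \<in> \<C>" "p \<in> J" "q \<in> J'" by blast
      then have "J \<subseteq> J' \<or> J' \<subseteq> J" using \<C>(2) by (auto simp: subset.chain_def)
      then obtain J'' where "J'' \<in> \<C>" "p \<in> J''" "q \<in> J''" using JJ by blast
      then show "p + q \<in> \<Union>\<C>"
        using left_idealD(3)[OF li(1)] by blast
    qed
    then show "\<Union>\<C> \<in> \<J>" using \<C>(1) li(2,3) by (auto simp: \<J>_def)
  qed
  then obtain J where J_in: "J \<in> \<J>" and J_max: "\<forall>J'\<in>\<J>. J \<subseteq> J' \<longrightarrow> J' = J"
    by (rule bexE)
  have J: "left_ideal J" "J0 \<subseteq> J" "V v0 \<notin> J"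
    using J_in by (simp_all add: \<J>_def)
  have max: "J' = J" if "left_ideal J'" "J0 \<subseteq> J'" "V v0 \<notin> J'" "J \<subseteq> J'" for J'
    using J_max that by (simp add: \<J>_def)
  note JD = left_idealD[OF J(1)]
  have IJ: "I \<subseteq> J" using I_J0 J(2) by blast
  have "primitive_ideal J"
    unfolding primitive_ideal_def
  proof (intro conjI allI impI ballI J(1) IJ)
    show "J \<noteq> F" using J(3) v0 by auto
  next
    fix J' assume J': "left_ideal J'" "J \<subseteq> J'"
    note J'D = left_idealD[OF J'(1)]
    show "J' = J \<or> J' = F"
    proof (cases "V v0 \<in> J'")
      case False
      then show ?thesis using max J' J(2) by blast
    next
      case True
      have "a \<in> J'" if a: "a \<in> F" for a
      proof -
        have "a - a * V v0 \<in> J'" using mod[OF a] J(2) J'(2) by blast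
        moreover have "a * V v0 \<in> J'" using J'D(5)[OF a True] .
        ultimately have "(a - a * V v0) + a * V v0 \<in> J'" by (rule J'D(3))
        then show ?thesis by simp
      qed
      then show ?thesis using J'D(1) by blast
    qed
  next
    fix p assume p: "p \<in> F" "\<forall>q\<in>F. p * q \<in> J"
    \<comment> \<open>The annihilator of \<open>F / J\<close>.\<close>
    define H where "H = {p \<in> F. \<forall>q\<in>F. p * q \<in> J}"
    have H: "two_sided H"
      unfolding two_sided_def
    proof (intro conjI ballI)
      show "I \<subseteq> H" using IJ by (auto simp: H_def)
      fix p q assume "p \<in> H" "q \<in> H"
      then show "p + q \<in> H" by (auto simp: H_def distrib_right intro: JD)
    next
      fix p assume "p \<in> H"
      then show "- p \<in> H" by (auto simp: H_def intro: JD)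
    next
      fix a p assume "a \<in> F" "p \<in> H"
      then show "a * p \<in> H" "p * a \<in> H" by (auto simp: H_def mult.assoc intro: JD)
    qed (auto simp: H_def)
    have no_vertex: "V w \<notin> H" if w: "w \<in> verts G" for w
    proof
      assume wH: "V w \<in> H"
      obtain n where "w \<rightarrow>\<^sup>* v n" using reach[OF w] by blast
      then obtain \<pi> where \<pi>: "awalk w \<pi> (v n)" by (auto simp: reachable_awalk)
      have "(V (v n) * S \<pi>) * V w * (P \<pi> * V (v n)) \<in> H"
        using wH \<pi> by (intro two_sidedD(5)[OF H] two_sidedD(4)[OF H]) auto
      then have "V (v n) \<in> H"
        by (rule two_sided_eqv[OF H eqv_sym[OF compress_vertex[OF \<pi>]]])
      then have "(P (l n) * V (v n)) * V (v n) * (V (v n) * S (l n)) \<in> H"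
        using l(1)[of n] by (intro two_sidedD(5)[OF H] two_sidedD(4)[OF H]) auto
      moreover have "f n \<approx> (P (l n) * V (v n)) * V (v n) * (V (v n) * S (l n))"
      proof -
        have vn: "v n \<in> verts G" using l(1)[of n] by auto
        have "V (v n) * (V (v n) * V (v n)) \<approx> V (v n)"
          using eqv_trans[OF eqv_left[OF _ eqv_VV[OF vn]] eqv_VV[OF vn]] vn by auto
        then have "P (l n) * (V (v n) * (V (v n) * V (v n))) * S (l n) \<approx> f n"
          unfolding f_def mon_def using l(1)[of n] by (intro eqv_left eqv_right) auto
        from eqv_sym[OF this] show ?thesis by (simp add: mult.assoc)
      qed
      ultimately have "f n \<in> H" by (rule two_sided_eqv[OF H, rotated])
      then have "f n * V v0 \<in> J" using v0 by (simp add: H_def)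
      moreover have "f n \<approx> f n * V v0"
        unfolding f_def by (rule eqv_sym[OF mon_V[OF l(1) l(1)]])
      ultimately have "f n \<in> J" by (rule eqv_left_ideal[OF J(1) IJ, rotated])
      moreover have "V v0 - f n \<in> J" using diff J(2) by blast
      ultimately have "(V v0 - f n) + f n \<in> J" by (intro JD(3))
      then show False using J(3) by simp
    qed
    have "p \<in> H" using p by (simp add: H_def)
    with no_vertex show "p \<in> I" by (rule two_sided_no_vertex[OF L H])
  qed
  then show ?thesis by blast
qed

lemma primitive_ideal_if_conditions:
  assumes MT3: "condition_MT3 G" and L: "condition_L G"
    and CSP: "countable_separation_property G (verts G)" and ne: "verts G \<noteq> {}"
  shows "\<exists>J. primitive_ideal J"
proof -
  obtain D where D: "D \<subseteq> verts G" "countable D" "\<And>w. w \<in> verts G \<Longrightarrow> \<exists>d\<in>D. w \<rightarrow>\<^sup>* d"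
    using CSP unfolding countable_separation_property_def by blast
  have "D \<noteq> {}" using D(3) ne by blast
  define d where "d = from_nat_into D"
  have d: "d n \<in> D" for n using \<open>D \<noteq> {}\<close> by (simp add: d_def from_nat_into)
  have d_surj: "\<exists>n. d n = x" if "x \<in> D" for x
    using from_nat_into_surj[OF D(2) that] by (simp add: d_def)
  have dG: "d n \<in> verts G" for n using d D(1) by blast
  \<comment> \<open>The \<open>n\<close>-th path ends at a vertex that \<open>d n\<close> reaches, and the path for \<open>n = 0\<close> is trivial.\<close>
  define Q where "Q n = (\<lambda>(v, l). awalk (d 0) l v \<and> d n \<rightarrow>\<^sup>* v \<and> (n = 0 \<longrightarrow> l = []))" for n :: nat
  define R where "R = (\<lambda>(v, l) (v', l'). \<exists>\<epsilon>. awalk v \<epsilon> v' \<and> l' = l @ \<epsilon>)"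
  have "\<exists>f. \<forall>n. Q n (f n) \<and> R (f n) (f (Suc n))"
  proof (rule dependent_nat_choice)
    show "\<exists>x. Q 0 x" using dG by (intro exI[of _ "(d 0, [])"]) (auto simp: Q_def awalk_Nil_iff)
    fix x n assume "Q n x"
    then obtain v l where x: "x = (v, l)" and w: "awalk (d 0) l v" by (auto simp: Q_def)
    then have "v \<in> verts G" by auto
    then obtain u where u: "v \<rightarrow>\<^sup>* u" "d (Suc n) \<rightarrow>\<^sup>* u"
      using MT3 dG unfolding condition_MT3_def by blast
    then obtain \<epsilon> where "awalk v \<epsilon> u" by (auto simp: reachable_awalk)
    then show "\<exists>y. Q (Suc n) y \<and> R x y"
      using u w awalk_appendI[OF w]
      by (intro exI[of _ "(u, l @ \<epsilon>)"]) (auto simp: Q_def R_def x)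
  qed
  then obtain f where f: "\<And>n. Q n (f n)" "\<And>n. R (f n) (f (Suc n))" by blast
  show ?thesis
  proof (rule primitive_ideal_exists[OF L,
        where v = "\<lambda>n. fst (f n)" and l = "\<lambda>n. snd (f n)" and ?v0.0 = "d 0"])
    show "awalk (d 0) (snd (f n)) (fst (f n))" for n
      using f(1)[of n] by (auto simp: Q_def split: prod.splits)
    show "\<exists>\<epsilon>. awalk (fst (f n)) \<epsilon> (fst (f (Suc n))) \<and> snd (f (Suc n)) = snd (f n) @ \<epsilon>" for n
      using f(2)[of n] by (auto simp: R_def split: prod.splits)
    show "snd (f 0) = []"
      using f(1)[of 0] by (auto simp: Q_def split: prod.splits)
    show "\<exists>n. w \<rightarrow>\<^sup>* fst (f n)" if w: "w \<in> verts G" for w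
    proof -
      obtain x where "x \<in> D" "w \<rightarrow>\<^sup>* x" using D(3)[OF w] by blast
      then obtain n where "w \<rightarrow>\<^sup>* d n" using d_surj by blast
      moreover have "d n \<rightarrow>\<^sup>* fst (f n)"
        using f(1)[of n] by (auto simp: Q_def split: prod.splits)
      ultimately show ?thesis using reachable_trans by blast
    qed
  qed
qed

theorem left_primitive_iff:
  "left_primitive L \<longleftrightarrow>
    condition_MT3 G \<and> condition_L G \<and> countable_separation_property G (verts G)"
proof (cases "verts G = {}")
  case True
  have "condition_L G"
    unfolding condition_L_def cycle_def using True awalk_hd_in_verts by blast
  moreover have "condition_MT3 G" "countable_separation_property G (verts G)"
    using True by (auto simp: condition_MT3_def countable_separation_property_def)
  ultimately show ?thesis
    using left_primitive_if_no_vertices[OF True] by blast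
next
  case False
  show ?thesis
  proof
    assume "left_primitive L"
    then obtain J where "primitive_ideal J"
      using primitive_ideal_if_left_primitive[OF _ False] by blast
    then show "condition_MT3 G \<and> condition_L G \<and> countable_separation_property G (verts G)"
      using MT3_if_primitive_ideal L_if_primitive_ideal CSP_if_primitive_ideal by blast
  next
    assume "condition_MT3 G \<and> condition_L G \<and> countable_separation_property G (verts G)"
    then show "left_primitive L"
      using primitive_ideal_if_conditions[OF _ _ _ False] left_primitive_if_primitive_ideal by blast
  qed
qed

end

theorem theorem4p7:
  fixes E :: "('v,'e) pre_digraph"
  assumes "wf_digraph E"
  shows "left_primitive (leavitt_path_algebra E :: ('v,'e,'k::field) lpa_elem ring) \<longleftrightarrow>
    condition_MT3 E \<and> condition_L E \<and> countable_separation_property E (verts E)"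
proof -
  interpret wf_digraph E by fact
  interpret leavitt_path E "TYPE('k)" by unfold_locales
  show ?thesis by (rule left_primitive_iff)
qed

end
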